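(* Let $\alpha\in(0,1]$ and let $(Z_n)_{n\ge0}$ be the Diaconis and Freedman's chain in $\Delta_2$ with weight functions $p_0,p_1,p_2\in\mathcal H_\alpha(\Delta_2)$ and transition operator $P$. Let $\mathcal I(P)$ be the set of invariant probability measures of $(Z_n)_{n\ge0}$ and $\mathcal K_m$ the set of minimal $P$-absorbing compact subsets of $\Delta_2$. Then one of the following options holds. 1. If $\mathcal K_m=\{\{\mathbf{e}_0\},\{\mathbf{e}_1\},\{\mathbf{e}_2\}\}$, then $\mathcal I(P)=co\{\delta_{\mathbf{e}_0},\delta_{\mathbf{e}_1},\delta_{\mathbf{e}_2}\}$ and, for any $\mathbf{x}\in\Delta_2$, the chain $(Z_n)$ converges $\mathbb{P}_{\mathbf{x}}$-a.s. to a random variable $Z_\infty$ with values in $\{\mathbf{e}_0,\mathbf{e}_1,\mathbf{e}_2\}$ and distribution $\mathbb{P}_{\mathbf{x}}(Z_\infty=\mathbf{e}_i)=h_i(\mathbf{x})$, $i\in\{0,1,2\}$, where $h_i$ is a nonnegative function in $\mathcal H_\alpha(\Delta_2)$ such that $Ph_i=h_i$, $h_0+h_1+h_2\equiv1$, and $h_i(\mathbf{e}_j)=0$ for all $i\ne j$ in $\{0,1,2\}$. Moreover, there exist $\kappa>0$ and $\rho\in[0,1)$ such that for all $\varphi\in\mathcal H_\alpha(\Delta_2)$, $\mathbf{x}\in\Delta_2$, $n\ge 0$, $$\Big|P^n\varphi(\mathbf{x})-h_0(\mathbf{x})\varphi(\mathbf{e}_0)-h_1(\mathbf{x})\varphi(\mathbf{e}_1)-h_2(\mathbf{x})\varphi(\mathbf{e}_2)\Big|\le\kappa\rho^n\|\varphi\|_\alpha.$$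 2. If $\mathcal K_m=\{\{\mathbf{e}_i\},\{\mathbf{e}_j\}\}$ for some distinct $i,j\in\{0,1,2\}$, then $\mathcal I(P)=co\{\delta_{\mathbf{e}_i},\delta_{\mathbf{e}_j}\}$ and, for any $\mathbf{x}\in\Delta_2$, $(Z_n)$ converges $\mathbb{P}_{\mathbf{x}}$-a.s. to a random variable $Z_\infty$ with values in $\{\mathbf{e}_i,\mathbf{e}_j\}$ and distribution $\mathbb{P}_{\mathbf{x}}(Z_\infty=\mathbf{e}_k)=h_k(\mathbf{x})$, $k\in\{i,j\}$, where $h_i,h_j$ are the unique functions in $\mathcal H_\alpha(\Delta_2)$ such that $Ph_k=h_k$, $h_i+h_j\equiv1$, and $h_k(\mathbf{e}_l)=\delta_{kl}$ for all $k,l\in\{i,j\}$. Moreover, there exist $\kappa>0$ and $\rho\in[0,1)$ such that for all $\varphi\in\mathcal H_\alpha(\Delta_2)$, $\mathbf{x}\in\Delta_2$, $n\ge 0$, $$\Big|P^n\varphi(\mathbf{x})-h_i(\mathbf{x})\varphi(\mathbf{e}_i)-h_j(\mathbf{x})\varphi(\mathbf{e}_j)\Big|\le\kappa\rho^n\|\varphi\|_\alpha.$$ 3. If $\mathcal K_m=\{\{\mathbf{e}_i\}\}$ for some $i\in\{0,1,2\}$, then $\mathcal I(P)=\{\delta_{\mathbf{e}_i}\}$ and, for any $\mathbf{x}\in\Delta_2$, $(Z_n)$ converges $\mathbb{P}_{\mathbf{x}}$-a.s. to $\mathbf{e}_i$. Moreover, there exist $\kappa>0$ and $\rho\in[0,1)$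 such that for all $\varphi\in\mathcal H_\alpha(\Delta_2)$, $\mathbf{x}\in\Delta_2$, $n\ge 0$, $$|P^n\varphi(\mathbf{x})-\varphi(\mathbf{e}_i)|\le\kappa\rho^n\|\varphi\|_\alpha.$$ 4. If $\mathcal K_m=\{[\mathbf{e}_i,\mathbf{e}_j]\}$ for some distinct $i,j\in\{0,1,2\}$, then $\mathcal I(P)=\{\mu_\infty^{ij}\}$, where $\mu^{ij}_\infty$ is the probability measure on the edge $[\mathbf{e}_i,\mathbf{e}_j]$ whose density with respect to $dt$, in the parametrization $t\in(0,1)\mapsto t\mathbf{e}_i+(1-t)\mathbf{e}_j$, is $$t\mapsto C\exp\left(\int_s^t\frac{p_i(u\mathbf{e}_i+(1-u)\mathbf{e}_j)}{1-u}\,du+\int_t^s\frac{p_j(u\mathbf{e}_i+(1-u)\mathbf{e}_j)}{u}\,du\right),$$ with $s\in(0,1)$ any fixed reference point and $C>0$ the normalizing constant. For any $\mathbf{x}\in\Delta_2$, the chain $(Z_n)$ converges $\mathbb{P}_{\mathbf{x}}$-a.s. to a random variable $Z_\infty$ with values in $[\mathbf{e}_i,\mathbf{e}_j]$ and distribution $\mu^{ij}_\infty$. Moreover, there exist $\kappa>0$ and $\rho\in[0,1)$ such that for all $\varphi\in\mathcal H_\alpha(\Delta_2)$, $\mathbf{x}\in\Delta_2$, $n\ge 0$, $$|P^n\varphi(\mathbf{x})-\mu^{ij}_\infty(\varphi)|\le\kappa\rho^n\|\varphi\|_\alpha.$$ 5. If $\mathcal K_m=\{\{\mathbf{e}_k\},[\mathbf{e}_i,\mathbf{e}_j]\}$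 for some $\{i,j,k\}=\{0,1,2\}$, then $\mathcal I(P)=co\{\delta_{\mathbf{e}_k},\mu_\infty^{ij}\}$, with $\mu^{ij}_\infty$ the probability measure on $[\mathbf{e}_i,\mathbf{e}_j]$ given by the density formula in option 4, and, for any $\mathbf{x}\in\Delta_2$, the chain $(Z_n)$ started at $\mathbf{x}$ converges to $\mathbf{e}_k$ with some probability $h_k(\mathbf{x})$ and to $[\mathbf{e}_i,\mathbf{e}_j]$ with some probability $h_{ij}(\mathbf{x})$. Moreover, there exist $\kappa>0$ and $\rho\in[0,1)$ such that for all $\varphi\in\mathcal H_\alpha(\Delta_2)$, $\mathbf{x}\in\Delta_2$, $n\ge 0$, $$\Big|P^n\varphi(\mathbf{x})-h_k(\mathbf{x})\varphi(\mathbf{e}_k)-h_{ij}(\mathbf{x})\mu^{ij}_\infty(\varphi)\Big|\le\kappa\rho^n\|\varphi\|_\alpha.$$ 6. If $\mathcal K_m=\{K_\infty\}$ for a compact set $K_\infty\subseteq\Delta_2$ with $K_\infty\cap\mathring{\Delta}_2\ne\emptyset$ (possibly $K_\infty=\Delta_2$), then $\mathcal I(P)=\{\mu_\infty\}$, where $\mu_\infty$ is a probability measure on $\Delta_2$ with support $K_\infty$.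
   Context: $\Delta_2=\{(x_1,x_2): x_1,x_2\ge0,\ x_1+x_2\le1\}$ is the closed triangle with interior $\mathring{\Delta}_2$ and vertices $\mathbf{e}_0=(0,0)$, $\mathbf{e}_1=(1,0)$, $\mathbf{e}_2=(0,1)$; $[\mathbf{a},\mathbf{b}]$ is the closed segment; $co$ denotes convex hull; $\delta_{\mathbf{a}}$ is the Dirac mass at $\mathbf{a}$ and $\delta_{kl}$ the Kronecker symbol. Given nonnegative continuous weight functions $p_0,p_1,p_2$ on $\Delta_2$ with $p_0+p_1+p_2\equiv1$, the Diaconis and Freedman's chain $(Z_n)_{n\ge0}$ is the Markov chain on $\Delta_2$ which, when at $\mathbf{x}$, chooses the vertex $\mathbf{e}_i$ with probability $p_i(\mathbf{x})$ and then moves to $t\mathbf{x}+(1-t)\mathbf{e}_i$ with $t$ uniform on $(0,1)$. $\mathbb{P}_{\mathbf{x}}$ is the law of the chain started at $Z_0=\mathbf{x}$. The transition operator is $Pf(\mathbf{x})=\sum_{i=0}^2p_i(\mathbf{x})\int_0^1f(t\mathbf{x}+(1-t)\mathbf{e}_i)\,dt$ for bounded measurable $f$. A Borel probability measure $\nu$ is invariant if $\nu(Pf)=\nu(f)$ for all bounded measurable $f$, where $\nu(f)=\int f\,d\nu$. For $0<\alpha\le1$, $\mathcal H_\alpha(\Delta_2)$ is the space of $\alpha$-Hölder continuous functions $f:\Delta_2\to\mathbb{C}$ with norm $\|f\|_\alpha=\|f\|_\infty+\sup_{\mathbf{x}\ne\mathbf{y}}\frac{|f(\mathbf{x})-f(\mathbf{y})|}{|\mathbf{x}-\mathbf{y}|^\alpha}$.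 A non-empty compact set $K\subseteq\Delta_2$ is $P$-absorbing if $P\mathbf{1}_{\Delta_2\setminus K}(\mathbf{x})=0$ for all $\mathbf{x}\in K$; it is minimal if it contains no proper $P$-absorbing compact subset. $\mathcal K_m$ is the set of all minimal $P$-absorbing compact subsets.
   Formalization: In option 4, a.s. convergence of the chain to a random variable with law μ^{ij} is false (e.g. p_0=p_1=1/2, p_2=0: steps do not vanish); it is replaced by a.s. convergence of the distance to the edge [e_i,e_j] to 0 together with convergence in distribution to μ^{ij}. *)

theory Defs
  imports "HOL-Probability.Probability"
begin

type_synonym point = "real \<times> real"

definition simplex2 :: "point set" where
  "simplex2 = {x. 0 \<le> fst x \<and> 0 \<le> snd x \<and> fst x + snd x \<le> 1}"

definition vertex :: "nat \<Rightarrow> point" where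
  "vertex i = (if i = 0 then (0, 0) else if i = 1 then (1, 0) else (0, 1))"

abbreviation edge :: "nat \<Rightarrow> nat \<Rightarrow> point set" where
  "edge i j \<equiv> closed_segment (vertex i) (vertex j)"

abbreviation borel_simplex :: "point measure" where
  "borel_simplex \<equiv> restrict_space borel simplex2"

text \<open>Functions on the triangle are total functions on the plane of which only the values on
  \<^const>\<open>simplex2\<close> matter.\<close>

definition holder_space :: "real \<Rightarrow> (point \<Rightarrow> complex) set" where
  "holder_space \<alpha> =
    {f. \<exists>C. \<forall>x\<in>simplex2. \<forall>y\<in>simplex2. cmod (f x - f y) \<le> C * dist x y powr \<alpha>}"

definition holder_norm :: "real \<Rightarrow> (point \<Rightarrow> complex) \<Rightarrow> real" where
  "holder_norm \<alpha> f =
    (SUP x\<in>simplex2. cmod (f x)) +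
    (SUP (x, y)\<in>{(x, y). x \<in> simplex2 \<and> y \<in> simplex2 \<and> x \<noteq> y}.
       cmod (f x - f y) / dist x y powr \<alpha>)"

definition bounded_measurable :: "(point \<Rightarrow> real) set" where
  "bounded_measurable = {f \<in> borel_measurable borel_simplex. bounded (f ` simplex2)}"

definition trans_op ::
    "(nat \<Rightarrow> point \<Rightarrow> real) \<Rightarrow> (point \<Rightarrow> 'b) \<Rightarrow> point \<Rightarrow> 'b::{banach, second_countable_topology}" where
  "trans_op p f x =
    (\<Sum>i\<in>{0, 1, 2}. p i x *\<^sub>R (LINT t:{0..1}|lborel. f (t *\<^sub>R x + (1 - t) *\<^sub>R vertex i)))"

definition natural_filtration :: "'w measure \<Rightarrow> (nat \<Rightarrow> 'w \<Rightarrow> point) \<Rightarrow> nat \<Rightarrow> 'w measure" where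
  "natural_filtration M Z n =
    sigma (space M) {Z k -` A \<inter> space M | k A. k \<le> n \<and> A \<in> sets borel}"

text \<open>\<open>df_chain p x M Z\<close>: on the probability space \<open>M\<close>, the process \<open>Z\<close> is a Markov chain in the
  triangle with transition operator \<^term>\<open>trans_op p\<close>, started at \<open>x\<close>. Statements about the law of
  the chain started at \<open>x\<close> are statements about every such realization.\<close>

definition df_chain ::
    "(nat \<Rightarrow> point \<Rightarrow> real) \<Rightarrow> point \<Rightarrow> 'w measure \<Rightarrow> (nat \<Rightarrow> 'w \<Rightarrow> point) \<Rightarrow> bool" where
  "df_chain p x M Z \<longleftrightarrow>
    prob_space M \<and>
    (\<forall>n. Z n \<in> measurable M borel_simplex) \<and>
    (AE \<omega> in M. Z 0 \<omega> = x) \<and>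
    (\<forall>n. \<forall>f\<in>bounded_measurable.
       AE \<omega> in M. real_cond_exp M (natural_filtration M Z n) (\<lambda>\<omega>. f (Z (Suc n) \<omega>)) \<omega>
                  = trans_op p f (Z n \<omega>))"

definition invariant_measures :: "(nat \<Rightarrow> point \<Rightarrow> real) \<Rightarrow> point measure set" where
  "invariant_measures p =
    {\<nu>. prob_space \<nu> \<and> sets \<nu> = sets borel_simplex \<and>
        (\<forall>f\<in>bounded_measurable. (LINT x|\<nu>. trans_op p f x) = (LINT x|\<nu>. f x))}"

definition absorbing :: "(nat \<Rightarrow> point \<Rightarrow> real) \<Rightarrow> point set \<Rightarrow> bool" where
  "absorbing p K \<longleftrightarrow>
    K \<noteq> {} \<and> compact K \<and> K \<subseteq> simplex2 \<and>
    (\<forall>x\<in>K. trans_op p (indicator (simplex2 - K) :: point \<Rightarrow> real) x = 0)"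

definition minimal_absorbing :: "(nat \<Rightarrow> point \<Rightarrow> real) \<Rightarrow> point set set" where
  "minimal_absorbing p = {K. absorbing p K \<and> (\<forall>L. absorbing p L \<and> L \<subseteq> K \<longrightarrow> L = K)}"

abbreviation dirac :: "nat \<Rightarrow> point measure" where
  "dirac i \<equiv> return borel_simplex (vertex i)"

text \<open>Measures are not a real vector space in the library, so convex combinations are written out
  setwise.\<close>

definition measure_hull :: "'a measure set \<Rightarrow> 'a measure set" where
  "measure_hull S =
    {\<nu>. \<exists>T a. finite T \<and> T \<subseteq> S \<and> (\<forall>\<mu>\<in>T. 0 \<le> a \<mu> \<and> sets \<nu> = sets \<mu>) \<and>
           (\<Sum>\<mu>\<in>T. a \<mu>) = (1::real) \<and>
           (\<forall>B\<in>sets \<nu>. emeasure \<nu> B = (\<Sum>\<mu>\<in>T. ennreal (a \<mu>) * emeasure \<mu> B))}"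

definition measure_support :: "'a::topological_space measure \<Rightarrow> 'a set" where
  "measure_support \<mu> =
    {x \<in> space \<mu>. \<forall>U. open U \<and> x \<in> U \<longrightarrow> 0 < emeasure \<mu> (U \<inter> space \<mu>)}"

abbreviation edge_point :: "nat \<Rightarrow> nat \<Rightarrow> real \<Rightarrow> point" where
  "edge_point i j t \<equiv> t *\<^sub>R vertex i + (1 - t) *\<^sub>R vertex j"

text \<open>The interval integrals below are oriented: they change sign when the bounds are swapped.\<close>

definition edge_density ::
    "(nat \<Rightarrow> point \<Rightarrow> real) \<Rightarrow> nat \<Rightarrow> nat \<Rightarrow> real \<Rightarrow> real \<Rightarrow> real" where
  "edge_density p i j s t =
    exp ((LBINT u=s..t. p i (edge_point i j u) / (1 - u)) +
         (LBINT u=t..s. p j (edge_point i j u) / u))"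

text \<open>\<open>is_edge_law p i j \<mu>\<close>: \<open>\<mu>\<close> is the probability measure on the edge whose density in the
  parametrization \<^term>\<open>edge_point i j\<close> is a constant multiple of \<^term>\<open>edge_density p i j s\<close>,
  whatever the reference point \<open>s\<close>.\<close>

definition is_edge_law :: "(nat \<Rightarrow> point \<Rightarrow> real) \<Rightarrow> nat \<Rightarrow> nat \<Rightarrow> point measure \<Rightarrow> bool" where
  "is_edge_law p i j \<mu> \<longleftrightarrow>
    prob_space \<mu> \<and>
    (\<forall>s\<in>{0<..<1}. \<exists>C>0.
       \<mu> = distr (density (restrict_space lborel {0<..<1})
                           (\<lambda>t. ennreal (C * edge_density p i j s t)))
                 borel_simplex (edge_point i j))"

definition converges_in_law :: "'w measure \<Rightarrow> (nat \<Rightarrow> 'w \<Rightarrow> point) \<Rightarrow> point measure \<Rightarrow> bool" where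
  "converges_in_law M Z \<mu> \<longleftrightarrow>
    (\<forall>f :: point \<Rightarrow> real. continuous_on simplex2 f \<longrightarrow>
       (\<lambda>n. LINT \<omega>|M. f (Z n \<omega>)) \<longlonglongrightarrow> (LINT x|\<mu>. f x))"

definition geometric_rate ::
    "real \<Rightarrow> (nat \<Rightarrow> point \<Rightarrow> real) \<Rightarrow> ((point \<Rightarrow> complex) \<Rightarrow> point \<Rightarrow> complex) \<Rightarrow> bool" where
  "geometric_rate \<alpha> p L \<longleftrightarrow>
    (\<exists>\<kappa>>0. \<exists>\<rho>\<in>{0..<1}. \<forall>\<phi>\<in>holder_space \<alpha>. \<forall>x\<in>simplex2. \<forall>n.
       cmod ((trans_op p ^^ n) \<phi> x - L \<phi> x) \<le> \<kappa> * \<rho> ^ n * holder_norm \<alpha> \<phi>)"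

definition harmonic_pair ::
    "real \<Rightarrow> (nat \<Rightarrow> point \<Rightarrow> real) \<Rightarrow> nat \<Rightarrow> nat \<Rightarrow> (nat \<Rightarrow> point \<Rightarrow> complex) \<Rightarrow> bool" where
  "harmonic_pair \<alpha> p i j h \<longleftrightarrow>
    (\<forall>k\<in>{i, j}. h k \<in> holder_space \<alpha> \<and> (\<forall>x\<in>simplex2. trans_op p (h k) x = h k x)) \<and>
    (\<forall>x\<in>simplex2. h i x + h j x = 1) \<and>
    (\<forall>k\<in>{i, j}. \<forall>l\<in>{i, j}. h k (vertex l) = (if k = l then 1 else 0))"

end

theory Submission
  imports Defs "HOL-Complex_Analysis.Great_Picard"
begin

text \<open>The proof studies the iterates of the transition operator \<open>P\<close> on Hoelder functions; the
  trajectories of the chain enter only at the end.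

  Moving two points towards a common vertex with the same \<open>t\<close> multiplies their distance by \<open>t\<close>.
  Averaging over \<open>t\<close> therefore contracts Hoelder constants, and the variation of the weights adds only
  a multiple of the supremum norm (\<open>doeblin_fortet\<close>). Hence every orbit \<open>f\<close>, \<open>P f\<close>, \<open>P (P f)\<close>, ... of a
  Hoelder function is relatively compact for uniform convergence.

  A maximum principle decides which limits are possible (\<open>limit_point_maximal\<close>). Since \<open>t\<close> may be
  close to 1, the chain can stay as near to its position as it likes: if the mean of a nonnegative
  function vanishes after \<open>n\<close> steps, it vanishes after fewer steps, too, so there is no periodicity.
  It follows that some limit point of the orbit attains the common maximum of all limit points on a
  whole minimal absorbing set. This has two consequences: on a minimal absorbing set \<open>K\<close> the iterates
  of \<open>f\<close> converge to a constant \<open>lim_val K f\<close> (\<open>minimal_converges_constant\<close>), and if all these constants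
  are zero, the iterates converge to zero uniformly on the triangle (\<open>vanishing_on_minimal\<close>).

  Compactness of the Hoelder ball makes the latter convergence uniform in \<open>f\<close>, and with the
  contraction of Hoelder constants some power of \<open>P\<close> halves the Hoelder norm of all functions with
  vanishing constants (\<open>null_fun_contraction\<close>). For every minimal absorbing set \<open>K\<close> there is a harmonic
  function \<open>hit K\<close> that is 1 on \<open>K\<close> and 0 on the other ones. Subtracting the sum of \<open>lim_val K f * hit K\<close>
  from \<open>f\<close> makes all constants vanish; so this sum is the limit of the iterates, with a geometric rate
  (\<open>orbit_lim_rate\<close>, \<open>orbit_lim_eq\<close>).

  The functional \<open>lim_val K\<close> is the integral with respect to a probability measure \<open>stat K\<close>, a limit of
  laws of the chain; the selection of a convergent subsequence is reduced to the real line by means of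
  a space-filling curve (\<open>lim_val_represented\<close>). Integrating the limit of the iterates with respect to
  an invariant measure shows that the invariant measures are the convex combinations of the measures
  \<open>stat K\<close> (\<open>invariant_measures_eq\<close>). The support of \<open>stat K\<close> is absorbing, hence equal to \<open>K\<close>
  (\<open>stat_support\<close>), and on an edge the density solves a linear differential equation (\<open>stat_edge\<close>).

  For the chain itself, the geometric rate means that the expected distance of \<open>Z n\<close> from the union of
  the minimal absorbing sets decays geometrically, and so do the second moments of the increments of
  \<open>hit K (Z n)\<close>, which are increments of the expectation of a square. Therefore almost surely \<open>Z n\<close>
  approaches this union while all sequences \<open>hit K (Z n)\<close> converge; this forces it to approach exactly
  one minimal absorbing set, which is \<open>K\<close> with probability \<open>hit K x\<close> (\<open>chain_absorption\<close>).

  Finally, \<open>t\<close> may also be close to 0, so every absorbing set contains a vertex. A minimal absorbing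
  set turns out to be a vertex or an edge or to meet the interior of the triangle, and in the last case
  it contains all three vertices and is the only one (\<open>minimal_absorbing_classification\<close>).\<close>

section \<open>The triangle and averages along segments\<close>

lemma convex_simplex2: "convex simplex2"
proof -
  have eq: "simplex2 = {x. (1,0) \<bullet> x \<ge> 0} \<inter> {x. (0,1) \<bullet> x \<ge> 0} \<inter> {x. (1,1) \<bullet> x \<le> 1}"
    by (auto simp: simplex2_def inner_prod_def)
  show ?thesis
    unfolding eq by (rule convex_Int[OF convex_Int[OF convex_halfspace_ge convex_halfspace_ge] convex_halfspace_le])
qed

lemma closed_simplex2: "closed simplex2"
  unfolding simplex2_def by (intro closed_Collect_conj closed_Collect_le continuous_intros)

lemma bounded_simplex2: "bounded simplex2"
proof -
  have "norm x \<le> 2" if "x \<in> simplex2" for x :: point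
  proof -
    have "norm x \<le> norm (fst x) + norm (snd x)"
      by (metis norm_Pair_le prod.collapse)
    then show ?thesis using that by (auto simp: simplex2_def)
  qed
  then show ?thesis unfolding bounded_iff by blast
qed

lemma compact_simplex2: "compact simplex2"
  using bounded_simplex2 closed_simplex2 compact_eq_bounded_closed by blast

lemma dist_simplex2_le:
  assumes "x \<in> simplex2" "y \<in> simplex2"
  shows "dist x y \<le> 2"
proof -
  have "dist x y \<le> dist (fst x) (fst y) + dist (snd x) (snd y)"
    unfolding dist_prod_def by (rule sqrt_sum_squares_le_sum) auto
  also have "\<dots> \<le> 2" using assms by (auto simp: simplex2_def dist_real_def)
  finally show ?thesis .
qed

lemma vertex_simplex2 [simp]: "vertex i \<in> simplex2"
  by (auto simp: vertex_def simplex2_def)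

lemma move_simplex2:
  assumes "x \<in> simplex2" "0 \<le> t" "t \<le> 1"
  shows "t *\<^sub>R x + (1 - t) *\<^sub>R vertex i \<in> simplex2"
  using convexD_alt[OF convex_simplex2 vertex_simplex2 assms(1), of t i] assms
  by (simp add: add.commute)

definition seg_avg :: "(point \<Rightarrow> real) \<Rightarrow> point \<Rightarrow> point \<Rightarrow> real" where
  "seg_avg f v x = integral {0..1} (\<lambda>t. f (t *\<^sub>R x + (1 - t) *\<^sub>R v))"

lemma continuous_on_move:
  fixes f :: "point \<Rightarrow> 'b::topological_space"
  assumes f: "continuous_on simplex2 f" and x: "x \<in> simplex2"
  shows "continuous_on {0..1} (\<lambda>t. f (t *\<^sub>R x + (1 - t) *\<^sub>R vertex i))"
  by (rule continuous_on_compose2[OF f]) (auto intro!: continuous_intros move_simplex2 x)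

lemma integrable_move:
  fixes f :: "point \<Rightarrow> 'b::euclidean_space"
  assumes f: "continuous_on simplex2 f" and x: "x \<in> simplex2"
  shows "(\<lambda>t. f (t *\<^sub>R x + (1 - t) *\<^sub>R vertex i)) integrable_on {0..1}"
  using continuous_on_move[OF assms] integrable_continuous_real by blast

lemma set_integrable_move:
  fixes f :: "point \<Rightarrow> 'b::euclidean_space"
  assumes f: "continuous_on simplex2 f" and x: "x \<in> simplex2"
  shows "set_integrable lborel {0..1} (\<lambda>t. f (t *\<^sub>R x + (1 - t) *\<^sub>R vertex i))"
  using continuous_on_move[OF assms] borel_integrable_atLeastAtMost' by blast

lemma trans_op_eq:
  fixes f :: "point \<Rightarrow> real"
  assumes "continuous_on simplex2 f" "x \<in> simplex2"
  shows "trans_op p f x = (\<Sum>i\<in>{0,1,2}. p i x * seg_avg f (vertex i) x)"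
  unfolding trans_op_def seg_avg_def
  by (simp add: set_borel_integral_eq_integral(2)[OF set_integrable_move[OF assms]])

lemma seg_avg_mono:
  assumes "continuous_on simplex2 f" "continuous_on simplex2 g" "x \<in> simplex2"
    "\<And>t. 0 \<le> t \<Longrightarrow> t \<le> 1 \<Longrightarrow> f (t *\<^sub>R x + (1 - t) *\<^sub>R vertex i) \<le> g (t *\<^sub>R x + (1 - t) *\<^sub>R vertex i)"
  shows "seg_avg f (vertex i) x \<le> seg_avg g (vertex i) x"
  unfolding seg_avg_def by (rule integral_le) (auto intro!: integrable_move assms)

lemma seg_avg_lin:
  assumes "continuous_on simplex2 f" "continuous_on simplex2 g" "x \<in> simplex2"
  shows "seg_avg (\<lambda>y. a * f y + b * g y) (vertex i) x
    = a * seg_avg f (vertex i) x + b * seg_avg g (vertex i) x"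
proof -
  have "(\<lambda>t. a * f (t *\<^sub>R x + (1 - t) *\<^sub>R vertex i)) integrable_on {0..1}"
    "(\<lambda>t. b * g (t *\<^sub>R x + (1 - t) *\<^sub>R vertex i)) integrable_on {0..1}"
    using integrable_move[OF assms(1,3)] integrable_move[OF assms(2,3)]
    by (auto intro: integrable_on_mult_right)
  from integral_add[OF this] show ?thesis
    unfolding seg_avg_def by simp
qed

lemma continuous_on_seg_avg:
  assumes "continuous_on simplex2 f"
  shows "continuous_on simplex2 (seg_avg f (vertex i))"
proof -
  have "continuous_on (simplex2 \<times> cbox 0 1) (\<lambda>(x, t). f (t *\<^sub>R x + (1 - t) *\<^sub>R vertex i))"
    unfolding case_prod_unfold
  proof (rule continuous_on_compose2[OF assms])
    show "(\<lambda>z. snd z *\<^sub>R fst z + (1 - snd z) *\<^sub>R vertex i) ` (simplex2 \<times> cbox 0 1) \<subseteq> simplex2"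
      by (clarsimp simp del: scaleR_Pair) (rule move_simplex2, auto)
  qed (intro continuous_intros)
  from integral_continuous_on_param[OF this] show ?thesis
    by (simp add: seg_avg_def[abs_def])
qed

text \<open>Moving two starting points towards a common vertex multiplies their distance by the
  uniform variable \<open>t\<close>, so averaging contracts the Hoelder constant by the mean of
  \<open>t powr \<alpha>\<close>, which is \<open>1 / (1 + \<alpha>)\<close>.\<close>

lemma seg_avg_holder:
  assumes f: "continuous_on simplex2 f" and xy: "x \<in> simplex2" "y \<in> simplex2" and a: "0 < \<alpha>"
    and h: "\<And>x y. x \<in> simplex2 \<Longrightarrow> y \<in> simplex2 \<Longrightarrow> \<bar>f x - f y\<bar> \<le> C * dist x y powr \<alpha>"
  shows "\<bar>seg_avg f (vertex i) x - seg_avg f (vertex i) y\<bar> \<le> C / (1 + \<alpha>) * dist x y powr \<alpha>"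
proof -
  let ?m = "\<lambda>x t. t *\<^sub>R x + (1 - t) *\<^sub>R vertex i"
  have pow: "((\<lambda>t. (C * dist x y powr \<alpha>) * t powr \<alpha>) has_integral
      (C * dist x y powr \<alpha>) * (1 / (1 + \<alpha>))) {0..1}"
    using has_integral_mult_right[OF has_integral_powr_from_0[of \<alpha> 1], of "C * dist x y powr \<alpha>"] a
    by (simp add: add.commute)
  have "\<bar>f (?m x t) - f (?m y t)\<bar> \<le> (C * dist x y powr \<alpha>) * t powr \<alpha>" if "t \<in> {0..1}" for t
  proof -
    have "dist (?m x t) (?m y t) = t * dist x y"
      using that by (simp add: dist_norm flip: scaleR_diff_right)
    then show ?thesis
      using h[OF move_simplex2[OF xy(1)] move_simplex2[OF xy(2)], of t t i i] that
      by (simp add: powr_mult mult_ac)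
  qed
  moreover have "(\<lambda>t. f (?m x t) - f (?m y t)) integrable_on {0..1}"
    by (intro integrable_diff integrable_move f xy)
  ultimately have "norm (integral {0..1} (\<lambda>t. f (?m x t) - f (?m y t)))
      \<le> integral {0..1} (\<lambda>t. (C * dist x y powr \<alpha>) * t powr \<alpha>)"
    using pow by (intro integral_norm_bound_integral) (auto simp: has_integral_integrable)
  then show ?thesis
    unfolding seg_avg_def integral_unique[OF pow]
    using integral_diff[OF integrable_move[OF f xy(1)] integrable_move[OF f xy(2)]]
    by (simp add: mult_ac)
qed

text \<open>The parameter \<open>t\<close> is uniform on all of \<open>[0, 1]\<close>, so a continuous nonnegative function with
  zero average vanishes on the whole segment, both end points included.\<close>

lemma seg_avg_eq_0D:
  assumes f: "continuous_on simplex2 f" and x: "x \<in> simplex2"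
    and nn: "\<And>t. 0 \<le> t \<Longrightarrow> t \<le> 1 \<Longrightarrow> 0 \<le> f (t *\<^sub>R x + (1 - t) *\<^sub>R vertex i)"
    and z: "seg_avg f (vertex i) x = 0" and t: "0 \<le> t" "t \<le> 1"
  shows "f (t *\<^sub>R x + (1 - t) *\<^sub>R vertex i) = 0"
  using z integral_eq_0_iff[OF continuous_on_move[OF f x, of i]] nn t
  unfolding seg_avg_def by auto

section \<open>The transition operator on continuous and on Hoelder functions\<close>

text \<open>The sup bound \<open>B\<close> and the Hoelder constant \<open>C\<close> are kept apart, because the transition operator
  acts on them differently: it contracts \<open>C\<close> at the expense of a multiple of \<open>B\<close>.\<close>

definition holder_bd :: "real \<Rightarrow> real \<Rightarrow> real \<Rightarrow> (point \<Rightarrow> real) \<Rightarrow> bool" where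
  "holder_bd \<alpha> B C f \<longleftrightarrow> (\<forall>x\<in>simplex2. \<bar>f x\<bar> \<le> B) \<and>
     (\<forall>x\<in>simplex2. \<forall>y\<in>simplex2. \<bar>f x - f y\<bar> \<le> C * dist x y powr \<alpha>)"

lemma holder_continuous:
  fixes f :: "point \<Rightarrow> 'b::metric_space"
  assumes a: "0 < \<alpha>" and h: "\<forall>x\<in>S. \<forall>y\<in>S. dist (f x) (f y) \<le> C * dist x y powr \<alpha>"
  shows "continuous_on S f"
proof -
  have "(f \<longlongrightarrow> f x) (at x within S)" if x: "x \<in> S" for x
  proof -
    have "((\<lambda>y. C * dist y x powr \<alpha>) \<longlongrightarrow> C * 0 powr \<alpha>) (at x within S)"
    proof (intro tendsto_intros tendsto_powr')
      show "((\<lambda>y. dist y x) \<longlongrightarrow> 0) (at x within S)"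
        using tendsto_dist[OF tendsto_ident_at[of x S] tendsto_const[of x]] by simp
    qed (use a in auto)
    then have lim: "((\<lambda>y. C * dist y x powr \<alpha>) \<longlongrightarrow> 0) (at x within S)" by simp
    have "((\<lambda>y. dist (f y) (f x)) \<longlongrightarrow> 0) (at x within S)"
      by (rule Lim_null_comparison[OF _ lim]) (use h x in \<open>auto simp: eventually_at_filter\<close>)
    then show ?thesis using tendsto_dist_iff by blast
  qed
  then show ?thesis by (simp add: continuous_on_def)
qed

lemma holder_bd_continuous: "0 < \<alpha> \<Longrightarrow> holder_bd \<alpha> B C f \<Longrightarrow> continuous_on simplex2 f"
  by (rule holder_continuous[where \<alpha>=\<alpha> and C=C]) (auto simp: holder_bd_def dist_real_def)

lemma holder_bd_nonneg: "holder_bd \<alpha> B C f \<Longrightarrow> 0 \<le> B"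
  unfolding holder_bd_def using vertex_simplex2 abs_ge_zero order_trans by blast

lemma holder_bd_const_nonneg: "holder_bd \<alpha> B C f \<Longrightarrow> 0 \<le> C"
proof -
  assume "holder_bd \<alpha> B C f"
  then have "\<bar>f (vertex 0) - f (vertex 1)\<bar> \<le> C * dist (vertex 0) (vertex 1) powr \<alpha>"
    by (simp add: holder_bd_def)
  then show ?thesis by (simp add: vertex_def dist_norm norm_Pair)
qed

lemma holder_bd_mono:
  assumes "holder_bd \<alpha> B C f" "B \<le> B'" "C \<le> C'"
  shows "holder_bd \<alpha> B' C' f"
proof -
  have "C * dist x y powr \<alpha> \<le> C' * dist x y powr \<alpha>" for x y :: point
    using assms(3) by (intro mult_right_mono) auto
  then show ?thesis
    using assms(1,2) order_trans unfolding holder_bd_def by meson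
qed

locale df_weights =
  fixes \<alpha> :: real and p :: "nat \<Rightarrow> point \<Rightarrow> real"
  assumes alpha: "0 < \<alpha>" "\<alpha> \<le> 1"
    and holder: "\<And>i. i \<in> {0, 1, 2} \<Longrightarrow> (\<lambda>x. complex_of_real (p i x)) \<in> holder_space \<alpha>"
    and nonneg: "\<And>i x. i \<in> {0, 1, 2} \<Longrightarrow> x \<in> simplex2 \<Longrightarrow> 0 \<le> p i x"
    and sum_one: "\<And>x. x \<in> simplex2 \<Longrightarrow> p 0 x + p 1 x + p 2 x = 1"
begin

abbreviation P :: "(point \<Rightarrow> real) \<Rightarrow> point \<Rightarrow> real" where "P \<equiv> trans_op p"

abbreviation HB :: "real \<Rightarrow> real \<Rightarrow> (point \<Rightarrow> real) \<Rightarrow> bool" where "HB \<equiv> holder_bd \<alpha>"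

lemmas HB_cont = holder_bd_continuous[OF alpha(1)]

lemma weight_holder:
  obtains D where "D \<ge> 0" "\<forall>i\<in>{0, 1, 2}. HB 1 D (p i)"
proof -
  have "\<exists>C. \<forall>x\<in>simplex2. \<forall>y\<in>simplex2. \<bar>p i x - p i y\<bar> \<le> C * dist x y powr \<alpha>"
    if "i \<in> {0,1,2}" for i
    using holder[OF that] unfolding holder_space_def
    by (simp flip: of_real_diff)
  then obtain C where C: "\<And>i. i \<in> {0,1,2} \<Longrightarrow>
      \<forall>x\<in>simplex2. \<forall>y\<in>simplex2. \<bar>p i x - p i y\<bar> \<le> C i * dist x y powr \<alpha>"
    by metis
  have le: "\<bar>p i x\<bar> \<le> 1" if "i \<in> {0,1,2}" "x \<in> simplex2" for i x
    using nonneg[of 0 x] nonneg[of 1 x] nonneg[of 2 x] sum_one[of x] that by auto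
  have hb: "HB 1 (C i) (p i)" if "i \<in> {0,1,2}" for i
    using C[OF that] le[OF that] by (simp add: holder_bd_def)
  have nn: "0 \<le> C i" if "i \<in> {0,1,2}" for i
    using hb[OF that] holder_bd_const_nonneg by blast
  show thesis
  proof (rule that[of "\<Sum>i\<in>{0,1,2}. C i"], goal_cases)
    case 2
    show ?case
    proof
      fix i :: nat assume i: "i \<in> {0,1,2}"
      have "C i \<le> (\<Sum>i\<in>{0,1,2}. C i)"
        by (rule member_le_sum[OF i]) (use nn in auto)
      then have "C i * dist x y powr \<alpha> \<le> (\<Sum>i\<in>{0,1,2}. C i) * dist x y powr \<alpha>" for x y :: point
        by (rule mult_right_mono) simp
      then show "HB 1 (\<Sum>i\<in>{0,1,2}. C i) (p i)"
        using hb[OF i] order_trans unfolding holder_bd_def by blast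
    qed
  qed (use nn in auto)
qed

lemma weight_cont: "i \<in> {0,1,2} \<Longrightarrow> continuous_on simplex2 (p i)"
  by (metis weight_holder HB_cont)

lemma weight_pos: "x \<in> simplex2 \<Longrightarrow> \<exists>i\<in>{0,1,2}. 0 < p i x"
  using sum_one[of x] nonneg[of _ x] by (smt (verit) insert_iff)

text \<open>The set is closed, so if a segment leaves it at one point, it does so for an interval of
  parameters, which has positive length. Hence \<open>K\<close> is left with probability zero exactly if the
  segments that are chosen with positive probability lie in \<open>K\<close>.\<close>

lemma absorbing_iff:
  "absorbing p K \<longleftrightarrow> K \<noteq> {} \<and> compact K \<and> K \<subseteq> simplex2 \<and>
    (\<forall>x\<in>K. \<forall>i\<in>{0,1,2}. 0 < p i x \<longrightarrow> (\<forall>t\<in>{0..1}. t *\<^sub>R x + (1 - t) *\<^sub>R vertex i \<in> K))"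
proof -
  have "trans_op p (indicator (simplex2 - K) :: point \<Rightarrow> real) x = 0 \<longleftrightarrow>
      (\<forall>i\<in>{0,1,2}. 0 < p i x \<longrightarrow> (\<forall>t\<in>{0..1}. t *\<^sub>R x + (1 - t) *\<^sub>R vertex i \<in> K))"
    if K: "compact K" "K \<subseteq> simplex2" and x: "x \<in> K" for x
  proof -
    have xs: "x \<in> simplex2" using K x by auto
    let ?m = "\<lambda>i t. t *\<^sub>R x + (1 - t) *\<^sub>R vertex i"
    define S where "S i = {t\<in>{0..1}. ?m i t \<notin> K}" for i
    have op: "open {t. ?m i t \<notin> K}" for i
    proof -
      have "open ((\<lambda>t. ?m i t) -` (- K))"
        by (intro open_vimage open_Compl compact_imp_closed K continuous_intros)
      then show ?thesis by (simp add: vimage_def)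
    qed
    have Seq: "S i = {0..1} \<inter> {t. ?m i t \<notin> K}" for i by (auto simp: S_def)
    have S_sets: "S i \<in> sets lborel" for i
      unfolding Seq using borel_open[OF op[of i]] by auto
    have fin: "emeasure lborel (S i) < \<infinity>" for i
    proof -
      have "emeasure lborel (S i) \<le> emeasure lborel {0..1::real}"
        by (rule emeasure_mono) (auto simp: S_def)
      then show ?thesis by (simp add: le_less_trans)
    qed
    have I: "(LINT t:{0..1}|lborel. indicator (simplex2 - K) (?m i t)) = measure lborel (S i)" for i
    proof -
      have "(LINT t:{0..1}|lborel. (indicator (simplex2 - K) (?m i t)::real))
          = (LINT t|lborel. indicator (S i) t)"
        unfolding set_lebesgue_integral_def
        by (rule Bochner_Integration.integral_cong)
           (auto simp: S_def indicator_def move_simplex2[OF xs])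
      then show ?thesis using S_sets by simp
    qed
    have zero: "measure lborel (S i) = 0 \<longleftrightarrow> (\<forall>t\<in>{0..1}. ?m i t \<in> K)" for i
    proof
      assume m0: "measure lborel (S i) = 0"
      show "\<forall>t\<in>{0..1}. ?m i t \<in> K"
      proof (rule ccontr)
        assume "\<not> ?thesis"
        then obtain t where t: "t \<in> {0..1}" "?m i t \<notin> K" by auto
        then obtain e where e: "e > 0" "\<And>s. \<bar>s - t\<bar> < e \<Longrightarrow> ?m i s \<notin> K"
          using op[of i] unfolding open_dist dist_real_def by force
        define d where "d = min (e/2) (1/2)"
        have d: "0 < d" "d < e" "d \<le> 1/2" using e by (auto simp: d_def)
        \<comment> \<open>an interval of length \<open>d\<close> with end point \<open>t\<close>, on the side where it stays inside \<open>[0, 1]\<close>\<close>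
        define a where "a = (if t \<le> 1/2 then t else t - d)"
        have "{a..a+d} \<subseteq> S i"
          using t d e(2) unfolding a_def S_def by (auto split: if_splits)
        then have "emeasure lborel {a..a+d} \<le> emeasure lborel (S i)"
          using S_sets by (intro emeasure_mono) auto
        moreover have "emeasure lborel (S i) = 0"
          using m0 fin[of i] by (auto simp: measure_def enn2real_eq_0_iff)
        ultimately show False using d by simp
      qed
    next
      assume "\<forall>t\<in>{0..1}. ?m i t \<in> K"
      then have "S i = {}" by (auto simp: S_def)
      then show "measure lborel (S i) = 0" by simp
    qed
    have "trans_op p (indicator (simplex2 - K) :: point \<Rightarrow> real) x
        = (\<Sum>i\<in>{0,1,2}. p i x * measure lborel (S i))"
      unfolding trans_op_def by (simp only: I real_scaleR_def)
    also have "\<dots> = 0 \<longleftrightarrow> (\<forall>i\<in>{0,1,2}. p i x * measure lborel (S i) = 0)"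
      using nonneg[OF _ xs] by (intro sum_nonneg_eq_0_iff) auto
    also have "\<dots> \<longleftrightarrow> (\<forall>i\<in>{0,1,2}. 0 < p i x \<longrightarrow> (\<forall>t\<in>{0..1}. ?m i t \<in> K))"
      unfolding mult_eq_0_iff zero using nonneg[OF _ xs] by (metis less_eq_real_def less_irrefl)
    finally show ?thesis .
  qed
  then show ?thesis unfolding absorbing_def by blast
qed

lemma absorbing_move:
  "absorbing p K \<Longrightarrow> x \<in> K \<Longrightarrow> i \<in> {0,1,2} \<Longrightarrow> 0 < p i x \<Longrightarrow> 0 \<le> t \<Longrightarrow> t \<le> 1 \<Longrightarrow>
    t *\<^sub>R x + (1 - t) *\<^sub>R vertex i \<in> K"
  unfolding absorbing_iff by (meson atLeastAtMost_iff)

lemma absorbing_simplex2: "absorbing p simplex2"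
  unfolding absorbing_iff using compact_simplex2 move_simplex2 vertex_simplex2 by fastforce

lemma absorbing_subset: "absorbing p K \<Longrightarrow> K \<subseteq> simplex2"
  by (simp add: absorbing_def)

text \<open>From a point of an absorbing set \<open>A\<close> the operator sees only the values on \<open>A\<close>.\<close>

lemma P_mono:
  assumes A: "absorbing p A" and c: "continuous_on simplex2 f" "continuous_on simplex2 g"
    and le: "\<And>y. y \<in> A \<Longrightarrow> f y \<le> g y" and x: "x \<in> A"
  shows "P f x \<le> P g x"
proof -
  have xs: "x \<in> simplex2" using absorbing_subset[OF A] x by auto
  show ?thesis
    unfolding trans_op_eq[OF c(1) xs] trans_op_eq[OF c(2) xs]
  proof (rule sum_mono)
    fix i :: nat assume i: "i \<in> {0,1,2}"
    show "p i x * seg_avg f (vertex i) x \<le> p i x * seg_avg g (vertex i) x"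
    proof (cases "p i x = 0")
      case False
      then have pos: "0 < p i x" using nonneg[OF i xs] by simp
      show ?thesis
        by (intro mult_left_mono seg_avg_mono c xs le nonneg i absorbing_move[OF A x i pos])
    qed simp
  qed
qed

lemma P_cong:
  assumes A: "absorbing p A" and c: "continuous_on simplex2 f" "continuous_on simplex2 g"
    and le: "\<And>y. y \<in> A \<Longrightarrow> f y = g y" and x: "x \<in> A"
  shows "P f x = P g x"
  by (intro order_antisym P_mono[OF A _ _ _ x] c) (simp_all add: le)

lemma P_const: "x \<in> simplex2 \<Longrightarrow> P (\<lambda>_. a) x = a"
  using arg_cong[OF sum_one[of x], of "\<lambda>s. s * a"]
  by (simp add: trans_op_eq seg_avg_def distrib_right)

lemma P_lin:
  assumes "continuous_on simplex2 f" "continuous_on simplex2 g" "x \<in> simplex2"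
  shows "P (\<lambda>y. a * f y + b * g y) x = a * P f x + b * P g x"
  using assms
  by (simp add: trans_op_eq continuous_on_add continuous_on_mult_left seg_avg_lin sum.distrib
      algebra_simps)

lemma P_cont:
  assumes "continuous_on simplex2 f"
  shows "continuous_on simplex2 (P f)"
proof -
  have "continuous_on simplex2 (\<lambda>x. \<Sum>i\<in>{0,1,2}. p i x * seg_avg f (vertex i) x)"
    by (intro continuous_intros continuous_on_seg_avg assms weight_cont) auto
  then show ?thesis
    by (subst continuous_on_cong[OF refl trans_op_eq[OF assms]]) auto
qed

lemma Pn_cont: "continuous_on simplex2 f \<Longrightarrow> continuous_on simplex2 ((P ^^ n) f)"
  by (induction n) (simp_all add: P_cont)

lemma Pn_mono:
  assumes A: "absorbing p A" and c: "continuous_on simplex2 f" "continuous_on simplex2 g"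
    and le: "\<And>y. y \<in> A \<Longrightarrow> f y \<le> g y" and x: "x \<in> A"
  shows "(P ^^ n) f x \<le> (P ^^ n) g x"
  using x
proof (induction n arbitrary: x)
  case (Suc n)
  then show ?case using P_mono[OF A Pn_cont[OF c(1)] Pn_cont[OF c(2)]] by simp
qed (simp add: le)

lemma Pn_cong:
  assumes A: "absorbing p A" and c: "continuous_on simplex2 f" "continuous_on simplex2 g"
    and le: "\<And>y. y \<in> A \<Longrightarrow> f y = g y" and x: "x \<in> A"
  shows "(P ^^ n) f x = (P ^^ n) g x"
  by (intro order_antisym Pn_mono[OF A _ _ _ x] c) (simp_all add: le)

lemma Pn_const: "x \<in> simplex2 \<Longrightarrow> (P ^^ n) (\<lambda>_. a) x = a"
proof (induction n arbitrary: x)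
  case (Suc n)
  have "P ((P ^^ n) (\<lambda>_. a)) x = P (\<lambda>_. a) x"
    by (rule P_cong[OF absorbing_simplex2]) (auto simp: Suc Pn_cont)
  then show ?case using Suc P_const by simp
qed simp

lemma Pn_lin:
  assumes "continuous_on simplex2 f" "continuous_on simplex2 g" "x \<in> simplex2"
  shows "(P ^^ n) (\<lambda>y. a * f y + b * g y) x = a * (P ^^ n) f x + b * (P ^^ n) g x"
  using assms(3)
proof (induction n arbitrary: x)
  case (Suc n)
  have "P ((P ^^ n) (\<lambda>y. a * f y + b * g y)) x = P (\<lambda>y. a * (P ^^ n) f y + b * (P ^^ n) g y) x"
    by (rule P_cong[OF absorbing_simplex2])
       (auto simp: Suc intro!: Pn_cont continuous_intros assms)
  also have "\<dots> = a * P ((P ^^ n) f) x + b * P ((P ^^ n) g) x"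
    by (intro P_lin Pn_cont assms Suc.prems)
  finally show ?case by simp
qed simp

lemma Pn_diff:
  assumes "continuous_on simplex2 f" "continuous_on simplex2 g" "x \<in> simplex2"
  shows "(P ^^ n) (\<lambda>y. f y - g y) x = (P ^^ n) f x - (P ^^ n) g x"
  using Pn_lin[OF assms, of n 1 "-1"] by simp

lemma Pn_bound:
  assumes A: "absorbing p A" and c: "continuous_on simplex2 f"
    and le: "\<And>y. y \<in> A \<Longrightarrow> \<bar>f y\<bar> \<le> e" and x: "x \<in> A"
  shows "\<bar>(P ^^ n) f x\<bar> \<le> e"
proof -
  have xs: "x \<in> simplex2" using absorbing_subset[OF A] x by auto
  have "(P ^^ n) f x \<le> (P ^^ n) (\<lambda>_. e) x" "(P ^^ n) (\<lambda>_. - e) x \<le> (P ^^ n) f x"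
    using le by (intro Pn_mono[OF A _ _ _ x] c; fastforce)+
  then show ?thesis by (simp add: Pn_const xs)
qed

lemma Pn_add: "(P ^^ (m + n)) f = (P ^^ m) ((P ^^ n) f)"
  by (simp add: funpow_add)

text \<open>If the mean of a nonnegative function vanishes at \<open>x\<close>, the function vanishes on every segment
  that the chain can choose from \<open>x\<close>; as these segments contain \<open>x\<close>, also at \<open>x\<close>.\<close>

lemma P_zero_segment:
  assumes A: "absorbing p A" and c: "continuous_on simplex2 f"
    and nn: "\<And>y. y \<in> A \<Longrightarrow> 0 \<le> f y" and x: "x \<in> A" and z: "P f x = 0"
    and i: "i \<in> {0,1,2}" "0 < p i x" and t: "0 \<le> t" "t \<le> 1"
  shows "f (t *\<^sub>R x + (1 - t) *\<^sub>R vertex i) = 0"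
proof -
  have xs: "x \<in> simplex2" using absorbing_subset[OF A] x by auto
  have nn': "0 \<le> p j x * seg_avg f (vertex j) x" if j: "j \<in> {0,1,2}" for j
  proof (cases "p j x = 0")
    case False
    then have pos: "0 < p j x" using nonneg[OF j xs] by simp
    have "seg_avg (\<lambda>_. 0) (vertex j) x \<le> seg_avg f (vertex j) x"
      by (intro seg_avg_mono c xs nn continuous_intros absorbing_move[OF A x j pos])
    then show ?thesis using pos by (simp add: seg_avg_def)
  qed simp
  have "\<forall>j\<in>{0,1,2}. p j x * seg_avg f (vertex j) x = 0"
    using z unfolding trans_op_eq[OF c xs] by (subst (asm) sum_nonneg_eq_0_iff) (use nn' in auto)
  then have "seg_avg f (vertex i) x = 0" using i by auto
  then show ?thesis
    by (intro seg_avg_eq_0D[OF c xs _ _ t] nn absorbing_move[OF A x i])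
qed

lemma P_zero_self:
  assumes A: "absorbing p A" and c: "continuous_on simplex2 f"
    and nn: "\<And>y. y \<in> A \<Longrightarrow> 0 \<le> f y" and x: "x \<in> A" and z: "P f x = 0"
  shows "f x = 0"
proof -
  obtain i where "i \<in> {0,1,2}" "0 < p i x"
    using weight_pos absorbing_subset[OF A] x by blast
  from P_zero_segment[OF A c nn x z this, of 1] show ?thesis by simp
qed

text \<open>Aperiodicity: with \<open>t\<close> close to 1 the chain can waste a step, so what it can reach in \<open>k\<close> steps
  it can almost reach in \<open>n \<ge> k\<close> steps.\<close>

lemma Pn_zero_mono:
  assumes A: "absorbing p A" and c: "continuous_on simplex2 f"
    and nn: "\<And>y. y \<in> A \<Longrightarrow> 0 \<le> f y" and x: "x \<in> A" and z: "(P ^^ n) f x = 0" and k: "k \<le> n"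
  shows "(P ^^ k) f x = 0"
  using k z
proof (induction rule: dec_induct[consumes 1, case_names base step])
  case (step m)
  have "0 \<le> (P ^^ m) f y" if "y \<in> A" for y
    using Pn_mono[OF A _ c, of "\<lambda>_. 0" y m] nn that Pn_const[of y m 0] absorbing_subset[OF A] by auto
  then show ?case
    using P_zero_self[OF A Pn_cont[OF c] _ x, of m] step by simp
qed auto

text \<open>The Doeblin--Fortet inequality. In \<open>p i x * a i x - p i y * a i y\<close>, where \<open>a i\<close> is the average of
  \<open>f\<close> on the segment to the vertex \<open>i\<close>, the variation of \<open>a i\<close> is contracted by \<open>seg_avg_holder\<close> and
  the contracted bounds are averaged with the weights \<open>p i x\<close>; the variation of \<open>p i\<close> is multiplied by
  at most the sup norm of \<open>f\<close>.\<close>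

lemma doeblin_fortet_step:
  obtains D where "D \<ge> 0"
    "\<forall>B C f. HB B C f \<longrightarrow> HB B (C / (1 + \<alpha>) + D * B) (P f)"
proof -
  obtain D where D: "D \<ge> 0" "\<forall>i\<in>{0, 1, 2}. HB 1 D (p i)" by (rule weight_holder)
  show thesis
  proof (rule that[of "3 * D"], goal_cases)
    case 2
    show ?case
    proof (intro allI impI)
      fix B C f assume f: "HB B C f"
      have c: "continuous_on simplex2 f" using f by (rule HB_cont)
      have B: "\<bar>f y\<bar> \<le> B" if "y \<in> simplex2" for y using f that by (simp add: holder_bd_def)
      have B0: "0 \<le> B" using f by (rule holder_bd_nonneg)
      show "HB B (C / (1 + \<alpha>) + 3 * D * B) (P f)"
        unfolding holder_bd_def
      proof (intro conjI ballI)
        fix x assume "x \<in> simplex2"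
        then show "\<bar>P f x\<bar> \<le> B"
          using Pn_bound[OF absorbing_simplex2 c B, of x 1] by simp
      next
        fix x y assume x: "x \<in> simplex2" and y: "y \<in> simplex2"
        let ?s = "\<lambda>i. seg_avg f (vertex i)" and ?d = "dist x y powr \<alpha>"
        have s: "\<bar>?s i y\<bar> \<le> B" for i
        proof -
          have "?s i y \<le> seg_avg (\<lambda>_. B) (vertex i) y" "seg_avg (\<lambda>_. -B) (vertex i) y \<le> ?s i y"
            using B[OF move_simplex2[OF y, of _ i]]
            by (auto intro!: seg_avg_mono c y continuous_intros simp: abs_le_iff minus_le_iff)
          then show ?thesis by (simp add: seg_avg_def)
        qed
        have t: "\<bar>p i x * ?s i x - p i y * ?s i y\<bar> \<le> p i x * (C / (1 + \<alpha>) * ?d) + D * ?d * B"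
          if i: "i \<in> {0,1,2}" for i
        proof -
          have "\<bar>p i x * ?s i x - p i y * ?s i y\<bar>
              = \<bar>p i x * (?s i x - ?s i y) + (p i x - p i y) * ?s i y\<bar>"
            by (rule arg_cong[where f=abs]) algebra
          also have "\<dots> \<le> p i x * \<bar>?s i x - ?s i y\<bar> + \<bar>p i x - p i y\<bar> * \<bar>?s i y\<bar>"
            using nonneg[OF i x] by (intro order_trans[OF abs_triangle_ineq]) (simp add: abs_mult)
          also have "\<dots> \<le> p i x * (C / (1 + \<alpha>) * ?d) + D * ?d * B"
          proof (intro add_mono mult_left_mono mult_mono)
            show "\<bar>?s i x - ?s i y\<bar> \<le> C / (1 + \<alpha>) * ?d"
              using f by (intro seg_avg_holder c x y alpha) (auto simp: holder_bd_def)
            show "\<bar>p i x - p i y\<bar> \<le> D * ?d"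
              using bspec[OF D(2) i] x y by (auto simp: holder_bd_def)
          qed (use nonneg[OF i x] s D(1) in auto)
          finally show ?thesis .
        qed
        have "\<bar>P f x - P f y\<bar> \<le> (\<Sum>i\<in>{0,1,2}. \<bar>p i x * ?s i x - p i y * ?s i y\<bar>)"
          unfolding trans_op_eq[OF c x] trans_op_eq[OF c y] sum_subtractf[symmetric] by (rule sum_abs)
        also have "\<dots> \<le> (\<Sum>i\<in>{0,1,2}. p i x * (C / (1 + \<alpha>) * ?d) + D * ?d * B)"
          using t by (rule sum_mono)
        also have "\<dots> = (p 0 x + p 1 x + p 2 x) * (C / (1 + \<alpha>) * ?d) + 3 * (D * ?d * B)"
          by (simp add: algebra_simps add_divide_distrib)
        also have "\<dots> = (C / (1 + \<alpha>) + 3 * D * B) * ?d"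
          using sum_one[OF x] by (simp add: algebra_simps)
        finally show "\<bar>P f x - P f y\<bar> \<le> (C / (1 + \<alpha>) + 3 * D * B) * ?d" .
      qed
    qed
  qed (use D in simp)
qed

lemma doeblin_fortet:
  obtains r D where "0 \<le> r" "r < 1" "D \<ge> 0"
    "\<forall>B C f n. HB B C f \<longrightarrow> HB B (r ^ n * C + D * B) ((P ^^ n) f)"
proof -
  obtain D where D: "D \<ge> 0" "\<forall>B C f. HB B C f \<longrightarrow> HB B (C / (1 + \<alpha>) + D * B) (P f)"
    by (rule doeblin_fortet_step)
  define r where "r = 1 / (1 + \<alpha>)"
  have r: "0 \<le> r" "r < 1" using alpha by (auto simp: r_def)
  \<comment> \<open>the sum of the geometric series of the errors \<open>D\<close> of the single steps\<close>
  define E where "E = D / (1 - r)"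
  have E: "E = r * E + D" using r by (simp add: E_def field_simps)
  have E0: "E \<ge> 0" using D r by (simp add: E_def)
  show thesis
  proof (rule that[OF r E0], intro allI impI)
    fix B C f n assume f: "HB B C f"
    show "HB B (r ^ n * C + E * B) ((P ^^ n) f)"
    proof (induction n)
      case 0
      have "0 \<le> E * B" using E0 holder_bd_nonneg[OF f] by simp
      then show ?case using holder_bd_mono[OF f, of B "C + E * B"] by simp
    next
      case (Suc n)
      have "(r ^ n * C + E * B) / (1 + \<alpha>) + D * B = r * (r ^ n * C + E * B) + D * B"
        by (simp add: r_def)
      also have "\<dots> = r ^ Suc n * C + (r * E + D) * B" by (simp add: algebra_simps)
      also have "r * E + D = E" by (rule E[symmetric])
      finally have eq: "(r ^ n * C + E * B) / (1 + \<alpha>) + D * B = r ^ Suc n * C + E * B" .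
      show ?case using D(2)[rule_format, OF Suc] unfolding eq by simp
    qed
  qed
qed

lemma Pn_HB:
  assumes "HB B C f"
  obtains C' where "\<And>n. HB B C' ((P ^^ n) f)"
proof -
  obtain r D where rD: "0 \<le> r" "r < 1" "D \<ge> 0"
    "\<forall>B C f n. HB B C f \<longrightarrow> HB B (r ^ n * C + D * B) ((P ^^ n) f)" by (rule doeblin_fortet)
  show thesis
  proof (rule that[of "C + D * B"])
    fix n
    have "r ^ n * C \<le> C" using rD holder_bd_const_nonneg[OF assms] power_le_one[of r n]
      by (simp add: mult_left_le_one_le)
    then show "HB B (C + D * B) ((P ^^ n) f)"
      by (intro holder_bd_mono[OF rD(4)[rule_format, OF assms]]) auto
  qed
qed

section \<open>Minimal absorbing sets\<close>

text \<open>The segment chosen by the chain ends at a vertex (\<open>t = 0\<close>).\<close>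

lemma absorbing_has_vertex:
  assumes "absorbing p K" obtains i where "i \<in> {0,1,2}" "vertex i \<in> K"
proof -
  obtain x where x: "x \<in> K" using assms by (auto simp: absorbing_def)
  then obtain i where i: "i \<in> {0,1,2}" "0 < p i x"
    using weight_pos absorbing_subset[OF assms] by blast
  from absorbing_move[OF assms x i, of 0] i(1) that show thesis by simp
qed

text \<open>The smallest absorbing set containing \<open>x\<close>: the closure of what the chain can reach from \<open>x\<close>.\<close>

definition generated :: "point \<Rightarrow> point set" where
  "generated x = \<Inter> {L. absorbing p L \<and> x \<in> L}"

lemma absorbing_Inter:
  assumes "\<And>L. L \<in> \<L> \<Longrightarrow> absorbing p L" "\<Inter>\<L> \<noteq> {}" "\<L> \<noteq> {}"
  shows "absorbing p (\<Inter>\<L>)"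
  unfolding absorbing_iff
proof (intro conjI ballI impI)
  show "compact (\<Inter>\<L>)"
    using assms(1,3) by (intro compact_Inter) (auto simp: absorbing_def)
  show "\<Inter>\<L> \<subseteq> simplex2" using assms(1,3) absorbing_subset by blast
  fix x i t assume "x \<in> \<Inter>\<L>" "i \<in> {0,1,2}" "0 < p i x" "t \<in> {0..1::real}"
  then show "t *\<^sub>R x + (1 - t) *\<^sub>R vertex i \<in> \<Inter>\<L>"
    by (intro InterI absorbing_move[OF assms(1)]) auto
qed (use assms in auto)

lemma generated_absorbing: "x \<in> simplex2 \<Longrightarrow> absorbing p (generated x)"
  unfolding generated_def using absorbing_simplex2 by (intro absorbing_Inter) auto

lemma generated_least: "absorbing p L \<Longrightarrow> x \<in> L \<Longrightarrow> generated x \<subseteq> L"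
  by (auto simp: generated_def)

lemma minimal_absorbing_generated:
  assumes "K \<in> minimal_absorbing p" "x \<in> K"
  shows "generated x = K"
proof -
  have "absorbing p K" using assms by (simp add: minimal_absorbing_def)
  then have "absorbing p (generated x)" "generated x \<subseteq> K"
    using generated_absorbing generated_least absorbing_subset assms(2) by blast+
  then show ?thesis using assms by (simp add: minimal_absorbing_def)
qed

text \<open>A minimal absorbing set is generated by any of its points, in particular by a vertex; so there
  are at most three.\<close>

lemma minimal_absorbing_subset_generated:
  "minimal_absorbing p \<subseteq> (\<lambda>i. generated (vertex i)) ` {0,1,2}"
proof
  fix K assume K: "K \<in> minimal_absorbing p"
  then have "absorbing p K" by (simp add: minimal_absorbing_def)
  then obtain i where "i \<in> {0,1,2}" "vertex i \<in> K" by (rule absorbing_has_vertex)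
  then show "K \<in> (\<lambda>i. generated (vertex i)) ` {0,1,2}"
    using minimal_absorbing_generated[OF K] by blast
qed

lemma finite_minimal_absorbing: "finite (minimal_absorbing p)"
  by (rule finite_subset[OF minimal_absorbing_subset_generated]) simp

lemma minimal_absorbing_disjoint:
  "K \<in> minimal_absorbing p \<Longrightarrow> L \<in> minimal_absorbing p \<Longrightarrow> K \<noteq> L \<Longrightarrow> K \<inter> L = {}"
  using minimal_absorbing_generated by blast

lemma minimal_absorbingD:
  assumes "K \<in> minimal_absorbing p"
  shows "absorbing p K" "K \<subseteq> simplex2" "compact K" "K \<noteq> {}"
  using assms by (auto simp: minimal_absorbing_def absorbing_def)

text \<open>Every absorbing set contains a vertex, so among the finitely many sets generated by its
  vertices an inclusion-minimal one is minimal absorbing.\<close>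

lemma absorbing_contains_minimal:
  assumes A: "absorbing p A"
  obtains K where "K \<in> minimal_absorbing p" "K \<subseteq> A"
proof -
  define G where "G = (\<lambda>i. generated (vertex i)) ` {i\<in>{0,1,2}. vertex i \<in> A}"
  obtain i where i: "i \<in> {0,1,2}" "vertex i \<in> A" using absorbing_has_vertex[OF A] .
  have "finite G" unfolding G_def by simp
  moreover have "G \<noteq> {}" unfolding G_def using i by blast
  ultimately obtain K where K: "K \<in> G" "\<forall>L\<in>G. L \<subseteq> K \<longrightarrow> K = L"
    using finite_has_minimal by metis
  have KA: "K \<subseteq> A" using K(1) generated_least[OF A] unfolding G_def by blast
  have aK: "absorbing p K" using K(1) generated_absorbing[OF vertex_simplex2] unfolding G_def by blast
  have "L = K" if L: "absorbing p L" "L \<subseteq> K" for L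
  proof -
    obtain j where j: "j \<in> {0,1,2}" "vertex j \<in> L" using absorbing_has_vertex[OF L(1)] .
    then have "generated (vertex j) \<in> G" using L(2) KA unfolding G_def by blast
    moreover have "generated (vertex j) \<subseteq> L" using generated_least[OF L(1) j(2)] .
    ultimately show ?thesis using K(2) L(2) by blast
  qed
  then have "K \<in> minimal_absorbing p" using aK by (simp add: minimal_absorbing_def)
  then show thesis using that KA by blast
qed

section \<open>Limit points of the orbit of a function\<close>

text \<open>The Arzela--Ascoli theorem: bounded families with a common Hoelder constant are uniformly
  equicontinuous, and the bounds pass to the limit.\<close>

lemma HB_compact:
  assumes F: "\<And>n. HB B C (F n)"
  obtains g k where "HB B C g" "strict_mono (k :: nat \<Rightarrow> nat)"
    "\<forall>e>0. \<exists>N. \<forall>n\<ge>N. \<forall>x\<in>simplex2. \<bar>F (k n) x - g x\<bar> < e"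
proof -
  have C: "0 \<le> C" using holder_bd_const_nonneg[OF F] .
  have "\<exists>d>0. \<forall>n y. y \<in> simplex2 \<and> norm (x - y) < d \<longrightarrow> norm (F n x - F n y) < e"
    if x: "x \<in> simplex2" and e: "0 < e" for x e
  proof (intro exI conjI allI impI)
    let ?d = "(e / (C + 1)) powr (1 / \<alpha>)"
    show "0 < ?d" using e C by simp
    fix n y assume y: "y \<in> simplex2 \<and> norm (x - y) < ?d"
    have "norm (F n x - F n y) \<le> C * dist x y powr \<alpha>"
      using F[of n] x y by (simp add: holder_bd_def)
    also have "\<dots> \<le> C * (?d powr \<alpha>)"
      using y C alpha by (intro mult_left_mono powr_mono2) (auto simp: dist_norm)
    also have "?d powr \<alpha> = e / (C + 1)"
      using alpha e C by (simp add: powr_powr)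
    also have "C * (e / (C + 1)) < e"
      using e C by (simp add: field_simps)
    finally show "norm (F n x - F n y) < e" .
  qed
  moreover have "norm (F n x) \<le> B" if "x \<in> simplex2" for n x
    using F[of n] that by (simp add: holder_bd_def)
  ultimately obtain g k where g: "strict_mono (k :: nat \<Rightarrow> nat)"
    "\<And>e. 0 < e \<Longrightarrow> \<exists>N. \<forall>n x. n \<ge> N \<and> x \<in> simplex2 \<longrightarrow> norm (F (k n) x - g x) < e"
    using Arzela_Ascoli[OF compact_simplex2, of F B] by metis
  have lim: "(\<lambda>n. F (k n) x) \<longlonglongrightarrow> g x" if "x \<in> simplex2" for x
    unfolding LIMSEQ_iff using g(2) that by meson
  have "HB B C g"
    unfolding holder_bd_def
  proof (intro conjI ballI)
    fix x assume x: "x \<in> simplex2"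
    show "\<bar>g x\<bar> \<le> B"
      by (rule LIMSEQ_le_const2[OF tendsto_rabs[OF lim[OF x]]])
         (use F x in \<open>auto simp: holder_bd_def\<close>)
    fix y assume y: "y \<in> simplex2"
    show "\<bar>g x - g y\<bar> \<le> C * dist x y powr \<alpha>"
      by (rule LIMSEQ_le_const2[OF tendsto_rabs[OF tendsto_diff[OF lim[OF x] lim[OF y]]]])
         (use F x y in \<open>auto simp: holder_bd_def\<close>)
  qed
  moreover have "\<forall>e>0. \<exists>N. \<forall>n\<ge>N. \<forall>x\<in>simplex2. \<bar>F (k n) x - g x\<bar> < e"
    using g(2) by (metis real_norm_def)
  ultimately show thesis using that g(1) by blast
qed

text \<open>The omega-limit set of \<open>u\<close> under \<open>P\<close>, for uniform convergence on the triangle.\<close>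

definition limit_points :: "(point \<Rightarrow> real) \<Rightarrow> (point \<Rightarrow> real) set" where
  "limit_points u = {g. (\<exists>B C. HB B C g) \<and>
     (\<forall>e>0. \<forall>N. \<exists>n\<ge>N. \<forall>x\<in>simplex2. \<bar>(P ^^ n) u x - g x\<bar> < e)}"

lemma limit_points_cont: "g \<in> limit_points u \<Longrightarrow> continuous_on simplex2 g"
  unfolding limit_points_def using HB_cont by blast

text \<open>The times \<open>m j\<close> tend to infinity, so compactness yields a limit point along any choice of such
  times.\<close>

lemma subsequence_limit_points:
  assumes u: "HB B C u" and m: "\<And>j. j \<le> (m :: nat \<Rightarrow> nat) j"
  obtains g k where "g \<in> limit_points u" "strict_mono (k :: nat \<Rightarrow> nat)"
    "\<forall>e>0. \<exists>N. \<forall>n\<ge>N. \<forall>x\<in>simplex2. \<bar>(P ^^ m (k n)) u x - g x\<bar> < e"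
proof -
  obtain C' where C': "\<And>n. HB B C' ((P ^^ n) u)" using Pn_HB[OF u] by metis
  obtain g k where g: "HB B C' g" "strict_mono (k :: nat \<Rightarrow> nat)"
    "\<forall>e>0. \<exists>N. \<forall>n\<ge>N. \<forall>x\<in>simplex2. \<bar>(P ^^ m (k n)) u x - g x\<bar> < e"
    using HB_compact[of B C' "\<lambda>j. (P ^^ m j) u"] C' by metis
  have "\<exists>n\<ge>N. \<forall>x\<in>simplex2. \<bar>(P ^^ n) u x - g x\<bar> < e" if e: "e > 0" for e N
  proof -
    obtain N' where N': "\<forall>n\<ge>N'. \<forall>x\<in>simplex2. \<bar>(P ^^ m (k n)) u x - g x\<bar> < e" using g(3) e by blast
    have "N \<le> m (k (max N N'))"
      using m[of "k (max N N')"] seq_suble[OF g(2), of "max N N'"] by linarith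
    then show ?thesis using N' by (intro exI[of _ "m (k (max N N'))"]) auto
  qed
  then have "g \<in> limit_points u" using g(1) by (auto simp: limit_points_def)
  then show thesis using that g(2,3) by blast
qed

lemma limit_points_nonempty:
  assumes "HB B C u" shows "\<exists>g. g \<in> limit_points u"
  by (rule subsequence_limit_points[OF assms, of "\<lambda>j. j"]) blast+

text \<open>If the iterates at the times \<open>m j\<close> approach \<open>g\<close>, then those at the times \<open>m j - n\<close> accumulate at
  some \<open>h\<close>, and \<open>P ^^ n\<close> maps \<open>h\<close> to \<open>g\<close> by continuity.\<close>

lemma limit_points_preimage:
  assumes u: "HB B C u" and g: "g \<in> limit_points u"
  obtains h where "h \<in> limit_points u" "\<forall>x\<in>simplex2. (P ^^ n) h x = g x"
proof -
  \<comment> \<open>times at least \<open>j + n\<close>, so that \<open>n\<close> steps can be taken back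
    and the remaining times still tend to infinity\<close>
  have "\<forall>j. \<exists>m\<ge>j + n. \<forall>x\<in>simplex2. \<bar>(P ^^ m) u x - g x\<bar> < 1 / real (Suc j)"
    using g by (simp add: limit_points_def)
  then obtain m where m: "\<And>j. j + n \<le> m j"
    "\<And>j x. x \<in> simplex2 \<Longrightarrow> \<bar>(P ^^ m j) u x - g x\<bar> < 1 / real (Suc j)"
    by metis
  have "j \<le> m j - n" for j using m(1)[of j] by simp
  then obtain h k where h: "h \<in> limit_points u" "strict_mono (k :: nat \<Rightarrow> nat)"
    "\<forall>e>0. \<exists>N. \<forall>i\<ge>N. \<forall>x\<in>simplex2. \<bar>(P ^^ (m (k i) - n)) u x - h x\<bar> < e"
    using subsequence_limit_points[OF u, of "\<lambda>j. m j - n"] by metis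
  have cu: "continuous_on simplex2 u" using HB_cont[OF u] .
  have ch: "continuous_on simplex2 h" using limit_points_cont[OF h(1)] .
  have "(P ^^ n) h x = g x" if x: "x \<in> simplex2" for x
  proof (rule ccontr)
    assume ne: "(P ^^ n) h x \<noteq> g x"
    define e where "e = \<bar>(P ^^ n) h x - g x\<bar> / 2"
    have e: "e > 0" using ne by (simp add: e_def)
    obtain N where N: "\<forall>i\<ge>N. \<forall>x\<in>simplex2. \<bar>(P ^^ (m (k i) - n)) u x - h x\<bar> < e" using h(3) e by blast
    obtain N2 where N2: "1 / real (Suc N2) < e"
      using e reals_Archimedean by (metis inverse_eq_divide)
    define i where "i = max N N2"
    have ki: "i \<le> k i" using seq_suble[OF h(2)] .
    have "\<bar>(P ^^ n) (\<lambda>y. (P ^^ (m (k i) - n)) u y - h y) x\<bar> \<le> e"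
      by (rule Pn_bound[OF absorbing_simplex2 _ _ x])
         (use N in \<open>auto simp: i_def less_imp_le intro!: continuous_intros Pn_cont cu ch\<close>)
    then have "\<bar>(P ^^ n) ((P ^^ (m (k i) - n)) u) x - (P ^^ n) h x\<bar> \<le> e"
      by (simp add: Pn_diff Pn_cont cu ch x)
    moreover have "(P ^^ n) ((P ^^ (m (k i) - n)) u) = (P ^^ m (k i)) u"
      using m(1)[of "k i"] by (simp flip: Pn_add)
    moreover have "\<bar>(P ^^ m (k i)) u x - g x\<bar> < e"
    proof -
      have "1 / real (Suc (k i)) \<le> 1 / real (Suc N2)"
        using ki unfolding i_def by (intro divide_left_mono) auto
      then show ?thesis using m(2)[OF x, of "k i"] N2 by linarith
    qed
    ultimately have "\<bar>(P ^^ n) h x - g x\<bar> < 2 * e" by (simp add: abs_if split: if_splits)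
    then show False by (simp add: e_def)
  qed
  then show thesis using that h(1) by blast
qed

text \<open>Limit points of an orbit accumulate at limit points of the same orbit, by a diagonal choice.\<close>

lemma limit_points_closed:
  assumes u: "HB B C u" and g: "\<And>n. g n \<in> limit_points u"
  obtains h k where "h \<in> limit_points u" "strict_mono (k :: nat \<Rightarrow> nat)"
    "\<forall>e>0. \<exists>N. \<forall>n\<ge>N. \<forall>x\<in>simplex2. \<bar>g (k n) x - h x\<bar> < e"
proof -
  have "\<forall>j. \<exists>m\<ge>j. \<forall>x\<in>simplex2. \<bar>(P ^^ m) u x - g j x\<bar> < 1 / real (Suc j)"
    using g by (simp add: limit_points_def)
  then obtain m where m: "\<And>j. j \<le> m j"
    "\<And>j x. x \<in> simplex2 \<Longrightarrow> \<bar>(P ^^ m j) u x - g j x\<bar> < 1 / real (Suc j)"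
    by metis
  obtain h k where h: "h \<in> limit_points u" "strict_mono (k :: nat \<Rightarrow> nat)"
    "\<forall>e>0. \<exists>N. \<forall>i\<ge>N. \<forall>x\<in>simplex2. \<bar>(P ^^ m (k i)) u x - h x\<bar> < e"
    using subsequence_limit_points[OF u m(1)] by metis
  have "\<exists>N. \<forall>n\<ge>N. \<forall>x\<in>simplex2. \<bar>g (k n) x - h x\<bar> < e" if e: "e > 0" for e
  proof -
    obtain N where N: "\<forall>i\<ge>N. \<forall>x\<in>simplex2. \<bar>(P ^^ m (k i)) u x - h x\<bar> < e / 2"
      using h(3) e by (meson half_gt_zero)
    obtain N2 where N2: "1 / real (Suc N2) < e / 2"
      using e reals_Archimedean by (metis half_gt_zero inverse_eq_divide)
    show ?thesis
    proof (intro exI allI impI ballI)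
      fix n x assume n: "max N N2 \<le> n" and x: "x \<in> simplex2"
      have "1 / real (Suc (k n)) \<le> 1 / real (Suc N2)"
        using n seq_suble[OF h(2), of n] by (intro divide_left_mono) auto
      moreover have "\<bar>(P ^^ m (k n)) u x - h x\<bar> < e / 2" using N n x by simp
      ultimately show "\<bar>g (k n) x - h x\<bar> < e"
        using m(2)[OF x, of "k n"] N2 by linarith
    qed
  qed
  then show thesis using that h(1,2) by blast
qed

definition sup_on :: "point set \<Rightarrow> (point \<Rightarrow> real) \<Rightarrow> real" where
  "sup_on A f = (SUP x\<in>A. f x)"

lemma sup_on_upper:
  assumes "absorbing p A" "continuous_on simplex2 f" "x \<in> A"
  shows "f x \<le> sup_on A f"
proof -
  have "compact (f ` A)"
    using assms absorbing_subset[OF assms(1)] unfolding absorbing_def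
    by (intro compact_continuous_image continuous_on_subset[OF assms(2)]) auto
  then show ?thesis unfolding sup_on_def
    using assms(3) by (intro cSUP_upper bounded_imp_bdd_above compact_imp_bounded)
qed

lemma sup_on_attained:
  assumes "absorbing p A" "continuous_on simplex2 f"
  obtains x where "x \<in> A" "f x = sup_on A f"
proof -
  have "continuous_on A f" using assms absorbing_subset continuous_on_subset by blast
  then obtain x where x: "x \<in> A" "\<forall>y\<in>A. f y \<le> f x"
    using continuous_attains_sup[of A f] assms(1) by (auto simp: absorbing_def)
  have "sup_on A f \<le> f x" unfolding sup_on_def using x by (intro cSUP_least) auto
  moreover have "f x \<le> sup_on A f" using sup_on_upper assms x by blast
  ultimately have "f x = sup_on A f" by simp
  then show thesis using that x(1) by blast
qed

text \<open>Along the orbit the supremum over an absorbing set decreases, so all limit points have the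
  same supremum.\<close>

lemma limit_points_sup:
  assumes A: "absorbing p A" and u: "HB B C u"
  obtains M where "(\<lambda>n. sup_on A ((P ^^ n) u)) \<longlonglongrightarrow> M"
    "\<forall>g\<in>limit_points u. sup_on A g = M"
proof -
  let ?s = "\<lambda>n. sup_on A ((P ^^ n) u)"
  have cu: "continuous_on simplex2 ((P ^^ n) u)" for n using Pn_cont[OF HB_cont[OF u]] .
  have uB: "\<bar>u y\<bar> \<le> B" if "y \<in> simplex2" for y using u that by (simp add: holder_bd_def)
  obtain x0 where x0: "x0 \<in> A" using A by (auto simp: absorbing_def)
  have dec: "decseq ?s"
    unfolding decseq_Suc_iff
  proof
    fix n
    obtain x where x: "x \<in> A" "(P ^^ Suc n) u x = ?s (Suc n)" using sup_on_attained[OF A cu] .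
    have "P ((P ^^ n) u) x \<le> P (\<lambda>_. ?s n) x"
      by (rule P_mono[OF A cu _ _ x(1)]) (auto intro: sup_on_upper[OF A cu])
    then show "?s (Suc n) \<le> ?s n"
      using x P_const absorbing_subset[OF A] by fastforce
  qed
  have lb: "- B \<le> ?s n" for n
  proof -
    have "\<bar>(P ^^ n) u x0\<bar> \<le> B"
      using Pn_bound[OF absorbing_simplex2 HB_cont[OF u] uB] absorbing_subset[OF A] x0 by blast
    then show ?thesis using sup_on_upper[OF A cu x0, of n] by linarith
  qed
  obtain M where M: "?s \<longlonglongrightarrow> M" "\<And>i. M \<le> ?s i" using decseq_convergent[OF dec, of "-B"] lb by blast
  have "sup_on A g = M" if g: "g \<in> limit_points u" for g
  proof -
    have cg: "continuous_on simplex2 g" using limit_points_cont[OF g] .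
    obtain x where x: "x \<in> A" "g x = sup_on A g" using sup_on_attained[OF A cg] .
    have near: "\<exists>n\<ge>N. \<forall>y\<in>A. \<bar>(P ^^ n) u y - g y\<bar> < e" if "e > 0" for e N
      using g that absorbing_subset[OF A] unfolding limit_points_def by blast
    have "sup_on A g \<le> M"
    proof (rule field_le_epsilon)
      fix e :: real assume e: "e > 0"
      obtain N where N: "\<And>n. n \<ge> N \<Longrightarrow> \<bar>?s n - M\<bar> < e / 2"
        using M(1) e unfolding LIMSEQ_iff by (metis half_gt_zero real_norm_def)
      obtain n where n: "n \<ge> N" "\<forall>y\<in>A. \<bar>(P ^^ n) u y - g y\<bar> < e / 2" using near e half_gt_zero by blast
      have "\<bar>(P ^^ n) u x - g x\<bar> < e / 2" using n(2) x by blast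
      then show "sup_on A g \<le> M + e"
        using N[OF n(1)] sup_on_upper[OF A cu x(1), of n] x(2) by linarith
    qed
    moreover have "M \<le> sup_on A g"
    proof (rule field_le_epsilon)
      fix e :: real assume e: "e > 0"
      obtain n where n: "\<forall>y\<in>A. \<bar>(P ^^ n) u y - g y\<bar> < e" using near e by blast
      obtain y where y: "y \<in> A" "(P ^^ n) u y = ?s n" using sup_on_attained[OF A cu] .
      have "\<bar>(P ^^ n) u y - g y\<bar> < e" using n y by blast
      then show "M \<le> sup_on A g + e"
        using M(2)[of n] y sup_on_upper[OF A cg y(1)] by linarith
    qed
    ultimately show ?thesis by simp
  qed
  then show thesis using that M(1) by blast
qed

text \<open>The maximum principle behind all convergence results. Let \<open>M\<close> be the common supremum on \<open>A\<close>
  of the limit points. A limit point \<open>g\<close> reaches \<open>M\<close> at some \<open>x\<close>, and \<open>g\<close> is the \<open>n\<close>-th iterate of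
  another limit point, which must then equal \<open>M\<close> wherever the chain can be after \<open>n\<close> steps from \<open>x\<close>.
  As \<open>n\<close> grows these functions accumulate at a limit point equal to \<open>M\<close> on everything that can be
  reached from \<open>x\<close>, hence on some minimal absorbing set.\<close>

lemma limit_point_maximal:
  assumes A: "absorbing p A" and u: "HB B C u"
    and M: "\<forall>g\<in>limit_points u. sup_on A g = M"
  obtains g K where "g \<in> limit_points u" "K \<in> minimal_absorbing p" "K \<subseteq> A" "\<forall>x\<in>K. g x = M"
proof -
  obtain g0 where g0: "g0 \<in> limit_points u" using limit_points_nonempty[OF u] by blast
  obtain x0 where x0: "x0 \<in> A" "g0 x0 = M"
    using sup_on_attained[OF A limit_points_cont[OF g0]] M g0 by metis
  have x0s: "x0 \<in> simplex2" using x0 absorbing_subset[OF A] by auto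
  have "\<forall>n. \<exists>h. h \<in> limit_points u \<and> (\<forall>x\<in>simplex2. (P ^^ n) h x = g0 x)"
    using limit_points_preimage[OF u g0] by metis
  then obtain h where h: "\<And>n. h n \<in> limit_points u" "\<And>n x. x \<in> simplex2 \<Longrightarrow> (P ^^ n) (h n) x = g0 x"
    by metis
  have ch: "continuous_on simplex2 (h n)" for n using limit_points_cont[OF h(1)] .
  have hM: "h n y \<le> M" if "y \<in> A" for n y
    using sup_on_upper[OF A ch that] M h(1) by metis
  \<comment> \<open>the deficit \<open>M - h n\<close> is nonnegative on \<open>A\<close>, and its mean after \<open>n\<close> steps from \<open>x0\<close> vanishes\<close>
  have hk: "(P ^^ k) (h n) x0 = M" if "k \<le> n" for k n
  proof -
    have z: "(P ^^ j) (\<lambda>y. M - h n y) x0 = M - (P ^^ j) (h n) x0" for j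
      using Pn_diff[OF continuous_on_const ch x0s] Pn_const[OF x0s] by simp
    have "(P ^^ k) (\<lambda>y. M - h n y) x0 = 0"
      by (rule Pn_zero_mono[OF A _ _ x0(1) _ that])
         (use hM h(2)[OF x0s] x0(2) in \<open>auto simp: z intro!: continuous_intros ch\<close>)
    then show ?thesis using z by simp
  qed
  obtain g k where g: "g \<in> limit_points u" "strict_mono (k :: nat \<Rightarrow> nat)"
    "\<forall>e>0. \<exists>N. \<forall>n\<ge>N. \<forall>x\<in>simplex2. \<bar>h (k n) x - g x\<bar> < e"
    using limit_points_closed[OF u, of h, OF h(1)] .
  have cg: "continuous_on simplex2 g" using limit_points_cont[OF g(1)] .
  define f where "f y = M - g y" for y
  have cf: "continuous_on simplex2 f" unfolding f_def by (intro continuous_intros cg)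
  have f0: "0 \<le> f y" if "y \<in> A" for y
    using sup_on_upper[OF A cg that] M g(1) by (simp add: f_def)
  \<comment> \<open>for fixed \<open>j\<close> pass to the limit in \<open>hk\<close> along the subsequence\<close>
  have fz: "(P ^^ j) f x0 = 0" for j
  proof -
    have "(P ^^ j) g x0 = M"
    proof (rule ccontr)
      assume ne: "(P ^^ j) g x0 \<noteq> M"
      define e where "e = \<bar>(P ^^ j) g x0 - M\<bar> / 2"
      have e: "e > 0" using ne by (simp add: e_def)
      obtain N where N: "\<forall>n\<ge>N. \<forall>x\<in>simplex2. \<bar>h (k n) x - g x\<bar> < e" using g(3) e by blast
      define n where "n = max N j"
      have "\<bar>(P ^^ j) (\<lambda>y. h (k n) y - g y) x0\<bar> \<le> e"
        by (rule Pn_bound[OF absorbing_simplex2 _ _ x0s])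
           (use N in \<open>auto simp: n_def less_imp_le intro!: continuous_intros ch cg\<close>)
      then have "\<bar>(P ^^ j) (h (k n)) x0 - (P ^^ j) g x0\<bar> \<le> e"
        by (simp add: Pn_diff ch cg x0s)
      moreover have "(P ^^ j) (h (k n)) x0 = M"
        using seq_suble[OF g(2), of n] by (intro hk) (simp add: n_def)
      ultimately show False using e by (simp add: e_def abs_minus_commute)
    qed
    then show ?thesis
      using Pn_diff[OF continuous_on_const cg x0s, of j M] Pn_const[OF x0s, of j M]
      by (simp add: f_def[abs_def])
  qed
  \<comment> \<open>the points from which the deficit of \<open>g\<close> vanishes in mean forever; they form an absorbing set\<close>
  define Z where "Z = {z\<in>A. \<forall>j. (P ^^ j) f z = 0}"
  have "absorbing p Z"
    unfolding absorbing_iff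
  proof (intro conjI ballI impI)
    show "Z \<noteq> {}" using x0(1) fz unfolding Z_def by blast
    show "Z \<subseteq> simplex2" using absorbing_subset[OF A] by (auto simp: Z_def)
    have "Z = A \<inter> (\<Inter>j. {z\<in>simplex2. (P ^^ j) f z = 0})"
      using absorbing_subset[OF A] by (auto simp: Z_def)
    moreover have "closed {z\<in>simplex2. (P ^^ j) f z = 0}" for j
      using continuous_closed_preimage_constant[OF Pn_cont[OF cf] closed_simplex2, of j 0] by simp
    ultimately show "compact Z"
      using A unfolding absorbing_def by (auto intro!: compact_Int_closed closed_INT)
    fix z i t assume z: "z \<in> Z" and i: "i \<in> {0,1,2}" "0 < p i z" and t: "t \<in> {0..1::real}"
    have zA: "z \<in> A" using z by (simp add: Z_def)
    have "(P ^^ j) f (t *\<^sub>R z + (1 - t) *\<^sub>R vertex i) = 0" for j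
    proof (rule P_zero_segment[OF A Pn_cont[OF cf] _ zA _ i])
      fix y assume y: "y \<in> A"
      show "0 \<le> (P ^^ j) f y"
        using Pn_mono[OF A continuous_on_const cf f0 y, of j] Pn_const[of y j 0]
          absorbing_subset[OF A] y by auto
    next
      have "(P ^^ Suc j) f z = 0" using z unfolding Z_def by blast
      then show "P ((P ^^ j) f) z = 0" by simp
    qed (use t in auto)
    moreover have "t *\<^sub>R z + (1 - t) *\<^sub>R vertex i \<in> A"
      using absorbing_move[OF A zA i] t by simp
    ultimately show "t *\<^sub>R z + (1 - t) *\<^sub>R vertex i \<in> Z" by (simp add: Z_def)
  qed
  then obtain K where K: "K \<in> minimal_absorbing p" "K \<subseteq> Z" by (rule absorbing_contains_minimal)
  have "g x = M" if "x \<in> K" for x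
  proof -
    have "(P ^^ 0) f x = 0" using K(2) that unfolding Z_def by blast
    then show ?thesis by (simp add: f_def)
  qed
  moreover have "K \<subseteq> A" using K(2) by (auto simp: Z_def)
  ultimately show thesis using that g(1) K(1) by blast
qed

lemma HB_uminus: "HB B C f \<Longrightarrow> HB B C (\<lambda>x. - f x)"
  unfolding holder_bd_def by (simp add: abs_minus_commute)

lemma Pn_uminus:
  "continuous_on simplex2 f \<Longrightarrow> x \<in> simplex2 \<Longrightarrow> (P ^^ n) (\<lambda>y. - f y) x = - (P ^^ n) f x"
  using Pn_lin[of f f x n "-1" 0] by simp

lemma limit_points_uminus:
  assumes u: "HB B C u" and g: "g \<in> limit_points u"
  shows "(\<lambda>x. - g x) \<in> limit_points (\<lambda>x. - u x)"
proof -
  obtain B' C' where "HB B' C' g" using g by (auto simp: limit_points_def)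
  moreover have "\<exists>n\<ge>N. \<forall>x\<in>simplex2. \<bar>(P ^^ n) (\<lambda>x. - u x) x - - g x\<bar> < e" if e: "e > 0" for e N
  proof -
    obtain n where "n \<ge> N" "\<forall>x\<in>simplex2. \<bar>(P ^^ n) u x - g x\<bar> < e"
      using g e unfolding limit_points_def by blast
    then show ?thesis
      by (intro exI[of _ n]) (auto simp: Pn_uminus HB_cont[OF u] abs_minus_commute)
  qed
  ultimately show ?thesis unfolding limit_points_def using HB_uminus by blast
qed

text \<open>On a minimal absorbing set the iterates converge to a constant: some limit point is constant
  and equal to the common maximum of all limit points, so this maximum is also the common minimum.\<close>

lemma minimal_converges_constant:
  assumes K: "K \<in> minimal_absorbing p" and u: "HB B C u"
  shows "\<exists>c. \<forall>e>0. \<exists>N. \<forall>n\<ge>N. \<forall>x\<in>K. \<bar>(P ^^ n) u x - c\<bar> < e"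
proof -
  note A = minimal_absorbingD(1)[OF K]
  have cu: "continuous_on simplex2 ((P ^^ n) u)" for n using Pn_cont[OF HB_cont[OF u]] .
  have u': "HB B C (\<lambda>x. - u x)" using HB_uminus[OF u] .
  obtain M where M: "(\<lambda>n. sup_on K ((P ^^ n) u)) \<longlonglongrightarrow> M" "\<forall>g\<in>limit_points u. sup_on K g = M"
    using limit_points_sup[OF A u] .
  obtain m where m: "(\<lambda>n. sup_on K ((P ^^ n) (\<lambda>x. - u x))) \<longlonglongrightarrow> m"
      "\<forall>g\<in>limit_points (\<lambda>x. - u x). sup_on K g = m"
    using limit_points_sup[OF A u'] .
  obtain g L where g: "g \<in> limit_points u" "L \<in> minimal_absorbing p" "L \<subseteq> K" "\<forall>x\<in>L. g x = M"
    using limit_point_maximal[OF A u M(2)] .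
  have "L = K" using K g(2,3) unfolding minimal_absorbing_def by blast
  then have gM: "\<forall>x\<in>K. g x = M" using g by simp
  have "sup_on K (\<lambda>x. - g x) = - M"
    using gM minimal_absorbingD(4)[OF K] unfolding sup_on_def by simp
  then have mM: "m = - M" using limit_points_uminus[OF u g(1)] m(2) by metis
  show ?thesis
  proof (rule exI[of _ M], intro allI impI)
    fix e :: real assume e: "e > 0"
    obtain N1 where N1: "\<forall>n\<ge>N1. \<bar>sup_on K ((P ^^ n) u) - M\<bar> < e"
      using M(1) e unfolding LIMSEQ_iff by (metis real_norm_def)
    obtain N2 where N2: "\<forall>n\<ge>N2. \<bar>sup_on K ((P ^^ n) (\<lambda>x. - u x)) - m\<bar> < e"
      using m(1) e unfolding LIMSEQ_iff by (metis real_norm_def)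
    show "\<exists>N. \<forall>n\<ge>N. \<forall>x\<in>K. \<bar>(P ^^ n) u x - M\<bar> < e"
    proof (intro exI allI impI ballI)
      fix n x assume n: "n \<ge> max N1 N2" and x: "x \<in> K"
      have xs: "x \<in> simplex2" using x minimal_absorbingD(2)[OF K] by auto
      have "(P ^^ n) u x \<le> sup_on K ((P ^^ n) u)" using sup_on_upper[OF A cu x] .
      moreover have "- (P ^^ n) u x \<le> sup_on K ((P ^^ n) (\<lambda>x. - u x))"
        using sup_on_upper[OF A Pn_cont[OF HB_cont[OF u']] x, of n]
        by (simp add: Pn_uminus[OF HB_cont[OF u] xs])
      moreover have "\<bar>sup_on K ((P ^^ n) u) - M\<bar> < e" "\<bar>sup_on K ((P ^^ n) (\<lambda>x. - u x)) - m\<bar> < e"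
        using N1 N2 n by auto
      ultimately show "\<bar>(P ^^ n) u x - M\<bar> < e" using mM by linarith
    qed
  qed
qed

text \<open>If the iterates vanish asymptotically on all minimal absorbing sets, the common supremum of
  the limit points, being the value of one of them on a minimal absorbing set, is zero.\<close>

lemma vanishing_on_minimal_sup:
  assumes u: "HB B C u"
    and z: "\<And>K x. K \<in> minimal_absorbing p \<Longrightarrow> x \<in> K \<Longrightarrow> (\<lambda>n. (P ^^ n) u x) \<longlonglongrightarrow> 0"
  shows "(\<lambda>n. sup_on simplex2 ((P ^^ n) u)) \<longlonglongrightarrow> 0"
proof -
  note A = absorbing_simplex2
  obtain M where M: "(\<lambda>n. sup_on simplex2 ((P ^^ n) u)) \<longlonglongrightarrow> M" "\<forall>g\<in>limit_points u. sup_on simplex2 g = M"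
    using limit_points_sup[OF A u] .
  obtain g L where g: "g \<in> limit_points u" "L \<in> minimal_absorbing p" "L \<subseteq> simplex2" "\<forall>x\<in>L. g x = M"
    using limit_point_maximal[OF A u M(2)] .
  obtain x where x: "x \<in> L" using minimal_absorbingD(4)[OF g(2)] by auto
  have "\<bar>M\<bar> \<le> e" if e: "e > 0" for e
  proof -
    obtain N where N: "\<forall>n\<ge>N. \<bar>(P ^^ n) u x\<bar> < e / 2"
      using z[OF g(2) x] e unfolding LIMSEQ_iff by (metis diff_zero half_gt_zero real_norm_def)
    obtain n where "n \<ge> N" "\<forall>x\<in>simplex2. \<bar>(P ^^ n) u x - g x\<bar> < e / 2"
      using g(1) half_gt_zero[OF e] unfolding limit_points_def by blast
    then have "\<bar>(P ^^ n) u x\<bar> < e / 2" "\<bar>(P ^^ n) u x - M\<bar> < e / 2"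
      using N g(3,4) x by auto
    then show ?thesis by linarith
  qed
  then have "M = 0" by (metis abs_le_zero_iff dense_ge)
  then show ?thesis using M(1) by simp
qed

lemma vanishing_on_minimal:
  assumes u: "HB B C u"
    and z: "\<And>K x. K \<in> minimal_absorbing p \<Longrightarrow> x \<in> K \<Longrightarrow> (\<lambda>n. (P ^^ n) u x) \<longlonglongrightarrow> 0"
  shows "\<forall>e>0. \<exists>N. \<forall>n\<ge>N. \<forall>x\<in>simplex2. \<bar>(P ^^ n) u x\<bar> < e"
proof (intro allI impI)
  fix e :: real assume e: "e > 0"
  note cu = HB_cont[OF u] and u' = HB_uminus[OF u]
  have z': "(\<lambda>n. (P ^^ n) (\<lambda>y. - u y) x) \<longlonglongrightarrow> 0" if "K \<in> minimal_absorbing p" "x \<in> K" for K x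
  proof -
    have "x \<in> simplex2" using minimal_absorbingD(2)[OF that(1)] that(2) by blast
    then show ?thesis using tendsto_minus[OF z[OF that]] by (simp add: Pn_uminus[OF cu])
  qed
  have s1: "(\<lambda>n. sup_on simplex2 ((P ^^ n) u)) \<longlonglongrightarrow> 0"
    by (rule vanishing_on_minimal_sup[OF u]) (rule z)
  have s2: "(\<lambda>n. sup_on simplex2 ((P ^^ n) (\<lambda>y. - u y))) \<longlonglongrightarrow> 0"
    by (rule vanishing_on_minimal_sup[OF u']) (rule z')
  obtain N1 where N1: "\<forall>n\<ge>N1. \<bar>sup_on simplex2 ((P ^^ n) u)\<bar> < e"
    using s1 e unfolding LIMSEQ_iff real_norm_def diff_zero by blast
  obtain N2 where N2: "\<forall>n\<ge>N2. \<bar>sup_on simplex2 ((P ^^ n) (\<lambda>y. - u y))\<bar> < e"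
    using s2 e unfolding LIMSEQ_iff real_norm_def diff_zero by blast
  show "\<exists>N. \<forall>n\<ge>N. \<forall>x\<in>simplex2. \<bar>(P ^^ n) u x\<bar> < e"
  proof (intro exI allI impI ballI)
    fix n x assume n: "n \<ge> max N1 N2" and x: "x \<in> simplex2"
    have "(P ^^ n) u x \<le> sup_on simplex2 ((P ^^ n) u)"
      using sup_on_upper[OF absorbing_simplex2 Pn_cont[OF cu] x] .
    moreover have "- (P ^^ n) u x \<le> sup_on simplex2 ((P ^^ n) (\<lambda>x. - u x))"
      using sup_on_upper[OF absorbing_simplex2 Pn_cont[OF HB_cont[OF u']] x, of n]
      by (simp add: Pn_uminus[OF cu x])
    moreover have "\<bar>sup_on simplex2 ((P ^^ n) u)\<bar> < e" "\<bar>sup_on simplex2 ((P ^^ n) (\<lambda>y. - u y))\<bar> < e"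
      using N1 N2 n by auto
    ultimately show "\<bar>(P ^^ n) u x\<bar> < e" by linarith
  qed
qed

section \<open>Limits of iterates and their rate\<close>

text \<open>The constant to which the iterates of \<open>f\<close> converge on the minimal absorbing set \<open>K\<close>; any point
  of \<open>K\<close> can be used to compute it.\<close>

definition lim_val :: "point set \<Rightarrow> (point \<Rightarrow> real) \<Rightarrow> real" where
  "lim_val K f = lim (\<lambda>n. (P ^^ n) f (SOME x. x \<in> K))"

lemma lim_val_tendsto:
  assumes K: "K \<in> minimal_absorbing p" and f: "HB B C f" and x: "x \<in> K"
  shows "(\<lambda>n. (P ^^ n) f x) \<longlonglongrightarrow> lim_val K f"
proof -
  obtain c where c: "\<forall>e>0. \<exists>N. \<forall>n\<ge>N. \<forall>x\<in>K. \<bar>(P ^^ n) f x - c\<bar> < e"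
    using minimal_converges_constant[OF K f] by blast
  have lim: "(\<lambda>n. (P ^^ n) f y) \<longlonglongrightarrow> c" if "y \<in> K" for y
    unfolding LIMSEQ_iff real_norm_def using c that by meson
  have "(SOME x. x \<in> K) \<in> K" using x by (rule someI)
  then have "lim_val K f = c" unfolding lim_val_def using lim limI by blast
  then show ?thesis using lim[OF x] by simp
qed

lemma lim_val_unique:
  assumes "K \<in> minimal_absorbing p" "HB B C f" "x \<in> K" "(\<lambda>n. (P ^^ n) f x) \<longlonglongrightarrow> l"
  shows "lim_val K f = l"
  using lim_val_tendsto[OF assms(1-3)] assms(4) LIMSEQ_unique by blast

lemma HB_lin:
  assumes "HB B C f" "HB B' C' g"
  shows "HB (\<bar>a\<bar> * B + \<bar>b\<bar> * B') (\<bar>a\<bar> * C + \<bar>b\<bar> * C') (\<lambda>x. a * f x + b * g x)"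
  unfolding holder_bd_def
proof (intro conjI ballI)
  fix x assume x: "x \<in> simplex2"
  have "\<bar>a * f x + b * g x\<bar> \<le> \<bar>a\<bar> * \<bar>f x\<bar> + \<bar>b\<bar> * \<bar>g x\<bar>"
    by (metis abs_mult abs_triangle_ineq)
  also have "\<dots> \<le> \<bar>a\<bar> * B + \<bar>b\<bar> * B'"
    using assms x by (intro add_mono mult_left_mono) (auto simp: holder_bd_def)
  finally show "\<bar>a * f x + b * g x\<bar> \<le> \<bar>a\<bar> * B + \<bar>b\<bar> * B'" .
  fix y assume y: "y \<in> simplex2"
  have "a * f x + b * g x - (a * f y + b * g y) = a * (f x - f y) + b * (g x - g y)"
    by (simp add: algebra_simps)
  then have "\<bar>a * f x + b * g x - (a * f y + b * g y)\<bar> \<le> \<bar>a\<bar> * \<bar>f x - f y\<bar> + \<bar>b\<bar> * \<bar>g x - g y\<bar>"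
    by (metis abs_mult abs_triangle_ineq)
  also have "\<dots> \<le> \<bar>a\<bar> * (C * dist x y powr \<alpha>) + \<bar>b\<bar> * (C' * dist x y powr \<alpha>)"
    using assms x y by (intro add_mono mult_left_mono) (auto simp: holder_bd_def)
  finally show "\<bar>a * f x + b * g x - (a * f y + b * g y)\<bar> \<le> (\<bar>a\<bar> * C + \<bar>b\<bar> * C') * dist x y powr \<alpha>"
    by (simp add: algebra_simps)
qed

lemma HB_diff:
  assumes "HB B C f" "HB B' C' g" shows "HB (B + B') (C + C') (\<lambda>x. f x - g x)"
  using HB_lin[OF assms, of 1 "-1"] by simp

lemma HB_mult:
  assumes "HB B C f" "HB B' C' g"
  shows "HB (B * B') (B * C' + C * B') (\<lambda>x. f x * g x)"
  unfolding holder_bd_def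
proof (intro conjI ballI)
  have nn: "0 \<le> B" "0 \<le> B'" "0 \<le> C" using assms holder_bd_nonneg holder_bd_const_nonneg by blast+
  fix x assume x: "x \<in> simplex2"
  show "\<bar>f x * g x\<bar> \<le> B * B'"
    unfolding abs_mult using assms x nn by (intro mult_mono) (auto simp: holder_bd_def)
  fix y assume y: "y \<in> simplex2"
  have "f x * g x - f y * g y = f x * (g x - g y) + (f x - f y) * g y"
    by (simp add: algebra_simps)
  then have "\<bar>f x * g x - f y * g y\<bar> \<le> \<bar>f x\<bar> * \<bar>g x - g y\<bar> + \<bar>f x - f y\<bar> * \<bar>g y\<bar>"
    by (metis abs_mult abs_triangle_ineq)
  also have "\<dots> \<le> B * (C' * dist x y powr \<alpha>) + (C * dist x y powr \<alpha>) * B'"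
    using assms x y nn by (intro add_mono mult_mono) (auto simp: holder_bd_def)
  finally show "\<bar>f x * g x - f y * g y\<bar> \<le> (B * C' + C * B') * dist x y powr \<alpha>"
    by (simp add: algebra_simps)
qed

lemma HB_const: "HB \<bar>a\<bar> 0 (\<lambda>_. a)" by (simp add: holder_bd_def)

text \<open>The diameter of the triangle is at most 2, so \<open>dist x y \<le> 2 * dist x y powr \<alpha>\<close>.\<close>

lemma lipschitz_HB:
  assumes B: "\<And>x. x \<in> simplex2 \<Longrightarrow> \<bar>f x\<bar> \<le> B"
    and L: "\<And>x y. x \<in> simplex2 \<Longrightarrow> y \<in> simplex2 \<Longrightarrow> \<bar>f x - f y\<bar> \<le> L * dist x y" and L0: "0 \<le> L"
  shows "HB B (2 * L) f"
  unfolding holder_bd_def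
proof (intro conjI ballI B)
  fix x y assume x: "x \<in> simplex2" and y: "y \<in> simplex2"
  have "dist x y \<le> 2 * dist x y powr \<alpha>"
  proof (cases "x = y")
    case False
    have "dist x y = dist x y powr \<alpha> * dist x y powr (1 - \<alpha>)"
      using False by (simp flip: powr_add)
    also have "\<dots> \<le> dist x y powr \<alpha> * 2 powr (1 - \<alpha>)"
      using dist_simplex2_le[OF x y] alpha by (intro mult_left_mono powr_mono2) auto
    also have "\<dots> \<le> dist x y powr \<alpha> * 2 powr 1"
      using alpha by (intro mult_left_mono powr_mono) auto
    finally show ?thesis by simp
  qed simp
  then have "L * dist x y \<le> L * (2 * dist x y powr \<alpha>)" using L0 by (rule mult_left_mono)
  then show "\<bar>f x - f y\<bar> \<le> 2 * L * dist x y powr \<alpha>"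
    using L[OF x y] by simp
qed

lemma lim_val_lin:
  assumes K: "K \<in> minimal_absorbing p" and f: "HB B C f" and g: "HB B' C' g"
  shows "lim_val K (\<lambda>x. a * f x + b * g x) = a * lim_val K f + b * lim_val K g"
proof -
  obtain x where x: "x \<in> K" using minimal_absorbingD(4)[OF K] by auto
  have xs: "x \<in> simplex2" using x minimal_absorbingD(2)[OF K] by auto
  show ?thesis
  proof (rule lim_val_unique[OF K HB_lin[OF f g] x])
    show "(\<lambda>n. (P ^^ n) (\<lambda>y. a * f y + b * g y) x) \<longlonglongrightarrow> a * lim_val K f + b * lim_val K g"
      by (simp only: Pn_lin[OF HB_cont[OF f] HB_cont[OF g] xs])
         (intro tendsto_intros lim_val_tendsto[OF K f x] lim_val_tendsto[OF K g x])
  qed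
qed

lemma lim_val_diff:
  assumes "K \<in> minimal_absorbing p" "HB B C f" "HB B' C' g"
  shows "lim_val K (\<lambda>x. f x - g x) = lim_val K f - lim_val K g"
  using lim_val_lin[OF assms, of 1 "-1"] by simp

lemma lim_val_const_on:
  assumes K: "K \<in> minimal_absorbing p" and f: "HB B C f" and c: "\<And>x. x \<in> K \<Longrightarrow> f x = a"
  shows "lim_val K f = a"
proof -
  obtain x where x: "x \<in> K" using minimal_absorbingD(4)[OF K] by auto
  have "(P ^^ n) f x = a" for n
    using Pn_cong[OF minimal_absorbingD(1)[OF K] HB_cont[OF f] continuous_on_const c x, of n]
      Pn_const[of x n a] minimal_absorbingD(2)[OF K] x by auto
  then show ?thesis by (intro lim_val_unique[OF K f x]) simp
qed

lemma lim_val_bound: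
  assumes K: "K \<in> minimal_absorbing p" and f: "HB B C f" and c: "\<And>x. x \<in> K \<Longrightarrow> \<bar>f x\<bar> \<le> a"
  shows "\<bar>lim_val K f\<bar> \<le> a"
proof -
  obtain x where x: "x \<in> K" using minimal_absorbingD(4)[OF K] by auto
  show ?thesis
    by (rule LIMSEQ_le_const2[OF tendsto_rabs[OF lim_val_tendsto[OF K f x]]])
       (use Pn_bound[OF minimal_absorbingD(1)[OF K] HB_cont[OF f] c x] in auto)
qed

lemma lim_val_Pn:
  assumes K: "K \<in> minimal_absorbing p" and f: "HB B C f"
  shows "lim_val K ((P ^^ m) f) = lim_val K f"
proof -
  obtain x where x: "x \<in> K" using minimal_absorbingD(4)[OF K] by auto
  obtain C' where C': "\<And>n. HB B C' ((P ^^ n) f)" using Pn_HB[OF f] by metis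
  show ?thesis
    by (rule lim_val_unique[OF K C' x])
       (use LIMSEQ_ignore_initial_segment[OF lim_val_tendsto[OF K f x], of m] in \<open>simp add: Pn_add\<close>)
qed

text \<open>Among Hoelder functions, the null functions are a complement of the span of the functions \<open>hit K\<close>
  introduced below; \<open>P\<close> maps this complement into itself, and a power of \<open>P\<close> contracts it.\<close>

definition null_fun :: "(point \<Rightarrow> real) \<Rightarrow> bool" where
  "null_fun f \<longleftrightarrow> (\<forall>K\<in>minimal_absorbing p. lim_val K f = 0)"

text \<open>Being null means that the iterates vanish asymptotically on all minimal absorbing sets.\<close>

lemma null_fun_vanishing:
  assumes f: "HB B C f" and "null_fun f"
  shows "\<forall>e>0. \<exists>N. \<forall>n\<ge>N. \<forall>x\<in>simplex2. \<bar>(P ^^ n) f x\<bar> < e"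
  by (rule vanishing_on_minimal[OF f])
     (use lim_val_tendsto[OF _ f] assms(2) in \<open>auto simp: null_fun_def\<close>)

text \<open>The convergence is uniform over the unit ball of the Hoelder norm, because this ball is
  compact for uniform convergence and \<open>P\<close> does not increase the sup norm: a sequence of counterexamples
  would accumulate at a null function whose iterates do not vanish asymptotically.\<close>

lemma null_fun_vanishing_uniform:
  assumes e: "e > 0"
  shows "\<exists>N. \<forall>n\<ge>N. \<forall>f. HB 1 1 f \<and> null_fun f \<longrightarrow> (\<forall>x\<in>simplex2. \<bar>(P ^^ n) f x\<bar> < e)"
proof (rule ccontr)
  assume "\<not> ?thesis"
  then have "\<forall>N. \<exists>n f x. n \<ge> N \<and> HB 1 1 f \<and> null_fun f \<and> x \<in> simplex2 \<and> \<not> \<bar>(P ^^ n) f x\<bar> < e" by meson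
  then obtain n F X where F: "\<And>N. n N \<ge> N" "\<And>N. HB 1 1 (F N)" "\<And>N. null_fun (F N)"
    "\<And>N. X N \<in> simplex2" "\<And>N. \<not> \<bar>(P ^^ n N) (F N) (X N)\<bar> < e" by metis
  obtain g k where g: "HB 1 1 g" "strict_mono (k :: nat \<Rightarrow> nat)"
    "\<forall>e>0. \<exists>N. \<forall>n\<ge>N. \<forall>x\<in>simplex2. \<bar>F (k n) x - g x\<bar> < e"
    using HB_compact[of 1 1 F, OF F(2)] .
  have "null_fun g"
    unfolding null_fun_def
  proof
    fix K assume K: "K \<in> minimal_absorbing p"
    have "\<bar>lim_val K g\<bar> \<le> d" if d: "d > 0" for d
    proof -
      obtain N where N: "\<forall>n\<ge>N. \<forall>x\<in>simplex2. \<bar>F (k n) x - g x\<bar> < d" using g(3) d by blast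
      have "\<bar>lim_val K (\<lambda>x. F (k N) x - g x)\<bar> \<le> d"
        by (rule lim_val_bound[OF K HB_diff[OF F(2) g(1)]])
           (use N minimal_absorbingD(2)[OF K] in \<open>auto intro: less_imp_le\<close>)
      then show ?thesis
        using F(3)[of "k N"] K by (simp add: lim_val_diff[OF K F(2) g(1)] null_fun_def)
    qed
    then show "lim_val K g = 0" by (metis abs_le_zero_iff dense_ge)
  qed
  then obtain N1 where N1: "\<forall>n\<ge>N1. \<forall>x\<in>simplex2. \<bar>(P ^^ n) g x\<bar> < e / 2"
    using null_fun_vanishing[OF g(1)] half_gt_zero[OF e] by blast
  obtain N2 where N2: "\<forall>n\<ge>N2. \<forall>x\<in>simplex2. \<bar>F (k n) x - g x\<bar> < e / 2"
    using g(3) half_gt_zero[OF e] by blast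
  define j where "j = k (max N1 N2)"
  have j: "n j \<ge> N1" using F(1)[of j] seq_suble[OF g(2), of "max N1 N2"] by (simp add: j_def)
  have "\<bar>(P ^^ n j) (\<lambda>x. F j x - g x) (X j)\<bar> \<le> e / 2"
    by (rule Pn_bound[OF absorbing_simplex2 _ _ F(4)])
       (use N2 in \<open>auto simp: j_def less_imp_le intro!: continuous_intros HB_cont[OF F(2)] HB_cont[OF g(1)]\<close>)
  then have "\<bar>(P ^^ n j) (F j) (X j) - (P ^^ n j) g (X j)\<bar> \<le> e / 2"
    by (simp add: Pn_diff HB_cont[OF F(2)] HB_cont[OF g(1)] F(4))
  moreover have "\<bar>(P ^^ n j) g (X j)\<bar> < e / 2" using N1 j F(4) by blast
  ultimately have "\<bar>(P ^^ n j) (F j) (X j)\<bar> < e" by linarith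
  then show False using F(5) by blast
qed

lemma HB_scale: "HB B C f \<Longrightarrow> 0 \<le> a \<Longrightarrow> HB (a * B) (a * C) (\<lambda>x. a * f x)"
  using HB_lin[of B C f B C f a 0] by simp

lemma null_fun_scale: "HB B C f \<Longrightarrow> null_fun f \<Longrightarrow> null_fun (\<lambda>x. a * f x)"
  using lim_val_lin[of _ B C f B C f a 0] by (simp add: null_fun_def)

lemma null_fun_Pn: "HB B C f \<Longrightarrow> null_fun f \<Longrightarrow> null_fun ((P ^^ n) f)"
  by (simp add: null_fun_def lim_val_Pn)

text \<open>After the time \<open>Suc N\<close> the sup norm of a null function is at most \<open>e\<close> times its Hoelder norm \<open>a\<close>,
  and the Hoelder constant is at most \<open>(1 + D) * a\<close>. During \<open>m\<close> further steps the Doeblin--Fortet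
  inequality multiplies the latter by \<open>r ^ m < e\<close> and adds \<open>D * (e * a)\<close>.\<close>

lemma null_fun_contraction:
  obtains n0 where "0 < n0"
    "\<forall>B C f. HB B C f \<and> null_fun f \<longrightarrow>
       (\<exists>B' C'. HB B' C' ((P ^^ n0) f) \<and> B' + C' \<le> (B + C) / 2)"
proof -
  obtain r D where rD: "0 \<le> r" "r < 1" "D \<ge> 0"
    "\<forall>B C f n. HB B C f \<longrightarrow> HB B (r ^ n * C + D * B) ((P ^^ n) f)" by (rule doeblin_fortet)
  \<comment> \<open>the total bound will be \<open>2 * (1 + D) * e * a\<close>, which is \<open>a / 2\<close>\<close>
  define e where "e = 1 / (4 * (1 + D))"
  have e: "e > 0" "(1 + D) * e = 1 / 4" using rD(3) by (auto simp: e_def field_simps)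
  obtain N where N: "\<forall>n\<ge>N. \<forall>f. HB 1 1 f \<and> null_fun f \<longrightarrow> (\<forall>x\<in>simplex2. \<bar>(P ^^ n) f x\<bar> < e)"
    using null_fun_vanishing_uniform[OF e(1)] by blast
  have "\<exists>m. r ^ m < e" using rD(2) e(1) by (rule real_arch_pow_inv[rotated])
  then obtain m where m: "r ^ m < e" by blast
  show thesis
  proof (rule that[of "Suc (m + N)"], simp, intro allI impI)
    fix B C f assume f: "HB B C f \<and> null_fun f"
    define a where "a = B + C"
    have BC: "0 \<le> B" "0 \<le> C" using f holder_bd_nonneg holder_bd_const_nonneg by blast+
    show "\<exists>B' C'. HB B' C' ((P ^^ Suc (m + N)) f) \<and> B' + C' \<le> (B + C) / 2"
    proof (cases "a = 0")
      case True
      then have BC0: "B = 0" "C = 0" using BC by (auto simp: a_def)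
      obtain C' where C': "\<And>n. HB B C' ((P ^^ n) f)" using Pn_HB f by metis
      have "HB 0 0 ((P ^^ Suc (m + N)) f)"
        using C'[of "Suc (m + N)"] unfolding BC0 holder_bd_def by (auto simp del: funpow.simps)
      then show ?thesis unfolding BC0 by (intro exI[of _ 0] conjI) (simp_all del: funpow.simps)
    next
      case False
      then have a: "a > 0" using BC by (simp add: a_def)
      have "HB ((1 / a) * B) ((1 / a) * C) (\<lambda>x. (1 / a) * f x)"
        using f a by (intro HB_scale) auto
      then have h1: "HB 1 1 (\<lambda>x. (1 / a) * f x)"
        by (rule holder_bd_mono) (use a BC in \<open>auto simp: a_def\<close>)
      have n1: "null_fun (\<lambda>x. (1 / a) * f x)" using null_fun_scale f by blast
      have cf: "continuous_on simplex2 f" using f HB_cont by blast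
      have small: "\<bar>(P ^^ Suc N) f x\<bar> \<le> e * a" if x: "x \<in> simplex2" for x
      proof -
        have "(P ^^ Suc N) (\<lambda>x. (1 / a) * f x) x = (1 / a) * (P ^^ Suc N) f x"
          using Pn_lin[OF cf cf x, of "Suc N" "1/a" 0] by (simp del: funpow.simps)
        moreover have "\<bar>(P ^^ Suc N) (\<lambda>x. (1 / a) * f x) x\<bar> < e"
          using N h1 n1 x le_Suc_eq by blast
        ultimately have "\<bar>(1 / a) * (P ^^ Suc N) f x\<bar> < e" by metis
        then have "\<bar>(P ^^ Suc N) f x\<bar> / a < e" using a unfolding abs_mult by simp
        then show ?thesis using a by (simp only: pos_divide_less_eq less_imp_le)
      qed
      have pw: "r ^ n \<le> 1" for n using rD by (simp add: power_le_one)
      have h2: "HB B (r ^ Suc N * C + D * B) ((P ^^ Suc N) f)" using rD(4) f by blast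
      have le: "r ^ Suc N * C + D * B \<le> (1 + D) * a"
      proof -
        have "r ^ Suc N * C \<le> 1 * C" by (rule mult_right_mono[OF pw BC(2)])
        moreover have "0 \<le> D * C" using rD(3) BC by simp
        ultimately show ?thesis using BC by (simp add: a_def algebra_simps)
      qed
      have "HB B ((1 + D) * a) ((P ^^ Suc N) f)" by (rule holder_bd_mono[OF h2 order_refl le])
      then have "HB (e * a) ((1 + D) * a) ((P ^^ Suc N) f)"
        using small unfolding holder_bd_def by blast
      then have "HB (e * a) (r ^ m * ((1 + D) * a) + D * (e * a)) ((P ^^ m) ((P ^^ Suc N) f))"
        using rD(4) by blast
      moreover have "(P ^^ m) ((P ^^ Suc N) f) = (P ^^ Suc (m + N)) f"
        unfolding Pn_add[symmetric] by simp
      moreover have "e * a + (r ^ m * ((1 + D) * a) + D * (e * a)) \<le> (B + C) / 2"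
      proof -
        have "r ^ m * ((1 + D) * a) \<le> e * ((1 + D) * a)"
          using m a rD(3) by (intro mult_right_mono) auto
        then have "e * a + (r ^ m * ((1 + D) * a) + D * (e * a)) \<le> 2 * ((1 + D) * e) * a"
          by (simp add: algebra_simps)
        then show ?thesis using e(2) by (simp add: a_def)
      qed
      ultimately show ?thesis by metis
    qed
  qed
qed

text \<open>The halving is iterated along the multiples of \<open>n0\<close>; for the remaining times it is enough that \<open>P\<close>
  does not increase the sup norm.\<close>

lemma null_fun_rate:
  obtains \<kappa> \<rho> where "\<kappa> > 0" "0 \<le> \<rho>" "\<rho> < 1"
    "\<forall>B C f n. HB B C f \<and> null_fun f \<longrightarrow> (\<forall>x\<in>simplex2. \<bar>(P ^^ n) f x\<bar> \<le> \<kappa> * \<rho> ^ n * (B + C))"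
proof -
  obtain n0 where n0: "0 < n0"
    "\<forall>B C f. HB B C f \<and> null_fun f \<longrightarrow>
       (\<exists>B' C'. HB B' C' ((P ^^ n0) f) \<and> B' + C' \<le> (B + C) / 2)" by (rule null_fun_contraction)
  have it: "\<exists>B' C'. HB B' C' ((P ^^ (n0 * q)) f) \<and> B' + C' \<le> (B + C) / 2 ^ q"
    if f: "HB B C f" "null_fun f" for B C f q
  proof (induction q)
    case 0
    show ?case using f by auto
  next
    case (Suc q)
    then obtain B' C' where 1: "HB B' C' ((P ^^ (n0 * q)) f)" "B' + C' \<le> (B + C) / 2 ^ q" by blast
    moreover have "null_fun ((P ^^ (n0 * q)) f)" using null_fun_Pn f by blast
    ultimately obtain B'' C'' where 2: "HB B'' C'' ((P ^^ n0) ((P ^^ (n0 * q)) f))"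
      "B'' + C'' \<le> (B' + C') / 2" using n0(2) by blast
    have "HB B'' C'' ((P ^^ (n0 * Suc q)) f)" using 2(1) unfolding Pn_add[symmetric] by simp
    moreover have "B'' + C'' \<le> (B + C) / 2 ^ Suc q" using 1(2) 2(2) by simp
    ultimately show ?case by blast
  qed
  \<comment> \<open>the factor 1/2 in \<open>n0\<close> steps, spread evenly over the single steps\<close>
  define \<rho> where "\<rho> = root n0 (1 / 2)"
  have \<rho>: "0 \<le> \<rho>" "\<rho> < 1" "\<rho> ^ n0 = 1 / 2"
    using n0(1) by (auto simp: \<rho>_def real_root_pow_pos2)
  show thesis
  proof (rule that[of 2 \<rho>], simp, rule \<rho>, rule \<rho>, intro allI impI ballI)
    fix B C f n x assume f: "HB B C f \<and> null_fun f" and x: "x \<in> simplex2"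
    define q where "q = n div n0"
    obtain B' C' where 1: "HB B' C' ((P ^^ (n0 * q)) f)" "B' + C' \<le> (B + C) / 2 ^ q"
      using it f by blast
    have BC: "0 \<le> B + C" using f holder_bd_nonneg holder_bd_const_nonneg by (meson add_nonneg_nonneg)
    have "0 \<le> C'" using holder_bd_const_nonneg[OF 1(1)] .
    have "(P ^^ n) f x = (P ^^ (n mod n0)) ((P ^^ (n0 * q)) f) x"
      unfolding Pn_add[symmetric] q_def by simp
    moreover have "\<bar>(P ^^ (n mod n0)) ((P ^^ (n0 * q)) f) x\<bar> \<le> B'"
      by (rule Pn_bound[OF absorbing_simplex2 HB_cont[OF 1(1)] _ x]) (use 1(1) in \<open>auto simp: holder_bd_def\<close>)
    moreover have "1 / 2 ^ q \<le> 2 * \<rho> ^ n"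
    proof -
      have "n \<le> n0 * Suc q"
        using n0(1) mult_div_mod_eq[of n0 n] mod_less_divisor[of n0 n] unfolding q_def mult_Suc_right by linarith
      then have "\<rho> ^ (n0 * Suc q) \<le> \<rho> ^ n" using \<rho> by (intro power_decreasing) auto
      moreover have "\<rho> ^ (n0 * Suc q) = (1 / 2) ^ Suc q" by (simp only: power_mult \<rho>(3))
      ultimately show ?thesis by (simp add: power_one_over)
    qed
    then have "(1 / 2 ^ q) * (B + C) \<le> 2 * \<rho> ^ n * (B + C)" using BC by (rule mult_right_mono)
    ultimately show "\<bar>(P ^^ n) f x\<bar> \<le> 2 * \<rho> ^ n * (B + C)"
      using 1(2) \<open>0 \<le> C'\<close> by simp
  qed
qed

definition orbit_lim :: "(point \<Rightarrow> real) \<Rightarrow> point \<Rightarrow> real" where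
  "orbit_lim f x = lim (\<lambda>n. (P ^^ n) f x)"

text \<open>The differences \<open>(P ^^ j) f - f\<close> are null functions, as \<open>lim_val K\<close> is invariant under \<open>P\<close>, and
  their Hoelder norms are bounded independently of \<open>j\<close>; so the orbit of every Hoelder function is Cauchy
  at a geometric rate.\<close>

lemma orbit_lim_rate:
  obtains \<kappa> \<rho> where "\<kappa> > 0" "0 \<le> \<rho>" "\<rho> < 1"
    "\<forall>B C f n. HB B C f \<longrightarrow>
       (\<forall>x\<in>simplex2. \<bar>(P ^^ n) f x - orbit_lim f x\<bar> \<le> \<kappa> * \<rho> ^ n * (B + C))"
proof -
  obtain \<kappa> \<rho> where k: "\<kappa> > 0" "0 \<le> \<rho>" "\<rho> < 1"
    "\<forall>B C f n. HB B C f \<and> null_fun f \<longrightarrow> (\<forall>x\<in>simplex2. \<bar>(P ^^ n) f x\<bar> \<le> \<kappa> * \<rho> ^ n * (B + C))"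
    by (rule null_fun_rate)
  obtain r D where rD: "0 \<le> r" "r < 1" "D \<ge> 0"
    "\<forall>B C f n. HB B C f \<longrightarrow> HB B (r ^ n * C + D * B) ((P ^^ n) f)" by (rule doeblin_fortet)
  show thesis
  proof (rule that[of "\<kappa> * (2 + D)" \<rho>], goal_cases)
    case 4
    show ?case
    proof (intro allI impI ballI)
      fix B C f n x assume f: "HB B C f" and x: "x \<in> simplex2"
      have cf: "continuous_on simplex2 f" using HB_cont[OF f] .
      have BC: "0 \<le> B" "0 \<le> C" using f holder_bd_nonneg holder_bd_const_nonneg by blast+
      have diff: "\<bar>(P ^^ (n + j)) f x - (P ^^ n) f x\<bar> \<le> \<kappa> * (2 + D) * \<rho> ^ n * (B + C)" for n j
      proof -
        have f': "HB B (C + D * B) ((P ^^ j) f)"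
        proof (rule holder_bd_mono[OF rD(4)[rule_format, OF f, of j]])
          have "r ^ j * C \<le> 1 * C" using rD BC by (intro mult_right_mono power_le_one) auto
          then show "r ^ j * C + D * B \<le> C + D * B" by simp
        qed simp
        have h: "HB (B + B) ((C + D * B) + C) (\<lambda>y. (P ^^ j) f y - f y)" by (rule HB_diff[OF f' f])
        have nf: "null_fun (\<lambda>y. (P ^^ j) f y - f y)"
          unfolding null_fun_def using lim_val_diff[OF _ f' f] lim_val_Pn[OF _ f] by simp
        have "(P ^^ n) (\<lambda>y. (P ^^ j) f y - f y) x = (P ^^ (n + j)) f x - (P ^^ n) f x"
          unfolding Pn_add by (rule Pn_diff[OF Pn_cont[OF cf] cf x])
        then have "\<bar>(P ^^ (n + j)) f x - (P ^^ n) f x\<bar> \<le> \<kappa> * \<rho> ^ n * (B + B + (C + D * B + C))"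
          using k(4)[rule_format, OF conjI[OF h nf] x, of n] by simp
        also have "\<dots> \<le> \<kappa> * \<rho> ^ n * ((2 + D) * (B + C))"
          using k(1,2) BC rD(3) by (intro mult_left_mono) (auto simp: algebra_simps)
        finally show ?thesis by (simp add: mult_ac)
      qed
      have "Cauchy (\<lambda>n. (P ^^ n) f x)"
      proof (rule metric_CauchyI)
        fix e :: real assume e: "e > 0"
        have "(\<lambda>n. 2 * (\<kappa> * (2 + D) * \<rho> ^ n * (B + C))) \<longlonglongrightarrow> 2 * (\<kappa> * (2 + D) * 0 * (B + C))"
          using k by (intro tendsto_intros LIMSEQ_power_zero) auto
        then have "\<forall>\<^sub>F n in sequentially. 2 * (\<kappa> * (2 + D) * \<rho> ^ n * (B + C)) < e"
          using e by (intro order_tendstoD(2)) auto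
        then obtain M where M: "2 * (\<kappa> * (2 + D) * \<rho> ^ M * (B + C)) < e"
          unfolding eventually_sequentially by blast
        have near: "\<bar>(P ^^ n) f x - (P ^^ M) f x\<bar> < e / 2" if "n \<ge> M" for n
          using diff[of M "n - M"] that M by simp
        show "\<exists>M. \<forall>m\<ge>M. \<forall>n\<ge>M. dist ((P ^^ m) f x) ((P ^^ n) f x) < e"
        proof (intro exI allI impI)
          fix m n assume "m \<ge> M" "n \<ge> M"
          from near[OF this(1)] near[OF this(2)]
          show "dist ((P ^^ m) f x) ((P ^^ n) f x) < e" unfolding dist_real_def by linarith
        qed
      qed
      then have "(\<lambda>n. (P ^^ n) f x) \<longlonglongrightarrow> orbit_lim f x"
        unfolding orbit_lim_def by (simp add: Cauchy_convergent_iff convergent_LIMSEQ_iff)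
      then have "(\<lambda>j. (P ^^ (n + j)) f x) \<longlonglongrightarrow> orbit_lim f x"
        using LIMSEQ_ignore_initial_segment[of _ _ n] by (simp add: add.commute)
      then have "(\<lambda>j. \<bar>(P ^^ (n + j)) f x - (P ^^ n) f x\<bar>) \<longlonglongrightarrow> \<bar>orbit_lim f x - (P ^^ n) f x\<bar>"
        by (intro tendsto_intros)
      then have "\<bar>orbit_lim f x - (P ^^ n) f x\<bar> \<le> \<kappa> * (2 + D) * \<rho> ^ n * (B + C)"
        by (rule LIMSEQ_le_const2) (use diff in blast)
      then show "\<bar>(P ^^ n) f x - orbit_lim f x\<bar> \<le> \<kappa> * (2 + D) * \<rho> ^ n * (B + C)"
        by (simp add: abs_minus_commute)
    qed
  qed (use k rD in auto)
qed

lemma orbit_lim_uniform: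
  assumes f: "HB B C f" and e: "e > 0"
  shows "\<exists>N. \<forall>n\<ge>N. \<forall>x\<in>simplex2. \<bar>(P ^^ n) f x - orbit_lim f x\<bar> < e"
proof -
  obtain \<kappa> \<rho> where k: "\<kappa> > 0" "0 \<le> \<rho>" "\<rho> < 1"
    "\<forall>B C f n. HB B C f \<longrightarrow>
       (\<forall>x\<in>simplex2. \<bar>(P ^^ n) f x - orbit_lim f x\<bar> \<le> \<kappa> * \<rho> ^ n * (B + C))"
    by (rule orbit_lim_rate)
  have "(\<lambda>n. \<kappa> * \<rho> ^ n * (B + C)) \<longlonglongrightarrow> \<kappa> * 0 * (B + C)"
    using k by (intro tendsto_intros LIMSEQ_power_zero) auto
  then have "\<forall>\<^sub>F n in sequentially. \<kappa> * \<rho> ^ n * (B + C) < e"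
    using e by (intro order_tendstoD(2)) auto
  then obtain N where "\<forall>n\<ge>N. \<kappa> * \<rho> ^ n * (B + C) < e" unfolding eventually_sequentially by blast
  then show ?thesis using k(4) f by (meson le_less_trans)
qed

lemma orbit_lim_tendsto:
  assumes f: "HB B C f" and x: "x \<in> simplex2"
  shows "(\<lambda>n. (P ^^ n) f x) \<longlonglongrightarrow> orbit_lim f x"
  unfolding LIMSEQ_iff real_norm_def using orbit_lim_uniform[OF f] x by meson

lemma orbit_lim_HB:
  assumes f: "HB B C f" obtains C' where "HB B C' (orbit_lim f)"
proof -
  obtain C' where C': "\<And>n. HB B C' ((P ^^ n) f)" using Pn_HB[OF f] by metis
  have "HB B C' (orbit_lim f)"
    unfolding holder_bd_def
  proof (intro conjI ballI)
    fix x assume x: "x \<in> simplex2"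
    show "\<bar>orbit_lim f x\<bar> \<le> B"
      by (rule LIMSEQ_le_const2[OF tendsto_rabs[OF orbit_lim_tendsto[OF f x]]])
         (use C' x in \<open>auto simp: holder_bd_def\<close>)
    fix y assume y: "y \<in> simplex2"
    show "\<bar>orbit_lim f x - orbit_lim f y\<bar> \<le> C' * dist x y powr \<alpha>"
      by (rule LIMSEQ_le_const2[OF tendsto_rabs[OF tendsto_diff[OF
            orbit_lim_tendsto[OF f x] orbit_lim_tendsto[OF f y]]]])
         (use C' x y in \<open>auto simp: holder_bd_def\<close>)
  qed
  then show thesis using that by blast
qed

lemma orbit_lim_harmonic:
  assumes f: "HB B C f" and x: "x \<in> simplex2"
  shows "P (orbit_lim f) x = orbit_lim f x"
proof -
  obtain C' where C': "HB B C' (orbit_lim f)" using orbit_lim_HB[OF f] .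
  have c: "continuous_on simplex2 (orbit_lim f)" "continuous_on simplex2 f"
    using HB_cont[OF C'] HB_cont[OF f] .
  have "(\<lambda>n. (P ^^ Suc n) f x) \<longlonglongrightarrow> P (orbit_lim f) x"
    unfolding LIMSEQ_iff real_norm_def
  proof (intro allI impI)
    fix e :: real assume e: "e > 0"
    obtain N where N: "\<forall>n\<ge>N. \<forall>x\<in>simplex2. \<bar>(P ^^ n) f x - orbit_lim f x\<bar> < e / 2"
      using orbit_lim_uniform[OF f half_gt_zero[OF e]] by blast
    show "\<exists>N. \<forall>n\<ge>N. \<bar>(P ^^ Suc n) f x - P (orbit_lim f) x\<bar> < e"
    proof (intro exI allI impI)
      fix n assume n: "n \<ge> N"
      have "\<bar>(P ^^ 1) (\<lambda>y. (P ^^ n) f y - orbit_lim f y) x\<bar> \<le> e / 2"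
        by (rule Pn_bound[OF absorbing_simplex2 _ _ x])
           (use N n in \<open>auto simp: less_imp_le intro!: continuous_intros Pn_cont c\<close>)
      also have "(P ^^ 1) (\<lambda>y. (P ^^ n) f y - orbit_lim f y) x = (P ^^ Suc n) f x - P (orbit_lim f) x"
        using Pn_diff[OF Pn_cont[OF c(2), of n] c(1) x, of 1] by simp
      finally show "\<bar>(P ^^ Suc n) f x - P (orbit_lim f) x\<bar> < e" using e by linarith
    qed
  qed
  moreover have "(\<lambda>n. (P ^^ Suc n) f x) \<longlonglongrightarrow> orbit_lim f x"
    using LIMSEQ_Suc[OF orbit_lim_tendsto[OF f x]] .
  ultimately show ?thesis using LIMSEQ_unique by blast
qed

lemma orbit_lim_on_minimal:
  assumes "K \<in> minimal_absorbing p" "HB B C f" "x \<in> K"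
  shows "orbit_lim f x = lim_val K f"
  using lim_val_tendsto[OF assms] unfolding orbit_lim_def by (rule limI)

section \<open>Absorption probabilities\<close>

lemma separating_function:
  assumes K: "K \<in> minimal_absorbing p"
  obtains f C where "HB 1 C f" "\<forall>x\<in>simplex2. 0 \<le> f x"
    "\<forall>L\<in>minimal_absorbing p. \<forall>x\<in>L. f x = (if L = K then 1 else 0)"
proof -
  define U where "U = \<Union> (minimal_absorbing p - {K})"
  have "compact U"
    unfolding U_def using finite_minimal_absorbing minimal_absorbingD(3) by (intro compact_Union) auto
  moreover have "K \<inter> U = {}"
    unfolding U_def using minimal_absorbing_disjoint[OF K] by blast
  ultimately obtain d where d: "d > 0" "\<forall>x\<in>K. \<forall>y\<in>U. d \<le> dist x y"
    using separate_compact_closed[OF minimal_absorbingD(3)[OF K] compact_imp_closed] by blast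
  define f where "f x = max 0 (1 - infdist x K / d)" for x
  show thesis
  proof (rule that[of "2 * (1 / d)" f])
    show "HB 1 (2 * (1 / d)) f"
    proof (rule lipschitz_HB)
      fix x y :: point
      show "\<bar>f x\<bar> \<le> 1" using d infdist_nonneg[of x K] by (simp add: f_def)
      have "\<bar>f x - f y\<bar> \<le> \<bar>infdist x K / d - infdist y K / d\<bar>" unfolding f_def by linarith
      also have "\<dots> = \<bar>infdist x K - infdist y K\<bar> / d" using d by (simp flip: diff_divide_distrib)
      also have "\<dots> \<le> 1 / d * dist x y"
        using infdist_triangle_abs[of x K y] d by (simp add: divide_right_mono)
      finally show "\<bar>f x - f y\<bar> \<le> 1 / d * dist x y" .
    qed (use d in auto)
    show "\<forall>x\<in>simplex2. 0 \<le> f x" by (simp add: f_def)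
    show "\<forall>L\<in>minimal_absorbing p. \<forall>x\<in>L. f x = (if L = K then 1 else 0)"
    proof (intro ballI)
      fix L x assume L: "L \<in> minimal_absorbing p" and x: "x \<in> L"
      show "f x = (if L = K then 1 else 0)"
      proof (cases "L = K")
        case False
        then have "x \<in> U" using L x by (auto simp: U_def)
        then have "d \<le> infdist x K"
          using d minimal_absorbingD(4)[OF K] unfolding infdist_notempty[OF minimal_absorbingD(4)[OF K]]
          by (intro cINF_greatest) (auto simp: dist_commute)
        then show ?thesis using False d by (simp add: f_def)
      qed (use x in \<open>simp add: f_def\<close>)
    qed
  qed
qed

text \<open>The limit of the orbit of a function that separates \<open>K\<close> from the other minimal absorbing sets.
  By \<open>orbit_lim_eq\<close> this limit is the same for all separating functions; it will be identified in
  \<open>chain_absorption\<close> with the probability of being absorbed by \<open>K\<close>.\<close>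

definition hit :: "point set \<Rightarrow> point \<Rightarrow> real" where
  "hit K = orbit_lim (SOME f. \<exists>C. HB 1 C f \<and> (\<forall>x\<in>simplex2. 0 \<le> f x) \<and>
    (\<forall>L\<in>minimal_absorbing p. \<forall>x\<in>L. f x = (if L = K then 1 else 0)))"

lemma hit_separating:
  assumes K: "K \<in> minimal_absorbing p"
  obtains f C where "HB 1 C f" "\<forall>x\<in>simplex2. 0 \<le> f x"
    "\<forall>L\<in>minimal_absorbing p. \<forall>x\<in>L. f x = (if L = K then 1 else 0)" "hit K = orbit_lim f"
proof -
  let ?Q = "\<lambda>f. \<exists>C. HB 1 C f \<and> (\<forall>x\<in>simplex2. 0 \<le> f x) \<and>
    (\<forall>L\<in>minimal_absorbing p. \<forall>x\<in>L. f x = (if L = K then 1 else 0))"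
  have "\<exists>f. ?Q f" using separating_function[OF K] by metis
  then have "?Q (SOME f. ?Q f)" by (rule someI_ex)
  then show thesis using that unfolding hit_def by blast
qed

lemma hit_HB:
  assumes "K \<in> minimal_absorbing p" obtains C where "HB 1 C (hit K)"
  using hit_separating[OF assms] orbit_lim_HB by metis

lemma hit_harmonic: "K \<in> minimal_absorbing p \<Longrightarrow> x \<in> simplex2 \<Longrightarrow> P (hit K) x = hit K x"
  using hit_separating orbit_lim_harmonic by metis

lemma hit_nonneg:
  assumes K: "K \<in> minimal_absorbing p" and x: "x \<in> simplex2" shows "0 \<le> hit K x"
proof -
  obtain f C where f: "HB 1 C f" "\<forall>x\<in>simplex2. 0 \<le> f x" "hit K = orbit_lim f"
    using hit_separating[OF K] by metis
  have "0 \<le> (P ^^ n) f x" for n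
    using Pn_mono[OF absorbing_simplex2 continuous_on_const HB_cont[OF f(1)] _ x, of 0 n]
      Pn_const[OF x] f(2) by auto
  then show ?thesis
    unfolding f(3) using orbit_lim_tendsto[OF f(1) x] by (meson LIMSEQ_le_const)
qed

lemma hit_on_minimal:
  assumes K: "K \<in> minimal_absorbing p" and L: "L \<in> minimal_absorbing p" and x: "x \<in> L"
  shows "hit K x = (if L = K then 1 else 0)"
proof -
  obtain f C where f: "HB 1 C f" 
    "\<forall>L\<in>minimal_absorbing p. \<forall>x\<in>L. f x = (if L = K then 1 else 0)" "hit K = orbit_lim f"
    using hit_separating[OF K] by metis
  have "lim_val L f = (if L = K then 1 else 0)"
    by (rule lim_val_const_on[OF L f(1)]) (use f(2) L in blast)
  then show ?thesis using orbit_lim_on_minimal[OF L f(1) x] f(3) by simp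
qed

lemma lim_val_hit:
  assumes K: "K \<in> minimal_absorbing p" and L: "L \<in> minimal_absorbing p"
  shows "lim_val L (hit K) = (if L = K then 1 else 0)"
proof -
  obtain C where C: "HB 1 C (hit K)" using hit_HB[OF K] .
  show ?thesis by (rule lim_val_const_on[OF L C hit_on_minimal[OF K L]])
qed

lemma HB_sum:
  assumes "finite S" "\<And>s. s \<in> S \<Longrightarrow> \<exists>B C. HB B C (f s)"
  shows "\<exists>B C. HB B C (\<lambda>x. \<Sum>s\<in>S. a s * f s x)"
  using assms
proof (induction S rule: finite_induct)
  case empty
  then show ?case using HB_const[of 0] by auto
next
  case (insert s S)
  obtain B C where 1: "HB B C (\<lambda>x. \<Sum>s\<in>S. a s * f s x)" using insert by auto
  obtain B' C' where 2: "HB B' C' (f s)" using insert.prems[of s] by blast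
  from HB_lin[OF 2 1, of "a s" 1] insert(1,2) show ?case by auto
qed

lemma lim_val_sum:
  assumes K: "K \<in> minimal_absorbing p" and "finite S" "\<And>s. s \<in> S \<Longrightarrow> \<exists>B C. HB B C (f s)"
  shows "lim_val K (\<lambda>x. \<Sum>s\<in>S. a s * f s x) = (\<Sum>s\<in>S. a s * lim_val K (f s))"
  using assms(2,3)
proof (induction S rule: finite_induct)
  case empty
  show ?case using lim_val_const_on[OF K HB_const[of 0]] by simp
next
  case (insert s S)
  have IH: "lim_val K (\<lambda>x. \<Sum>s\<in>S. a s * f s x) = (\<Sum>s\<in>S. a s * lim_val K (f s))"
    using insert by blast
  obtain B C where 1: "HB B C (\<lambda>x. \<Sum>s\<in>S. a s * f s x)" using HB_sum[of S f a] insert by auto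
  obtain B' C' where 2: "HB B' C' (f s)" using insert.prems[of s] by blast
  from lim_val_lin[OF K 2 1, of "a s" 1] insert(1,2) IH show ?case by simp
qed

text \<open>The limit of the orbit is a combination of the functions \<open>hit K\<close>: subtracting this
  combination leaves a function whose iterates vanish asymptotically on all minimal absorbing sets,
  hence everywhere.\<close>

lemma orbit_lim_eq:
  assumes f: "HB B C f" and x: "x \<in> simplex2"
  shows "orbit_lim f x = (\<Sum>K\<in>minimal_absorbing p. lim_val K f * hit K x)"
proof -
  let ?s = "\<lambda>y. \<Sum>K\<in>minimal_absorbing p. lim_val K f * hit K y"
  note fin = finite_minimal_absorbing
  have ex: "\<exists>B C. HB B C (hit K)" if "K \<in> minimal_absorbing p" for K using hit_HB[OF that] by metis
  obtain B' C' where s: "HB B' C' ?s" 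
    using HB_sum[of "minimal_absorbing p" hit "\<lambda>K. lim_val K f"] fin ex by blast
  have Ps: "P ?s y = ?s y" if y: "y \<in> simplex2" for y
  proof -
    have "P (\<lambda>y. \<Sum>K\<in>S. lim_val K f * hit K y) y = (\<Sum>K\<in>S. lim_val K f * hit K y)"
      if "finite S" "S \<subseteq> minimal_absorbing p" for S
      using that
    proof (induction S rule: finite_induct)
      case empty
      show ?case using P_const[OF y, of 0] by simp
    next
      case (insert K S)
      obtain B1 C1 where 1: "HB B1 C1 (hit K)" using ex insert by blast
      obtain B2 C2 where 2: "HB B2 C2 (\<lambda>y. \<Sum>K\<in>S. lim_val K f * hit K y)"
        using HB_sum[OF insert(1), of hit "\<lambda>K. lim_val K f"] ex insert.prems by blast
      show ?case
        using P_lin[OF HB_cont[OF 1] HB_cont[OF 2] y, of "lim_val K f" 1] insert hit_harmonic[OF _ y]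
        by simp
    qed
    then show ?thesis using fin by blast
  qed
  have Pns: "(P ^^ n) ?s y = ?s y" if "y \<in> simplex2" for n y
    using that
  proof (induction n arbitrary: y)
    case (Suc n)
    have "P ((P ^^ n) ?s) y = P ?s y"
      by (rule P_cong[OF absorbing_simplex2 Pn_cont[OF HB_cont[OF s]] HB_cont[OF s] Suc.IH Suc.prems])
    then show ?case using Ps Suc.prems by simp
  qed simp
  have nf: "null_fun (\<lambda>y. f y - ?s y)"
    unfolding null_fun_def
  proof
    fix L assume L: "L \<in> minimal_absorbing p"
    have "lim_val L ?s = (\<Sum>K\<in>minimal_absorbing p. lim_val K f * lim_val L (hit K))"
      by (rule lim_val_sum[OF L fin ex])
    also have "\<dots> = (\<Sum>K\<in>minimal_absorbing p. if L = K then lim_val K f else 0)"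
      by (rule sum.cong) (simp_all add: lim_val_hit L)
    also have "\<dots> = lim_val L f" using fin L by simp
    finally show "lim_val L (\<lambda>y. f y - ?s y) = 0" using lim_val_diff[OF L f s] by simp
  qed
  have "(\<lambda>n. (P ^^ n) (\<lambda>y. f y - ?s y) x) \<longlonglongrightarrow> 0"
    unfolding LIMSEQ_iff real_norm_def diff_zero
    using null_fun_vanishing[OF HB_diff[OF f s] nf] x by blast
  then have "(\<lambda>n. (P ^^ n) f x - ?s x) \<longlonglongrightarrow> 0"
    by (simp only: Pn_diff[OF HB_cont[OF f] HB_cont[OF s] x] Pns[OF x])
  then have "(\<lambda>n. (P ^^ n) f x) \<longlonglongrightarrow> ?s x" by (simp add: LIM_zero_cancel)
  then show ?thesis unfolding orbit_lim_def by (rule limI)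
qed

lemma hit_sum:
  assumes x: "x \<in> simplex2" shows "(\<Sum>K\<in>minimal_absorbing p. hit K x) = 1"
proof -
  have "orbit_lim (\<lambda>_. 1) x = 1" unfolding orbit_lim_def by (rule limI) (simp add: Pn_const[OF x])
  moreover have "lim_val K (\<lambda>_. 1) = 1" if "K \<in> minimal_absorbing p" for K
    using lim_val_const_on[OF that HB_const[of 1]] by simp
  ultimately show ?thesis using orbit_lim_eq[OF HB_const[of 1] x] by simp
qed

lemma hit_le_1:
  assumes K: "K \<in> minimal_absorbing p" and x: "x \<in> simplex2" shows "hit K x \<le> 1"
  using member_le_sum[OF K, of "\<lambda>K. hit K x"] hit_nonneg[OF _ x] finite_minimal_absorbing hit_sum[OF x]
  by fastforce

end

section \<open>A space-filling curve\<close>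

text \<open>An even function of period 2 that is 0 on \<open>[0, 1 / 3]\<close> and 1 on \<open>[2 / 3, 1]\<close>: truncating a cosine
  yields the plateaus without distinguishing cases.\<close>

definition wave :: "real \<Rightarrow> real" where
  "wave t = max 0 (min 1 (1 / 2 - cos (pi * t)))"

lemma wave_range: "0 \<le> wave t" "wave t \<le> 1"
  by (auto simp: wave_def)

text \<open>In \<open>2 * a / 3 + s\<close> the first ternary digit after the point is \<open>2 * a\<close>, and \<open>wave\<close> reads it off,
  whatever the later digits \<open>s\<close> and an even integer part are.\<close>

lemma wave_digit:
  assumes a: "a \<in> {0, 1::real}" and s: "0 \<le> s" "s \<le> 1 / 3"
  shows "wave (2 * of_int m + (2 * a / 3 + s)) = a"
proof -
  have per: "cos (pi * (2 * of_int m + u)) = cos (pi * u)" for u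
    using cos_int_2pin[of m] sin_int_2pin[of m]
    by (simp add: distrib_left cos_add mult_ac)
  have low: "1 / 2 \<le> cos (pi * s)" if "0 \<le> s" "s \<le> 1 / 3" for s
  proof -
    have "cos (pi / 3) \<le> cos (pi * s)"
      using that by (intro cos_monotone_0_pi_le) (auto simp: field_simps)
    then show ?thesis by (simp add: cos_60)
  qed
  show ?thesis
  proof (cases "a = 0")
    case True
    then show ?thesis using low[OF s] unfolding wave_def per by simp
  next
    case False
    then have a1: "a = 1" using a by simp
    have "cos (pi * (2 / 3 + s)) = - cos (pi * (1 / 3 - s))"
    proof -
      have "pi * (2 / 3 + s) = pi - pi * (1 / 3 - s)" by (simp add: field_simps)
      then show ?thesis by (simp only: cos_pi_minus)
    qed
    moreover have "1 / 2 \<le> cos (pi * (1 / 3 - s))" using s by (intro low) auto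
    ultimately show ?thesis unfolding wave_def per a1 by simp
  qed
qed

definition wave_series :: "real \<Rightarrow> real" where
  "wave_series t = (\<Sum>k. wave (9 ^ k * t) / 2 ^ Suc k)"

lemma continuous_wave_series: "continuous_on UNIV wave_series"
proof -
  have "uniform_limit UNIV (\<lambda>n t. \<Sum>k<n. wave (9 ^ k * t) / 2 ^ Suc k)
      (\<lambda>t. suminf (\<lambda>k. wave (9 ^ k * t) / 2 ^ Suc k)) sequentially"
  proof (rule Weierstrass_m_test)
    fix n :: nat and t :: real
    show "norm (wave (9 ^ n * t) / 2 ^ Suc n) \<le> (1 / 2) ^ Suc n"
      using wave_range[of "9 ^ n * t"] by (simp add: power_divide divide_right_mono)
    show "summable (\<lambda>n. (1 / 2 :: real) ^ Suc n)" by (subst summable_Suc_iff) (simp add: summable_geometric)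
  qed
  then show ?thesis
    unfolding wave_series_def[abs_def]
    by (rule uniform_limit_theorem[rotated])
       (auto simp: wave_def intro!: always_eventually continuous_intros)
qed

text \<open>The point of the Cantor set with ternary digits \<open>2 * a j\<close>.\<close>

definition cantor_sum :: "(nat \<Rightarrow> real) \<Rightarrow> real" where
  "cantor_sum a = (\<Sum>j. 2 * a j / 3 ^ Suc j)"

lemma cantor_sum_summable:
  assumes "\<And>j. a j \<in> {0, 1::real}"
  shows "summable (\<lambda>j. 2 * a j / 3 ^ Suc j)"
proof (rule summable_comparison_test'[where g = "\<lambda>j. (1 / 3 :: real) ^ j" and N = 0])
  fix j
  have "\<bar>a j\<bar> \<le> 1" using assms[of j] by auto
  then show "norm (2 * a j / 3 ^ Suc j) \<le> (1 / 3) ^ j"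
    by (simp add: power_divide abs_mult field_simps)
qed (simp add: summable_geometric)

lemma cantor_sum_range:
  assumes a: "\<And>j. a j \<in> {0, 1::real}"
  shows "0 \<le> cantor_sum a" "cantor_sum a \<le> 1"
proof -
  have ge: "0 \<le> a j" and le: "a j \<le> 1" for j using a[of j] by auto
  show "0 \<le> cantor_sum a"
    unfolding cantor_sum_def by (rule suminf_nonneg[OF cantor_sum_summable[OF a]]) (simp add: ge)
  have s: "(\<lambda>j. (2 / 3) * (1 / 3) ^ j) sums ((2 / 3) * (1 / (1 - 1 / 3 :: real)))"
    by (intro sums_mult geometric_sums) simp
  have "cantor_sum a \<le> (\<Sum>j. (2 / 3) * (1 / 3) ^ j)"
    unfolding cantor_sum_def
  proof (rule suminf_le[OF _ cantor_sum_summable[OF a] sums_summable[OF s]])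
    fix j show "2 * a j / 3 ^ Suc j \<le> 2 / 3 * (1 / 3) ^ j"
      using le[of j] by (simp add: power_divide divide_right_mono)
  qed
  then show "cantor_sum a \<le> 1" using sums_unique[OF s] by simp
qed

lemma cantor_sum_shift:
  assumes a: "\<And>j. a j \<in> {0, 1::real}"
  shows "cantor_sum a = 2 * a 0 / 3 + cantor_sum (\<lambda>j. a (Suc j)) / 3"
proof -
  have "summable (\<lambda>j. 2 * a (Suc j) / 3 ^ Suc j)" using cantor_sum_summable[of "\<lambda>j. a (Suc j)"] a by blast
  then have "(\<Sum>j. 2 * a (Suc j) / 3 ^ Suc j / 3) = cantor_sum (\<lambda>j. a (Suc j)) / 3"
    unfolding cantor_sum_def by (rule suminf_divide)
  moreover have "(\<Sum>j. 2 * a (Suc j) / 3 ^ Suc j / 3) = cantor_sum a - 2 * a 0 / 3 ^ Suc 0"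
    using suminf_split_head[OF cantor_sum_summable[of a]] a unfolding cantor_sum_def
    by (simp add: mult.commute)
  ultimately show ?thesis by simp
qed

text \<open>Multiplication by \<open>3 ^ k\<close> shifts the ternary digits; the digits moved to the left of the point form an
  even number because all of them are even.\<close>

lemma cantor_sum_scale:
  assumes a: "\<And>j. a j \<in> {0, 1::real}"
  shows "\<exists>m::int. 3 ^ k * cantor_sum a = 2 * of_int m + cantor_sum (\<lambda>j. a (k + j))"
proof (induction k)
  case 0
  show ?case by (intro exI[of _ 0]) simp
next
  case (Suc k)
  then obtain m :: int where m: "3 ^ k * cantor_sum a = 2 * of_int m + cantor_sum (\<lambda>j. a (k + j))" by blast
  have "3 ^ Suc k * cantor_sum a = 3 * (3 ^ k * cantor_sum a)" by simp
  also have "\<dots> = 6 * of_int m + 3 * cantor_sum (\<lambda>j. a (k + j))" unfolding m by simp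
  also have "cantor_sum (\<lambda>j. a (k + j)) = 2 * a k / 3 + cantor_sum (\<lambda>j. a (Suc k + j)) / 3"
    using cantor_sum_shift[of "\<lambda>j. a (k + j)"] a by simp
  finally have "3 ^ Suc k * cantor_sum a = 2 * (3 * of_int m + a k) + cantor_sum (\<lambda>j. a (Suc k + j))"
    by simp
  moreover have "\<exists>i::int. a k = of_int i" using a[of k] by (auto intro: exI[of _ 0] exI[of _ 1])
  ultimately show ?case by (metis of_int_add of_int_mult of_int_numeral)
qed

lemma wave_cantor_sum:
  assumes a: "\<And>j. a j \<in> {0, 1::real}"
  shows "wave (3 ^ k * cantor_sum a) = a k"
proof -
  obtain m :: int where m: "3 ^ k * cantor_sum a = 2 * of_int m + cantor_sum (\<lambda>j. a (k + j))"
    using cantor_sum_scale[of a k] a by blast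
  have "cantor_sum (\<lambda>j. a (k + j)) = 2 * a k / 3 + cantor_sum (\<lambda>j. a (k + Suc j)) / 3"
    using cantor_sum_shift[of "\<lambda>j. a (k + j)"] a by simp
  then show ?thesis
    unfolding m using cantor_sum_range[of "\<lambda>j. a (k + Suc j)"] a
    by (simp only:) (intro wave_digit, auto)
qed

text \<open>The greedy algorithm: \<open>r n\<close> is the remainder after \<open>n\<close> digits, scaled by \<open>2 ^ n\<close>.\<close>

lemma binary_expansion:
  assumes x: "0 \<le> x" "x \<le> (1::real)"
  obtains b :: "nat \<Rightarrow> real" where "\<forall>k. b k \<in> {0, 1}" "(\<lambda>k. b k / 2 ^ Suc k) sums x"
proof -
  define bit :: "real \<Rightarrow> real" where "bit r = (if 1 / 2 \<le> r then 1 else 0)" for r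
  define r where "r n = ((\<lambda>r. 2 * r - bit r) ^^ n) x" for n
  have r0: "r 0 = x" and rS: "r (Suc n) = 2 * r n - bit (r n)" for n by (auto simp: r_def)
  have rng: "0 \<le> r n \<and> r n \<le> 1" for n
    by (induction n) (use x in \<open>auto simp: r0 rS bit_def\<close>)
  have part: "(\<Sum>k<n. bit (r k) / 2 ^ Suc k) = x - r n / 2 ^ n" for n
  proof (induction n)
    case (Suc n)
    have "(\<Sum>k<Suc n. bit (r k) / 2 ^ Suc k) = x - r n / 2 ^ n + bit (r n) / 2 ^ Suc n"
      using Suc by simp
    also have "\<dots> = x - r (Suc n) / 2 ^ Suc n" unfolding rS by (simp add: field_simps)
    finally show ?case .
  qed (simp add: r0)
  have "(\<lambda>n. r n / 2 ^ n) \<longlonglongrightarrow> 0"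
  proof (rule tendsto_sandwich[of "\<lambda>_. 0" _ _ "\<lambda>n. (1 / 2) ^ n"])
    show "(\<lambda>n. (1 / 2 :: real) ^ n) \<longlonglongrightarrow> 0" by (rule LIMSEQ_power_zero) simp
  qed (use rng in \<open>auto intro!: always_eventually simp: power_divide divide_right_mono\<close>)
  from tendsto_diff[OF tendsto_const[of x] this]
  have "(\<lambda>k. bit (r k) / 2 ^ Suc k) sums x" unfolding sums_def part by simp
  then show thesis using that[of "\<lambda>k. bit (r k)"] by (auto simp: bit_def)
qed

text \<open>Schoenberg's curve, retracted onto the triangle. If the ternary digits of \<open>t\<close> are \<open>2 * a j\<close>, then
  \<open>wave (3 ^ k * t) = a k\<close>: the digits of \<open>t\<close> with even index become the binary digits of the first
  coordinate and those with odd index the binary digits of the second one. The nearest-point retraction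
  takes care of the parameters whose digits do not encode a point of the triangle.\<close>

definition schoenberg :: "real \<Rightarrow> point" where
  "schoenberg t = closest_point simplex2 (wave_series t, wave_series (3 * t))"

lemma simplex2_nonempty: "simplex2 \<noteq> {}"
  using vertex_simplex2 by blast

lemma schoenberg_in: "schoenberg t \<in> simplex2"
  unfolding schoenberg_def by (rule closest_point_in_set[OF closed_simplex2 simplex2_nonempty])

lemma continuous_schoenberg: "continuous_on UNIV schoenberg"
  unfolding schoenberg_def
  by (rule continuous_on_compose2[OF continuous_on_closest_point[OF convex_simplex2 closed_simplex2
          simplex2_nonempty, of UNIV]])
     (auto intro!: continuous_intros continuous_on_compose2[OF continuous_wave_series])

lemma schoenberg_surj:
  assumes x: "x \<in> simplex2"
  shows "\<exists>t. 0 \<le> t \<and> t \<le> 1 \<and> schoenberg t = x"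
proof -
  have rng: "0 \<le> fst x" "fst x \<le> 1" "0 \<le> snd x" "snd x \<le> 1" using x by (auto simp: simplex2_def)
  obtain b where b: "\<forall>k. b k \<in> {0, 1}" "(\<lambda>k. b k / 2 ^ Suc k) sums fst x"
    using binary_expansion[OF rng(1,2)] .
  obtain c where c: "\<forall>k. c k \<in> {0, 1}" "(\<lambda>k. c k / 2 ^ Suc k) sums snd x"
    using binary_expansion[OF rng(3,4)] .
  define a where "a j = (if even j then b (j div 2) else c (j div 2))" for j
  have a: "a j \<in> {0, 1}" for j unfolding a_def using b(1) c(1) by auto
  define t where "t = cantor_sum a"
  have "wave (9 ^ k * t) = b k" for k
    using wave_cantor_sum[of a "2 * k"] a by (simp add: t_def power_mult) (simp add: a_def)
  then have 1: "wave_series t = fst x"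
    unfolding wave_series_def using sums_unique[OF b(2)] by simp
  have "wave (9 ^ k * (3 * t)) = c k" for k
  proof -
    have "(3::real) ^ Suc (2 * k) = 9 ^ k * 3" by (simp add: power_mult)
    then have "wave (9 ^ k * 3 * cantor_sum a) = a (Suc (2 * k))"
      using wave_cantor_sum[of a "Suc (2 * k)"] a by metis
    then show ?thesis by (simp add: t_def mult.assoc) (simp add: a_def)
  qed
  then have 2: "wave_series (3 * t) = snd x"
    unfolding wave_series_def using sums_unique[OF c(2)] by simp
  have "schoenberg t = x"
    unfolding schoenberg_def 1 2 using closest_point_self[OF x] by simp
  moreover have "0 \<le> t \<and> t \<le> 1" using cantor_sum_range[of a] a unfolding t_def by blast
  ultimately show ?thesis by blast
qed

section \<open>The limit functionals are integrals\<close>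

lemma cont_measurable_simplex2:
  fixes f :: "point \<Rightarrow> 'b::topological_space"
  shows "continuous_on simplex2 f \<Longrightarrow> f \<in> borel_measurable borel_simplex"
  by (rule borel_measurable_continuous_on_restrict)

lemma space_borel_simplex [simp]: "space borel_simplex = simplex2"
  by (simp add: space_restrict_space)

context df_weights
begin

lemma Pn_sum:
  assumes "finite S" "\<And>s. s \<in> S \<Longrightarrow> continuous_on simplex2 (f s)" and x: "x \<in> simplex2"
  shows "(P ^^ n) (\<lambda>y. \<Sum>s\<in>S. a s * f s y) x = (\<Sum>s\<in>S. a s * (P ^^ n) (f s) x)"
  using assms(1,2)
proof (induction S rule: finite_induct)
  case empty
  show ?case using Pn_const[OF x, of n 0] by simp
next
  case (insert s S)
  have c: "continuous_on simplex2 (\<lambda>y. \<Sum>s\<in>S. a s * f s y)"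
    using insert.prems by (intro continuous_intros) auto
  show ?case
    using Pn_lin[OF insert.prems[of s] c x, of n "a s" 1] insert by simp
qed

text \<open>A partition of unity subordinate to a fine net replaces the law of the chain at time \<open>n\<close> by a
  finite convex combination of point masses.\<close>

lemma discrete_approximation:
  assumes x0: "x0 \<in> simplex2" and e: "e > 0"
  obtains X w where "finite X" "X \<subseteq> simplex2" "\<forall>z\<in>X. 0 \<le> w z" "(\<Sum>z\<in>X. w z) = (1::real)"
    "\<forall>B C f. HB B C f \<longrightarrow> \<bar>(P ^^ n) f x0 - (\<Sum>z\<in>X. w z * f z)\<bar> \<le> C * e powr \<alpha>"
proof -
  obtain X where X: "finite X" "X \<subseteq> simplex2" "simplex2 \<subseteq> (\<Union>z\<in>X. ball z e)"
    using seq_compact_imp_totally_bounded[of simplex2] compact_simplex2 e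
    unfolding compact_eq_seq_compact_metric by meson
  \<comment> \<open>tent functions around the points of the net, to be normalized to a partition of unity\<close>
  define b where "b z y = max 0 (e - dist z y)" for z y :: point
  define S where "S y = (\<Sum>z\<in>X. b z y)" for y
  have S: "S y > 0" if "y \<in> simplex2" for y
  proof -
    obtain z where "z \<in> X" "dist z y < e" using X(3) \<open>y \<in> simplex2\<close> by auto
    then show ?thesis
      unfolding S_def by (intro sum_pos2[OF X(1), of z]) (auto simp: b_def)
  qed
  define \<phi> where "\<phi> z y = b z y / S y" for z y
  have c\<phi>: "continuous_on simplex2 (\<phi> z)" for z
    unfolding \<phi>_def S_def b_def
    by (intro continuous_intros) (use S in \<open>fastforce simp: S_def b_def\<close>)
  have \<phi>0: "0 \<le> \<phi> z y" if "y \<in> simplex2" for z y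
    using S[OF that] by (simp add: \<phi>_def b_def)
  have \<phi>1: "(\<Sum>z\<in>X. \<phi> z y) = 1" if "y \<in> simplex2" for y
    using S[OF that] by (simp add: \<phi>_def flip: sum_divide_distrib S_def)
  define w where "w z = (P ^^ n) (\<phi> z) x0" for z
  have lin: "(P ^^ n) (\<lambda>y. \<Sum>z\<in>X. a z * \<phi> z y) x0 = (\<Sum>z\<in>X. a z * w z)" for a
    unfolding w_def by (rule Pn_sum[OF X(1) c\<phi> x0])
  show thesis
  proof (rule that[OF X(1,2), of w], goal_cases)
    case 1
    show ?case
    proof
      fix z
      show "0 \<le> w z"
        unfolding w_def
        using Pn_mono[OF absorbing_simplex2 continuous_on_const c\<phi> \<phi>0 x0, of n z] Pn_const[OF x0, of n 0]
        by simp
    qed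
  next
    case 2
    have "(P ^^ n) (\<lambda>y. \<Sum>z\<in>X. 1 * \<phi> z y) x0 = (P ^^ n) (\<lambda>y. 1) x0"
      by (rule Pn_cong[OF absorbing_simplex2 _ _ _ x0]) (auto simp: \<phi>1 intro!: continuous_intros c\<phi>)
    then show ?case using lin[of "\<lambda>_. 1"] Pn_const[OF x0] by simp
  next
    case 3
    show ?case
    proof (intro allI impI)
      fix B C f assume f: "HB B C f"
      have cf: "continuous_on simplex2 f" using HB_cont[OF f] .
      have C0: "0 \<le> C" using holder_bd_const_nonneg[OF f] .
      let ?g = "\<lambda>y. \<Sum>z\<in>X. f z * \<phi> z y"
      have cg: "continuous_on simplex2 ?g" by (intro continuous_intros c\<phi>)
      have "\<bar>f y - ?g y\<bar> \<le> C * e powr \<alpha>" if y: "y \<in> simplex2" for y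
      proof -
        have "f y = (\<Sum>z\<in>X. f y * \<phi> z y)" using \<phi>1[OF y] by (simp flip: sum_distrib_left)
        then have "f y - ?g y = (\<Sum>z\<in>X. (f y - f z) * \<phi> z y)"
          by (simp add: left_diff_distrib sum_subtractf)
        also have "\<bar>\<dots>\<bar> \<le> (\<Sum>z\<in>X. \<bar>(f y - f z) * \<phi> z y\<bar>)" by (rule sum_abs)
        also have "\<dots> \<le> (\<Sum>z\<in>X. (C * e powr \<alpha>) * \<phi> z y)"
        proof (rule sum_mono)
          fix z assume z: "z \<in> X"
          show "\<bar>(f y - f z) * \<phi> z y\<bar> \<le> (C * e powr \<alpha>) * \<phi> z y"
          proof (cases "dist z y < e")
            case True
            have "\<bar>f y - f z\<bar> \<le> C * dist y z powr \<alpha>" using f y z X(2) by (auto simp: holder_bd_def)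
            also have "\<dots> \<le> C * e powr \<alpha>"
              using True C0 alpha by (intro mult_left_mono powr_mono2) (auto simp: dist_commute)
            finally show ?thesis using \<phi>0[OF y, of z] by (simp add: abs_mult mult_right_mono)
          next
            case False
            then show ?thesis by (simp add: \<phi>_def b_def)
          qed
        qed
        also have "\<dots> = C * e powr \<alpha>" using \<phi>1[OF y] by (simp flip: sum_distrib_left)
        finally show ?thesis .
      qed
      then have "\<bar>(P ^^ n) (\<lambda>y. f y - ?g y) x0\<bar> \<le> C * e powr \<alpha>"
        by (intro Pn_bound[OF absorbing_simplex2 _ _ x0] continuous_intros cf cg) auto
      then show "\<bar>(P ^^ n) f x0 - (\<Sum>z\<in>X. w z * f z)\<bar> \<le> C * e powr \<alpha>"
        unfolding Pn_diff[OF cf cg x0] lin by (simp add: mult.commute)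
    qed
  qed
qed

text \<open>The image under \<open>\<tau>\<close> of a finite combination of point masses. It is carried by \<open>{-1<..1}\<close>, a
  half-open interval as in the definition of tightness.\<close>

lemma discrete_real_distribution:
  fixes \<tau> :: "point \<Rightarrow> real"
  assumes X: "finite X" and w: "\<forall>z\<in>X. 0 \<le> w z" "(\<Sum>z\<in>X. w z) = (1::real)"
    and t: "\<And>z. z \<in> X \<Longrightarrow> 0 \<le> \<tau> z \<and> \<tau> z \<le> 1"
  obtains M where "real_distribution M" "measure M {-1<..1} = 1"
    "\<forall>F\<in>borel_measurable borel. integral\<^sup>L M F = (\<Sum>z\<in>X. w z * F (\<tau> z))"
proof -
  define N where "N = point_measure X (\<lambda>z. ennreal (w z))"
  have spN: "space N = X" and stN: "sets N = Pow X"
    by (auto simp: N_def space_point_measure sets_point_measure)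
  have "emeasure N X = (\<Sum>z\<in>X. ennreal (w z))"
    unfolding N_def by (rule emeasure_point_measure_finite[OF X]) simp
  also have "\<dots> = ennreal (\<Sum>z\<in>X. w z)" using w by (intro sum_ennreal) auto
  finally interpret N: prob_space N using w(2) spN by (intro prob_spaceI) simp
  have mt: "\<tau> \<in> borel_measurable N" by (auto simp: measurable_def stN spN)
  define M where "M = distr N borel \<tau>"
  interpret M: prob_space M unfolding M_def by (rule N.prob_space_distr[OF mt])
  have "real_distribution M"
    by (rule real_distribution.intro[OF M.prob_space_axioms]) (simp add: real_distribution_axioms_def M_def)
  moreover have "measure M {-1<..1} = 1"
  proof -
    have "\<tau> -` {-1<..1} \<inter> space N = space N" using t unfolding spN by force
    then show ?thesis unfolding M_def using mt by (simp add: measure_distr N.prob_space)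
  qed
  moreover have "integral\<^sup>L M F = (\<Sum>z\<in>X. w z * F (\<tau> z))" if "F \<in> borel_measurable borel" for F :: "real \<Rightarrow> real"
  proof -
    have "integral\<^sup>L M F = (\<integral>z. F (\<tau> z) \<partial>N)" unfolding M_def by (rule integral_distr[OF mt that])
    also have "\<dots> = (\<Sum>z\<in>X. w z * F (\<tau> z))"
      unfolding N_def using w(1) X by (subst lebesgue_integral_point_measure_finite) auto
    finally show ?thesis .
  qed
  ultimately show thesis using that by blast
qed

text \<open>Lifting the discrete approximations of the laws of the chain to the line along Schoenberg's
  curve makes Helly's selection theorem applicable; the image of a weak limit represents the limit
  functional.\<close>

lemma lim_val_represented:
  assumes K: "K \<in> minimal_absorbing p"
  obtains \<mu> where "prob_space \<mu>" "sets \<mu> = sets borel_simplex"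
    "\<forall>B C f. HB B C f \<longrightarrow> integral\<^sup>L \<mu> f = lim_val K f"
proof -
  obtain x0 where x0: "x0 \<in> K" using minimal_absorbingD(4)[OF K] by auto
  then have x0s: "x0 \<in> simplex2" using minimal_absorbingD(2)[OF K] by auto
  obtain \<tau> where \<tau>: "\<And>z. z \<in> simplex2 \<Longrightarrow> 0 \<le> \<tau> z \<and> \<tau> z \<le> 1 \<and> schoenberg (\<tau> z) = z"
    using schoenberg_surj by metis
  have cg: "isCont (\<lambda>t. f (schoenberg t)) t" if "continuous_on simplex2 f" for f :: "point \<Rightarrow> real" and t
  proof -
    have "continuous_on UNIV (\<lambda>t. f (schoenberg t))"
      by (rule continuous_on_compose2[OF that continuous_schoenberg]) (use schoenberg_in in auto)
    then show ?thesis by (simp add: continuous_on_eq_continuous_at)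
  qed
  have "\<exists>M. real_distribution M \<and> measure M {-1<..1} = 1 \<and>
      (\<forall>B C f. HB B C f \<longrightarrow> \<bar>(P ^^ n) f x0 - (\<integral>t. f (schoenberg t) \<partial>M)\<bar> \<le> C * (1 / real (Suc n)) powr \<alpha>)" for n
  proof -
    have npos: "1 / real (Suc n) > 0" by simp
    obtain X w where X: "finite X" "X \<subseteq> simplex2" "\<forall>z\<in>X. 0 \<le> w z" "(\<Sum>z\<in>X. w z) = (1::real)"
      "\<forall>B C f. HB B C f \<longrightarrow> \<bar>(P ^^ n) f x0 - (\<Sum>z\<in>X. w z * f z)\<bar> \<le> C * (1 / real (Suc n)) powr \<alpha>"
      using discrete_approximation[OF x0s npos] .
    have \<tau>X: "0 \<le> \<tau> z \<and> \<tau> z \<le> 1" if "z \<in> X" for z using \<tau> X(2) that by blast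
    obtain M where M: "real_distribution M" "measure M {-1<..1} = 1"
      "\<forall>F\<in>borel_measurable borel. integral\<^sup>L M F = (\<Sum>z\<in>X. w z * F (\<tau> z))"
      using discrete_real_distribution[OF X(1,3,4) \<tau>X] .
    have "(\<integral>t. f (schoenberg t) \<partial>M) = (\<Sum>z\<in>X. w z * f z)" if f: "HB B C f" for B C f
    proof -
      have "(\<lambda>t. f (schoenberg t)) \<in> borel_measurable borel"
        using cg[OF HB_cont[OF f]] by (intro borel_measurable_continuous_onI) (simp add: continuous_on_eq_continuous_at)
      from bspec[OF M(3) this] show ?thesis
        by (simp only:) (rule sum.cong[OF refl], use \<tau> X(2) in \<open>simp add: subset_iff del: split_paired_All\<close>)
    qed
    then show ?thesis using M(1,2) X(5) by (intro exI[of _ M]) auto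
  qed
  then obtain M where M: "\<And>n. real_distribution (M n)" "\<And>n. measure (M n) {-1<..1} = 1"
    "\<And>n B C f. HB B C f \<Longrightarrow> \<bar>(P ^^ n) f x0 - (\<integral>t. f (schoenberg t) \<partial>M n)\<bar> \<le> C * (1 / real (Suc n)) powr \<alpha>"
    by metis
  have "tight M" 
    unfolding tight_def using M(1,2)
    by (intro conjI allI impI exI[where x="-1"] exI[where x=1]) simp_all
  from tight_imp_convergent_subsubsequence[OF this strict_mono_id]
  obtain r N where r: "strict_mono (r :: nat \<Rightarrow> nat)" "real_distribution N" "weak_conv_m (M \<circ> id \<circ> r) N" by blast
  have wc: "weak_conv_m (\<lambda>n. M (r n)) N" using r(3) by (simp add: comp_def)
  interpret N: real_distribution N by fact
  have ms: "schoenberg \<in> measurable N borel_simplex"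
    by (intro measurable_restrict_space2, simp add: schoenberg_in)
       (subst measurable_cong_sets[OF N.events_eq_borel refl],
        rule borel_measurable_continuous_onI[OF continuous_schoenberg])
  define \<mu> where "\<mu> = distr N borel_simplex schoenberg"
  have "integral\<^sup>L \<mu> f = lim_val K f" if f: "HB B C f" for B C f
  proof -
    have cf: "continuous_on simplex2 f" using HB_cont[OF f] .
    have "integral\<^sup>L \<mu> f = (\<integral>t. f (schoenberg t) \<partial>N)"
      unfolding \<mu>_def by (rule integral_distr[OF ms cont_measurable_simplex2[OF cf]])
    moreover have "(\<lambda>n. \<integral>t. f (schoenberg t) \<partial>M (r n)) \<longlonglongrightarrow> (\<integral>t. f (schoenberg t) \<partial>N)"
      by (rule weak_conv_imp_integral_bdd_continuous_conv[OF M(1) r(2) wc cg[OF cf], of B])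
         (use f schoenberg_in in \<open>auto simp: holder_bd_def\<close>)
    moreover have "(\<lambda>n. \<integral>t. f (schoenberg t) \<partial>M (r n)) \<longlonglongrightarrow> lim_val K f"
    proof -
      have "(\<lambda>n. C * (1 / real (Suc n)) powr \<alpha>) \<longlonglongrightarrow> C * 0 powr \<alpha>"
        using alpha LIMSEQ_inverse_real_of_nat
        by (intro tendsto_intros tendsto_powr') (auto simp: inverse_eq_divide)
      then have z: "(\<lambda>n. C * (1 / real (Suc n)) powr \<alpha>) \<longlonglongrightarrow> 0" by simp
      have "(\<lambda>n. (P ^^ n) f x0 - (\<integral>t. f (schoenberg t) \<partial>M n)) \<longlonglongrightarrow> 0"
        by (rule Lim_null_comparison[OF _ z]) (use M(3)[OF f] in \<open>auto intro!: always_eventually\<close>)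
      from tendsto_diff[OF lim_val_tendsto[OF K f x0] this]
      have "(\<lambda>n. \<integral>t. f (schoenberg t) \<partial>M n) \<longlonglongrightarrow> lim_val K f" by simp
      from LIMSEQ_subseq_LIMSEQ[OF this r(1)] show ?thesis by (simp add: comp_def)
    qed
    ultimately show ?thesis using LIMSEQ_unique by metis
  qed
  moreover have "prob_space \<mu>" unfolding \<mu>_def by (rule N.prob_space_distr[OF ms])
  moreover have "sets \<mu> = sets borel_simplex" by (simp add: \<mu>_def)
  ultimately show thesis using that by blast
qed

end

section \<open>Measures on the triangle\<close>

text \<open>The closed sets are a generator that is stable under intersection, as needed for the uniqueness
  of measures.\<close>

lemma sets_borel_simplex_closed:
  "sets borel_simplex = sigma_sets simplex2 {C. closed C \<and> C \<subseteq> simplex2}"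
proof -
  have "sets borel_simplex = (\<inter>) simplex2 ` sigma_sets UNIV (Collect closed)"
    by (simp add: sets_restrict_space borel_eq_closed)
  also have "\<dots> = sigma_sets simplex2 ((\<inter>) simplex2 ` Collect closed)"
    by (rule sigma_sets_Int) (auto simp: closed_simplex2 intro: sigma_sets.Basic)
  also have "(\<inter>) simplex2 ` Collect closed = {C. closed C \<and> C \<subseteq> simplex2}"
    using closed_simplex2 by (auto intro!: image_eqI)
  finally show ?thesis .
qed

lemma simplex_measure_space: "sets \<mu> = sets borel_simplex \<Longrightarrow> space \<mu> = simplex2"
  by (metis sets_eq_imp_space_eq space_borel_simplex)

lemma open_simplex_sets: "open W \<Longrightarrow> W \<inter> simplex2 \<in> sets borel_simplex"
  by (simp add: sets_restrict_space Int_commute image_eqI[of _ _ W])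

lemma bounded_measurable_integrable:
  assumes "prob_space \<mu>" "sets \<mu> = sets borel_simplex" "f \<in> bounded_measurable"
  shows "integrable \<mu> f"
proof -
  interpret prob_space \<mu> by fact
  obtain B where "\<forall>x\<in>simplex2. norm (f x) \<le> B"
    using assms(3) by (auto simp: bounded_measurable_def bounded_iff)
  then show ?thesis
    using assms(2,3) simplex_measure_space[OF assms(2)]
    by (intro integrable_const_bound[of _ B])
       (auto simp: bounded_measurable_def cong: measurable_cong_sets)
qed

lemma cont_bounded_measurable: "continuous_on simplex2 f \<Longrightarrow> f \<in> bounded_measurable"
  unfolding bounded_measurable_def
  using cont_measurable_simplex2 compact_continuous_image[OF _ compact_simplex2] compact_imp_bounded
  by blast

lemma continuous_simplex2_bounded:
  fixes f :: "point \<Rightarrow> real"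
  assumes "continuous_on simplex2 f" shows "\<exists>B. \<forall>y\<in>simplex2. \<bar>f y\<bar> \<le> B"
  using compact_imp_bounded[OF compact_continuous_image[OF assms compact_simplex2]]
  by (auto simp: bounded_iff)

text \<open>A convex combination of measures, built as the law of a point whose distribution is first drawn
  at random.\<close>

lemma convex_combination_measure:
  assumes T: "finite T" "\<And>\<mu>. \<mu> \<in> T \<Longrightarrow> prob_space \<mu> \<and> sets \<mu> = sets borel_simplex"
    and a: "\<And>\<mu>. \<mu> \<in> T \<Longrightarrow> 0 \<le> a \<mu>" "(\<Sum>\<mu>\<in>T. a \<mu>) = (1::real)"
  obtains \<nu> where "prob_space \<nu>" "sets \<nu> = sets borel_simplex"
    "\<forall>B\<in>sets borel_simplex. emeasure \<nu> B = (\<Sum>\<mu>\<in>T. ennreal (a \<mu>) * emeasure \<mu> B)"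
    "\<forall>f\<in>bounded_measurable. integral\<^sup>L \<nu> f = (\<Sum>\<mu>\<in>T. a \<mu> * integral\<^sup>L \<mu> f)"
proof -
  define Q where "Q = point_measure T (\<lambda>\<mu>. ennreal (a \<mu>))"
  have spQ: "space Q = T" and stQ: "sets Q = Pow T"
    by (auto simp: Q_def space_point_measure sets_point_measure)
  have "emeasure Q T = (\<Sum>\<mu>\<in>T. ennreal (a \<mu>))"
    unfolding Q_def by (rule emeasure_point_measure_finite[OF T(1)]) simp
  also have "\<dots> = ennreal (\<Sum>\<mu>\<in>T. a \<mu>)" using a by (intro sum_ennreal) auto
  finally interpret Q: prob_space Q using a(2) spQ by (intro prob_spaceI) simp
  have T0: "T \<noteq> {}" using a(2) by auto
  have sub: "\<mu> \<in> space (subprob_algebra borel_simplex)" if "\<mu> \<in> T" for \<mu>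
    using T(2)[OF that] by (simp add: space_subprob_algebra prob_space_imp_subprob_space)
  have m: "(\<lambda>\<mu>. \<mu>) \<in> measurable Q (subprob_algebra borel_simplex)"
    using sub by (auto simp: measurable_def spQ stQ)
  define \<nu> where "\<nu> = Q \<bind> (\<lambda>\<mu>. \<mu>)"
  have st: "sets \<nu> = sets borel_simplex"
    unfolding \<nu>_def by (rule sets_bind) (use T T0 spQ in auto)
  have em: "emeasure \<nu> B = (\<Sum>\<mu>\<in>T. ennreal (a \<mu>) * emeasure \<mu> B)" if "B \<in> sets borel_simplex" for B
  proof -
    have "emeasure \<nu> B = (\<integral>\<^sup>+\<mu>. emeasure \<mu> B \<partial>Q)"
      unfolding \<nu>_def using T0 by (intro emeasure_bind[OF _ m that]) (simp add: spQ)
    also have "\<dots> = (\<Sum>\<mu>\<in>T. ennreal (a \<mu>) * emeasure \<mu> B)"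
      unfolding Q_def by (rule nn_integral_point_measure_finite[OF T(1)])
    finally show ?thesis .
  qed
  have "integral\<^sup>L \<nu> f = (\<Sum>\<mu>\<in>T. a \<mu> * integral\<^sup>L \<mu> f)" if f: "f \<in> bounded_measurable" for f
  proof -
    obtain B where B: "\<forall>x\<in>simplex2. norm (f x) \<le> B"
      using f by (auto simp: bounded_measurable_def bounded_iff)
    have "integral\<^sup>L \<nu> f = (\<integral>\<mu>. integral\<^sup>L \<mu> f \<partial>Q)"
      unfolding \<nu>_def
    proof (rule integral_bind[OF _ _ m])
      show "AE \<mu> in Q. emeasure \<mu> (space \<mu>) \<le> ennreal 1"
        using T(2) by (intro AE_I2) (simp add: spQ prob_space.emeasure_space_1)
    qed (use f B Q.finite_measure_axioms in \<open>auto simp: bounded_measurable_def\<close>)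
    also have "\<dots> = (\<Sum>\<mu>\<in>T. a \<mu> * integral\<^sup>L \<mu> f)"
      unfolding Q_def using a(1) T(1) by (subst lebesgue_integral_point_measure_finite) auto
    finally show ?thesis .
  qed
  moreover have "prob_space \<nu>"
  proof (rule prob_spaceI)
    have "simplex2 \<in> sets borel_simplex" using sets.top[of borel_simplex] by simp
    moreover have "emeasure \<mu> simplex2 = 1" if "\<mu> \<in> T" for \<mu>
      using T(2)[OF that] prob_space.emeasure_space_1 simplex_measure_space by metis
    ultimately have "emeasure \<nu> simplex2 = (\<Sum>\<mu>\<in>T. ennreal (a \<mu>))"
      by (subst em) (auto intro!: sum.cong)
    also have "\<dots> = ennreal (\<Sum>\<mu>\<in>T. a \<mu>)" using a by (intro sum_ennreal) auto
    finally show "emeasure \<nu> (space \<nu>) = 1" using a(2) simplex_measure_space[OF st] by simp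
  qed
  ultimately show thesis using that st em by blast
qed

lemma dirac_integral:
  assumes "continuous_on simplex2 (\<phi> :: point \<Rightarrow> complex)"
  shows "(LINT y|dirac i. \<phi> y) = \<phi> (vertex i)"
  by (rule integral_return) (use cont_measurable_simplex2[OF assms] in auto)

lemma measure_hull_singleton:
  assumes "prob_space \<mu>"
  shows "measure_hull {\<mu>} = {\<mu>}"
proof (intro equalityI subsetI)
  fix \<nu> assume "\<nu> \<in> measure_hull {\<mu>}"
  then obtain T a where T: "T \<subseteq> {\<mu>}" "\<forall>\<mu>\<in>T. 0 \<le> a \<mu> \<and> sets \<nu> = sets \<mu>" "(\<Sum>\<mu>\<in>T. a \<mu>) = (1::real)"
    "\<forall>B\<in>sets \<nu>. emeasure \<nu> B = (\<Sum>\<mu>\<in>T. ennreal (a \<mu>) * emeasure \<mu> B)"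
    unfolding measure_hull_def by blast
  have "T = {\<mu>}" using T(1,3) by (cases "T = {}") auto
  then have "a \<mu> = 1" "sets \<nu> = sets \<mu>" using T by auto
  then show "\<nu> \<in> {\<mu>}" using T(4) \<open>T = {\<mu>}\<close> by (auto intro!: measure_eqI)
next
  fix \<nu> assume "\<nu> \<in> {\<mu>}"
  then show "\<nu> \<in> measure_hull {\<mu>}"
    unfolding measure_hull_def mem_Collect_eq
    by (intro exI[of _ "{\<mu>}"] exI[of _ "\<lambda>_. 1"]) auto
qed

context df_weights
begin

text \<open>Bumps \<open>max 0 (1 - n * infdist x C)\<close> decrease to the indicator function of a closed set \<open>C\<close>, so
  integrals of Hoelder functions determine a probability measure.\<close>

lemma measure_eq_of_holder:
  assumes \<mu>: "prob_space \<mu>" "sets \<mu> = sets borel_simplex"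
    and \<nu>: "prob_space \<nu>" "sets \<nu> = sets borel_simplex"
    and eq: "\<And>B C f. HB B C f \<Longrightarrow> integral\<^sup>L \<mu> f = integral\<^sup>L \<nu> f"
  shows "\<mu> = \<nu>"
proof -
  have lim: "(\<lambda>n. integral\<^sup>L M (\<lambda>x. max 0 (1 - real n * infdist x C))) \<longlonglongrightarrow> measure M C"
    if M: "prob_space M" "sets M = sets borel_simplex" and C: "closed C" "C \<noteq> {}" "C \<subseteq> simplex2" for M C
  proof -
    interpret prob_space M by fact
    have CM: "C \<in> sets M" unfolding M(2) sets_borel_simplex_closed using C by (intro sigma_sets.Basic) auto
    have "(\<lambda>n. integral\<^sup>L M (\<lambda>x. max 0 (1 - real n * infdist x C))) \<longlonglongrightarrow> integral\<^sup>L M (indicator C)"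
    proof (rule integral_dominated_convergence[where w = "\<lambda>_. 1"])
      show "AE x in M. (\<lambda>n. max 0 (1 - real n * infdist x C)) \<longlonglongrightarrow> indicator C x"
      proof (rule AE_I2)
        fix x
        show "(\<lambda>n. max 0 (1 - real n * infdist x C)) \<longlonglongrightarrow> indicator C x"
        proof (cases "x \<in> C")
          case False
          then have d: "infdist x C > 0"
            using C in_closed_iff_infdist_zero[of C x] infdist_nonneg[of x C] by linarith
          obtain N :: nat where N: "1 < real N * infdist x C" using reals_Archimedean3[OF d] by blast
          have "\<forall>\<^sub>F n in sequentially. max 0 (1 - real n * infdist x C) = 0"
            unfolding eventually_sequentially
          proof (intro exI allI impI)
            fix n assume "n \<ge> N"
            then have "real N * infdist x C \<le> real n * infdist x C" using d by (intro mult_right_mono) auto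
            then show "max 0 (1 - real n * infdist x C) = 0" using N by simp
          qed
          then show ?thesis using False by (simp add: tendsto_eventually)
        qed simp
      qed
      show "(\<lambda>x. max 0 (1 - real n * infdist x C)) \<in> borel_measurable M" for n
      proof -
        have "continuous_on simplex2 (\<lambda>x. max 0 (1 - real n * infdist x C))"
          by (intro continuous_on_max continuous_intros continuous_on_infdist)
        from cont_measurable_simplex2[OF this] show ?thesis
          using M(2) by (simp cong: measurable_cong_sets)
      qed
      show "indicator C \<in> borel_measurable M" using CM by simp
    qed (auto simp: infdist_nonneg)
    then show ?thesis using CM by simp
  qed
  have eqC: "emeasure \<mu> C = emeasure \<nu> C" if C: "C \<in> {C. closed C \<and> C \<subseteq> simplex2}" for C
  proof (cases "C = {}")
    case False
    interpret \<mu>: prob_space \<mu> by fact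
    interpret \<nu>: prob_space \<nu> by fact
    have "integral\<^sup>L \<mu> (\<lambda>x. max 0 (1 - real n * infdist x C)) = integral\<^sup>L \<nu> (\<lambda>x. max 0 (1 - real n * infdist x C))" for n
    proof (rule eq[OF lipschitz_HB])
      fix x y :: point
      show "\<bar>max 0 (1 - real n * infdist x C)\<bar> \<le> 1" by (simp add: infdist_nonneg)
      have "\<bar>max 0 (1 - real n * infdist x C) - max 0 (1 - real n * infdist y C)\<bar>
          \<le> \<bar>real n * infdist x C - real n * infdist y C\<bar>" by linarith
      also have "\<dots> = real n * \<bar>infdist x C - infdist y C\<bar>"
        by (simp add: abs_mult flip: right_diff_distrib)
      also have "\<dots> \<le> real n * dist x y"
        using infdist_triangle_abs[of x C y] by (intro mult_left_mono) auto
      finally show "\<bar>max 0 (1 - real n * infdist x C) - max 0 (1 - real n * infdist y C)\<bar> \<le> real n * dist x y" .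
    qed simp
    then have "measure \<mu> C = measure \<nu> C"
      using lim[OF \<mu>, of C] lim[OF \<nu>, of C] C False LIMSEQ_unique by auto
    then show ?thesis by (simp add: \<mu>.emeasure_eq_measure \<nu>.emeasure_eq_measure)
  qed simp
  show ?thesis
  proof (rule measure_eqI_generator_eq[where A = "\<lambda>_. simplex2", OF _ _ eqC])
    show "Int_stable {C. closed C \<and> C \<subseteq> simplex2}" by (auto simp: Int_stable_def)
    show "sets \<mu> = sigma_sets simplex2 {C. closed C \<and> C \<subseteq> simplex2}"
      "sets \<nu> = sigma_sets simplex2 {C. closed C \<and> C \<subseteq> simplex2}"
      using \<mu>(2) \<nu>(2) sets_borel_simplex_closed by auto
    show "emeasure \<mu> simplex2 \<noteq> \<infinity>"
      using prob_space.emeasure_space_1[OF \<mu>(1)] simplex_measure_space[OF \<mu>(2)] by simp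
  qed (use closed_simplex2 in auto)
qed

text \<open>The law of the chain after one step from the initial distribution \<open>\<nu>\<close>: draw the starting point,
  the time \<open>t\<close> and the vertex independently (the vertex from the counting measure) and reweight by the
  probability of that vertex.\<close>

lemma one_step_law:
  assumes \<nu>: "prob_space \<nu>" "sets \<nu> = sets borel_simplex"
  obtains \<nu>' where "prob_space \<nu>'" "sets \<nu>' = sets borel_simplex"
    "\<forall>f\<in>bounded_measurable. integral\<^sup>L \<nu>' f = (LINT x|\<nu>. P f x)"
proof -
  interpret \<nu>: prob_space \<nu> by fact
  define U where "U = restrict_space lborel {0..1::real}"
  have spU: "space U = {0..1}" by (simp add: U_def space_restrict_space)
  interpret U: prob_space U
    by (rule prob_spaceI) (simp add: U_def space_restrict_space emeasure_restrict_space)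
  define V where "V = count_space {0,1,2::nat}"
  interpret V: finite_measure V unfolding V_def by (rule finite_measure_count_space) simp
  interpret UV: pair_sigma_finite U V ..
  interpret UVf: finite_measure "U \<Otimes>\<^sub>M V"
  proof
    show "emeasure (U \<Otimes>\<^sub>M V) (space (U \<Otimes>\<^sub>M V)) \<noteq> \<infinity>"
      unfolding space_pair_measure
      by (subst V.emeasure_pair_measure_Times) (auto simp: U.emeasure_space_1 V.emeasure_finite)
  qed
  interpret N: pair_sigma_finite \<nu> "U \<Otimes>\<^sub>M V" ..
  interpret NF: finite_measure "\<nu> \<Otimes>\<^sub>M (U \<Otimes>\<^sub>M V)"
  proof
    show "emeasure (\<nu> \<Otimes>\<^sub>M (U \<Otimes>\<^sub>M V)) (space (\<nu> \<Otimes>\<^sub>M (U \<Otimes>\<^sub>M V))) \<noteq> \<infinity>"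
      unfolding space_pair_measure[of \<nu>]
      by (subst UV.P.emeasure_pair_measure_Times) (auto simp: \<nu>.emeasure_space_1 UVf.emeasure_finite)
  qed
  let ?N = "\<nu> \<Otimes>\<^sub>M (U \<Otimes>\<^sub>M V)"
  have sp\<nu>: "space \<nu> = simplex2" by (rule simplex_measure_space[OF \<nu>(2)])
  have spN: "z \<in> space ?N \<longleftrightarrow> fst z \<in> simplex2 \<and> 0 \<le> fst (snd z) \<and> fst (snd z) \<le> 1 \<and> snd (snd z) \<in> {0,1,2}" for z
    by (cases z) (auto simp: space_pair_measure sp\<nu> spU V_def)
  have mfst: "fst \<in> borel_measurable ?N"
  proof -
    have "(\<lambda>x. x) \<in> borel_measurable \<nu>"
      using measurable_restrict_space1[of "\<lambda>x. x" borel borel simplex2] \<nu>(2) by (simp cong: measurable_cong_sets)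
    then show ?thesis by (rule measurable_compose[OF measurable_fst])
  qed
  have mt: "(\<lambda>z. fst (snd z)) \<in> borel_measurable ?N"
  proof -
    have "(\<lambda>x. x) \<in> borel_measurable U"
      unfolding U_def by (rule measurable_restrict_space1) simp
    then show ?thesis by (intro measurable_compose[OF _ \<open>(\<lambda>x. x) \<in> borel_measurable U\<close>]) simp
  qed
  have mi: "(\<lambda>z. h (snd (snd z))) \<in> measurable ?N L" if "\<And>i. h i \<in> space L" for h :: "nat \<Rightarrow> 'b" and L
  proof -
    have "h \<in> measurable V L" using that by (simp add: V_def)
    then show ?thesis by (intro measurable_compose[OF _ \<open>h \<in> measurable V L\<close>]) simp
  qed
  define mv where "mv z = fst (snd z) *\<^sub>R fst z + (1 - fst (snd z)) *\<^sub>R vertex (snd (snd z))" for z :: "point \<times> real \<times> nat"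
  have mv: "mv \<in> measurable ?N borel_simplex"
  proof (rule measurable_restrict_space2)
    have "(\<lambda>z. vertex (snd (snd z))) \<in> borel_measurable ?N" by (rule mi) simp
    then show "mv \<in> borel_measurable ?N"
      unfolding mv_def using mfst mt by (intro borel_measurable_add borel_measurable_scaleR borel_measurable_diff) simp_all
    show "mv \<in> space ?N \<rightarrow> simplex2"
      unfolding mv_def using spN by (auto intro!: move_simplex2 simp del: scaleR_Pair)
  qed
  define w where "w z = (\<Sum>i\<in>{0,1,2}. of_bool (snd (snd z) = i) * p i (fst z))" for z :: "point \<times> real \<times> nat"
  have pm: "(\<lambda>z. p i (fst z)) \<in> borel_measurable ?N" if "i \<in> {0,1,2}" for i
  proof -
    have "p i \<in> borel_measurable \<nu>"
      using cont_measurable_simplex2[OF weight_cont[OF that]] \<nu>(2) by (simp cong: measurable_cong_sets)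
    then show ?thesis by (rule measurable_compose[OF measurable_fst])
  qed
  have w: "w \<in> borel_measurable ?N"
    unfolding w_def using pm by (intro borel_measurable_sum borel_measurable_times mi) auto
  have weq: "w (x, t, i) = p i x" if "i \<in> {0,1,2}" for x t i
    unfolding w_def using that by auto
  have w01: "0 \<le> w z \<and> w z \<le> 1" if z: "z \<in> space ?N" for z
  proof -
    have *: "fst z \<in> simplex2" "snd (snd z) \<in> {0,1,2}" using z spN by auto
    have "w z = p (snd (snd z)) (fst z)" using weq[OF *(2), of "fst z" "fst (snd z)"] by simp
    moreover obtain D where "\<forall>i\<in>{0,1,2}. HB 1 D (p i)" by (rule weight_holder)
    ultimately show ?thesis using nonneg[OF *(2,1)] * by (force simp: holder_bd_def)
  qed
  define \<nu>' where "\<nu>' = distr (density ?N (\<lambda>z. ennreal (w z))) borel_simplex mv"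
  have int: "integral\<^sup>L \<nu>' f = (LINT x|\<nu>. P f x)" if f: "f \<in> bounded_measurable" for f
  proof -
    have fm: "f \<in> borel_measurable borel_simplex" using f by (simp add: bounded_measurable_def)
    obtain B where B: "\<And>x. x \<in> simplex2 \<Longrightarrow> norm (f x) \<le> B"
      using f by (auto simp: bounded_measurable_def bounded_iff)
    have fmv: "(\<lambda>z. f (mv z)) \<in> borel_measurable ?N" by (rule measurable_compose[OF mv fm])
    have mvs: "mv z \<in> simplex2" if "z \<in> space ?N" for z using measurable_space[OF mv that] by simp
    have bd: "norm (w z * f (mv z)) \<le> B" if z: "z \<in> space ?N" for z
    proof -
      have "\<bar>w z\<bar> * \<bar>f (mv z)\<bar> \<le> 1 * B"
        using w01[OF z] B[OF mvs[OF z]] by (intro mult_mono) auto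
      then show ?thesis by (simp add: abs_mult)
    qed
    have I: "integrable ?N (\<lambda>z. w z * f (mv z))"
      by (rule NF.integrable_const_bound[of _ B]) (use bd w fmv in auto)
    have "integral\<^sup>L \<nu>' f = (\<integral>z. f (mv z) \<partial>density ?N (\<lambda>z. ennreal (w z)))"
      unfolding \<nu>'_def by (rule integral_distr) (use mv fm in auto)
    also have "\<dots> = (\<integral>z. w z * f (mv z) \<partial>?N)"
      using w01 w fmv by (subst integral_density) auto
    also have "\<dots> = (\<integral>x. (\<integral>y. w (x, y) * f (mv (x, y)) \<partial>(U \<Otimes>\<^sub>M V)) \<partial>\<nu>)"
      using N.integral_fst'[OF I] by simp
    also have "\<dots> = (\<integral>x. P f x \<partial>\<nu>)"
    proof (rule Bochner_Integration.integral_cong[OF refl])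
      fix x assume x: "x \<in> space \<nu>"
      have sx: "(\<lambda>y. w (x, y) * f (mv (x, y))) \<in> borel_measurable (U \<Otimes>\<^sub>M V)"
        using w fmv x by (intro borel_measurable_times) (auto intro: measurable_Pair2)
      have "integrable (U \<Otimes>\<^sub>M V) (\<lambda>y. w (x, y) * f (mv (x, y)))"
      proof (rule UVf.integrable_const_bound[of _ B, OF _ sx], rule AE_I2)
        fix y assume "y \<in> space (U \<Otimes>\<^sub>M V)"
        then have "(x, y) \<in> space ?N" using x by (simp add: space_pair_measure)
        from bd[OF this] show "norm (w (x, y) * f (mv (x, y))) \<le> B" .
      qed
      then have Ixy: "integrable (U \<Otimes>\<^sub>M V) (case_prod (\<lambda>t i. w (x, t, i) * f (mv (x, t, i))))"
        by (simp add: case_prod_unfold)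
      have "(\<integral>y. w (x, y) * f (mv (x, y)) \<partial>(U \<Otimes>\<^sub>M V)) = (\<integral>i. (\<integral>t. w (x, t, i) * f (mv (x, t, i)) \<partial>U) \<partial>V)"
        using UV.integral_snd[OF Ixy] by (simp add: case_prod_unfold)
      also have "\<dots> = (\<Sum>i\<in>{0,1,2}. (\<integral>t. w (x, t, i) * f (mv (x, t, i)) \<partial>U))"
        unfolding V_def by (rule lebesgue_integral_count_space_finite) simp
      also have "\<dots> = (\<Sum>i\<in>{0,1,2}. p i x * (\<integral>t. f (mv (x, t, i)) \<partial>U))"
        by (intro sum.cong refl) (simp only: weq integral_mult_right_zero)
      also have "\<dots> = P f x"
        unfolding trans_op_def mv_def set_lebesgue_integral_def U_def
        by (intro sum.cong refl) (subst integral_restrict_space, simp_all)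
      finally show "(\<integral>y. w (x, y) * f (mv (x, y)) \<partial>(U \<Otimes>\<^sub>M V)) = P f x" .
    qed
    finally show ?thesis .
  qed
  have st: "sets \<nu>' = sets borel_simplex" by (simp add: \<nu>'_def)
  have "prob_space \<nu>'"
  proof -
    have "finite_measure \<nu>'"
      unfolding \<nu>'_def
    proof (rule finite_measure.finite_measure_distr)
      have "(\<integral>\<^sup>+z. ennreal (w z) \<partial>?N) \<le> (\<integral>\<^sup>+z. 1 \<partial>?N)"
        by (rule nn_integral_mono) (use w01 in simp)
      also have "\<dots> < \<infinity>"
        using NF.finite_emeasure_space by (simp add: top.not_eq_extremum del: NF.emeasure_finite)
      finally show "finite_measure (density ?N (\<lambda>z. ennreal (w z)))"
        using w by (intro finite_measureI) (simp add: emeasure_density cong: nn_integral_cong)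
    qed (use mv in auto)
    then interpret \<nu>': finite_measure \<nu>' .
    have "integral\<^sup>L \<nu>' (\<lambda>_. 1) = (LINT x|\<nu>. P (\<lambda>_. 1) x)"
      by (rule int[OF cont_bounded_measurable]) simp
    also have "\<dots> = (LINT x|\<nu>. 1)"
      by (rule Bochner_Integration.integral_cong[OF refl]) (simp add: P_const sp\<nu>)
    finally have "measure \<nu>' (space \<nu>') = 1" by (simp add: \<nu>.prob_space)
    then show ?thesis by (intro prob_spaceI) (simp add: \<nu>'.emeasure_eq_measure)
  qed
  then show thesis using that st int by blast
qed

text \<open>Invariance need only be checked for Hoelder functions: they determine the law after one step.\<close>

lemma invariant_of_holder:
  assumes \<nu>: "prob_space \<nu>" "sets \<nu> = sets borel_simplex"
    and inv: "\<And>B C f. HB B C f \<Longrightarrow> (LINT x|\<nu>. P f x) = (LINT x|\<nu>. f x)"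
  shows "\<nu> \<in> invariant_measures p"
proof -
  obtain \<nu>' where \<nu>': "prob_space \<nu>'" "sets \<nu>' = sets borel_simplex"
    "\<forall>f\<in>bounded_measurable. integral\<^sup>L \<nu>' f = (LINT x|\<nu>. P f x)" using one_step_law[OF \<nu>] .
  have "\<nu>' = \<nu>"
    by (rule measure_eq_of_holder[OF \<nu>'(1,2) \<nu>])
       (use \<nu>'(3) inv cont_bounded_measurable[OF HB_cont] in metis)
  then show ?thesis using \<nu> \<nu>'(3) by (auto simp: invariant_measures_def)
qed

section \<open>Invariant measures\<close>

text \<open>Well defined by \<open>measure_eq_of_holder\<close>; it will turn out that \<open>K\<close> is the support.\<close>

definition stat :: "point set \<Rightarrow> point measure" where
  "stat K = (SOME \<mu>. prob_space \<mu> \<and> sets \<mu> = sets borel_simplex \<and>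
    (\<forall>B C f. HB B C f \<longrightarrow> integral\<^sup>L \<mu> f = lim_val K f))"

lemma stat:
  assumes K: "K \<in> minimal_absorbing p"
  shows "prob_space (stat K)" "sets (stat K) = sets borel_simplex"
    "HB B C f \<Longrightarrow> integral\<^sup>L (stat K) f = lim_val K f"
proof -
  have "\<exists>\<mu>. prob_space \<mu> \<and> sets \<mu> = sets borel_simplex \<and>
    (\<forall>B C f. HB B C f \<longrightarrow> integral\<^sup>L \<mu> f = lim_val K f)" using lim_val_represented[OF K] by metis
  from someI_ex[OF this] show "prob_space (stat K)" "sets (stat K) = sets borel_simplex"
    "HB B C f \<Longrightarrow> integral\<^sup>L (stat K) f = lim_val K f"
    unfolding stat_def by blast+
qed

lemma stat_unique:
  assumes K: "K \<in> minimal_absorbing p" and "prob_space \<mu>" "sets \<mu> = sets borel_simplex"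
    and "\<And>B C f. HB B C f \<Longrightarrow> integral\<^sup>L \<mu> f = lim_val K f"
  shows "\<mu> = stat K"
  by (rule measure_eq_of_holder) (use assms stat[OF K] in auto)

lemma invariantD:
  assumes "\<nu> \<in> invariant_measures p"
  shows "prob_space \<nu>" "sets \<nu> = sets borel_simplex" "space \<nu> = simplex2"
    "continuous_on simplex2 f \<Longrightarrow> (LINT x|\<nu>. (P ^^ n) f x) = (LINT x|\<nu>. f x)"
proof -
  show \<nu>: "prob_space \<nu>" "sets \<nu> = sets borel_simplex" using assms by (auto simp: invariant_measures_def)
  then show "space \<nu> = simplex2" using simplex_measure_space by blast
  assume f: "continuous_on simplex2 f"
  show "(LINT x|\<nu>. (P ^^ n) f x) = (LINT x|\<nu>. f x)"
  proof (induction n)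
    case (Suc n)
    have "(P ^^ n) f \<in> bounded_measurable" by (rule cont_bounded_measurable[OF Pn_cont[OF f]])
    then show ?case using assms Suc by (simp add: invariant_measures_def)
  qed simp
qed

text \<open>An invariant measure gives the same integral to all iterates of \<open>f\<close>, hence to their limit.\<close>

lemma invariant_integral_orbit_lim:
  assumes \<nu>: "\<nu> \<in> invariant_measures p" and f: "HB B C f"
  shows "integral\<^sup>L \<nu> f = (LINT x|\<nu>. orbit_lim f x)"
proof -
  interpret prob_space \<nu> using invariantD(1)[OF \<nu>] .
  obtain C' where C': "HB B C' (orbit_lim f)" using orbit_lim_HB[OF f] .
  have meas: "g \<in> borel_measurable \<nu>" if "continuous_on simplex2 g" for g :: "point \<Rightarrow> real"
    using cont_measurable_simplex2[OF that] invariantD(2)[OF \<nu>] by (simp cong: measurable_cong_sets)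
  have cf: "continuous_on simplex2 f" using HB_cont[OF f] .
  have fB: "\<bar>f y\<bar> \<le> B" if "y \<in> simplex2" for y using f that by (simp add: holder_bd_def)
  have "(\<lambda>n. LINT x|\<nu>. (P ^^ n) f x) \<longlonglongrightarrow> (LINT x|\<nu>. orbit_lim f x)"
  proof (rule integral_dominated_convergence[where w = "\<lambda>_. B"])
    show "AE x in \<nu>. (\<lambda>n. (P ^^ n) f x) \<longlonglongrightarrow> orbit_lim f x"
      using orbit_lim_tendsto[OF f] invariantD(3)[OF \<nu>] by (intro AE_I2) auto
    show "AE x in \<nu>. norm ((P ^^ n) f x) \<le> B" for n
      using Pn_bound[OF absorbing_simplex2 cf fB] invariantD(3)[OF \<nu>] by (intro AE_I2) auto
  qed (use meas Pn_cont[OF cf] HB_cont[OF C'] in auto)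
  then have "(\<lambda>n. integral\<^sup>L \<nu> f) \<longlonglongrightarrow> (LINT x|\<nu>. orbit_lim f x)"
    using invariantD(4)[OF \<nu> cf] by simp
  then show ?thesis using LIMSEQ_const_iff by blast
qed

lemma stat_invariant:
  assumes K: "K \<in> minimal_absorbing p"
  shows "stat K \<in> invariant_measures p"
proof (rule invariant_of_holder[OF stat(1,2)[OF K]])
  fix B C f assume f: "HB B C f"
  obtain C' where C': "\<And>n. HB B C' ((P ^^ n) f)" using Pn_HB[OF f] by metis
  have "HB B C' (P f)" using C'[of 1] by simp
  then show "(LINT x|stat K. P f x) = (LINT x|stat K. f x)"
    using stat(3)[OF K] f lim_val_Pn[OF K f, of 1] by simp
qed

text \<open>The integral of \<open>hit K\<close> tells \<open>stat K\<close> from the other stationary measures.\<close>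

lemma stat_inj: "inj_on stat (minimal_absorbing p)"
proof (rule inj_onI, rule ccontr)
  fix K L assume K: "K \<in> minimal_absorbing p" and L: "L \<in> minimal_absorbing p"
    and eq: "stat K = stat L" and ne: "K \<noteq> L"
  obtain C where C: "HB 1 C (hit K)" using hit_HB[OF K] .
  show False
    using stat(3)[OF K C] stat(3)[OF L C] lim_val_hit[OF K K] lim_val_hit[OF K L] eq ne by simp
qed

text \<open>For an invariant \<open>\<nu>\<close> the integral of \<open>f\<close> is that of the sum of \<open>lim_val K f * hit K\<close>, that is, the
  sum of \<open>b K * lim_val K f\<close> with the weights \<open>b K = \<nu> (hit K)\<close>, which add up to 1.\<close>

lemma invariant_measures_eq:
  "invariant_measures p = measure_hull (stat ` minimal_absorbing p)"
proof (intro equalityI subsetI)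
  let ?M = "minimal_absorbing p"
  note fin = finite_minimal_absorbing
  fix \<nu> assume \<nu>: "\<nu> \<in> invariant_measures p"
  interpret \<nu>: prob_space \<nu> using invariantD(1)[OF \<nu>] .
  have int: "integrable \<nu> (hit K)" if "K \<in> ?M" for K
    using hit_HB[OF that] HB_cont cont_bounded_measurable
      bounded_measurable_integrable[OF invariantD(1,2)[OF \<nu>]] by metis
  define b where "b K = integral\<^sup>L \<nu> (hit K)" for K
  have b0: "0 \<le> b K" if "K \<in> ?M" for K
    unfolding b_def using hit_nonneg[OF that] invariantD(3)[OF \<nu>]
    by (intro Bochner_Integration.integral_nonneg_AE AE_I2) auto
  have "(\<Sum>K\<in>?M. b K) = (LINT x|\<nu>. (\<Sum>K\<in>?M. hit K x))"
    unfolding b_def by (rule Bochner_Integration.integral_sum[symmetric]) (rule int)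
  also have "\<dots> = (LINT x|\<nu>. 1)"
    by (rule Bochner_Integration.integral_cong[OF refl]) (simp add: hit_sum invariantD(3)[OF \<nu>])
  finally have b1: "(\<Sum>K\<in>?M. b K) = 1" by (simp add: \<nu>.prob_space)
  define a where "a \<mu> = b (the_inv_into ?M stat \<mu>)" for \<mu>
  have a: "a (stat K) = b K" if "K \<in> ?M" for K
    unfolding a_def using the_inv_into_f_f[OF stat_inj that] by simp
  have sum_a: "(\<Sum>\<mu>\<in>stat ` ?M. a \<mu> * g \<mu>) = (\<Sum>K\<in>?M. b K * g (stat K))" for g :: "point measure \<Rightarrow> real"
    by (subst sum.reindex[OF stat_inj]) (simp add: a)
  have a1: "(\<Sum>\<mu>\<in>stat ` ?M. a \<mu>) = 1" using sum_a[of "\<lambda>_. 1"] b1 by simp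
  have a0: "0 \<le> a \<mu>" if "\<mu> \<in> stat ` ?M" for \<mu> using that a b0 by auto
  have pr: "prob_space \<mu> \<and> sets \<mu> = sets borel_simplex" if "\<mu> \<in> stat ` ?M" for \<mu>
    using that stat(1,2) by auto
  obtain \<nu>' where \<nu>': "prob_space \<nu>'" "sets \<nu>' = sets borel_simplex"
    "\<forall>B\<in>sets borel_simplex. emeasure \<nu>' B = (\<Sum>\<mu>\<in>stat ` ?M. ennreal (a \<mu>) * emeasure \<mu> B)"
    "\<forall>f\<in>bounded_measurable. integral\<^sup>L \<nu>' f = (\<Sum>\<mu>\<in>stat ` ?M. a \<mu> * integral\<^sup>L \<mu> f)"
    using convex_combination_measure[OF finite_imageI[OF fin] pr a0 a1] .
  have "\<nu> = \<nu>'"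
  proof (rule measure_eq_of_holder[OF invariantD(1,2)[OF \<nu>] \<nu>'(1,2)])
    fix B C f assume f: "HB B C f"
    have "integral\<^sup>L \<nu> f = (LINT x|\<nu>. (\<Sum>K\<in>?M. lim_val K f * hit K x))"
      unfolding invariant_integral_orbit_lim[OF \<nu> f]
      by (rule Bochner_Integration.integral_cong[OF refl]) (simp add: orbit_lim_eq[OF f] invariantD(3)[OF \<nu>])
    also have "\<dots> = (\<Sum>K\<in>?M. lim_val K f * b K)"
      unfolding b_def using int by (subst Bochner_Integration.integral_sum) auto
    also have "\<dots> = (\<Sum>K\<in>?M. b K * integral\<^sup>L (stat K) f)"
      by (rule sum.cong) (simp_all add: stat(3)[OF _ f])
    also have "\<dots> = integral\<^sup>L \<nu>' f"
      using \<nu>'(4) cont_bounded_measurable[OF HB_cont[OF f]] sum_a[of "\<lambda>\<mu>. integral\<^sup>L \<mu> f"] by simp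
    finally show "integral\<^sup>L \<nu> f = integral\<^sup>L \<nu>' f" .
  qed
  then show "\<nu> \<in> measure_hull (stat ` ?M)"
    unfolding measure_hull_def mem_Collect_eq
    using finite_imageI[OF fin] a0 a1 pr \<nu>'(2,3)
    by (intro exI[of _ "stat ` ?M"] exI[of _ a]) auto
next
  fix \<nu> assume "\<nu> \<in> measure_hull (stat ` minimal_absorbing p)"
  then obtain T a where T: "finite T" "T \<subseteq> stat ` minimal_absorbing p"
    "\<forall>\<mu>\<in>T. 0 \<le> a \<mu> \<and> sets \<nu> = sets \<mu>" "(\<Sum>\<mu>\<in>T. a \<mu>) = (1::real)"
    "\<forall>B\<in>sets \<nu>. emeasure \<nu> B = (\<Sum>\<mu>\<in>T. ennreal (a \<mu>) * emeasure \<mu> B)"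
    unfolding measure_hull_def by blast
  have inv: "\<mu> \<in> invariant_measures p" if "\<mu> \<in> T" for \<mu> using T(2) that stat_invariant by auto
  have pr: "prob_space \<mu> \<and> sets \<mu> = sets borel_simplex" if "\<mu> \<in> T" for \<mu>
    using invariantD(1,2)[OF inv[OF that]] by blast
  have a0: "0 \<le> a \<mu>" if "\<mu> \<in> T" for \<mu> using T(3) that by blast
  obtain \<mu>0 where "\<mu>0 \<in> T" using T(4) by fastforce
  then have st: "sets \<nu> = sets borel_simplex" using T(3) pr by metis
  obtain \<nu>' where \<nu>': "prob_space \<nu>'" "sets \<nu>' = sets borel_simplex"
    "\<forall>B\<in>sets borel_simplex. emeasure \<nu>' B = (\<Sum>\<mu>\<in>T. ennreal (a \<mu>) * emeasure \<mu> B)"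
    "\<forall>f\<in>bounded_measurable. integral\<^sup>L \<nu>' f = (\<Sum>\<mu>\<in>T. a \<mu> * integral\<^sup>L \<mu> f)"
    using convex_combination_measure[OF T(1) pr a0 T(4)] .
  have eq: "\<nu> = \<nu>'" by (rule measure_eqI) (use st \<nu>' T(5) in auto)
  show "\<nu> \<in> invariant_measures p"
    unfolding eq
  proof (rule invariant_of_holder[OF \<nu>'(1,2)])
    fix B C f assume f: "HB B C f"
    have c: "f \<in> bounded_measurable" "P f \<in> bounded_measurable"
      using cont_bounded_measurable HB_cont[OF f] P_cont by blast+
    have "(\<Sum>\<mu>\<in>T. a \<mu> * integral\<^sup>L \<mu> (P f)) = (\<Sum>\<mu>\<in>T. a \<mu> * integral\<^sup>L \<mu> f)"
      by (rule sum.cong) (use invariantD(4)[OF inv HB_cont[OF f], of _ 1] in auto)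
    then show "(LINT x|\<nu>'. P f x) = (LINT x|\<nu>'. f x)" using \<nu>'(4) c by simp
  qed
qed

text \<open>Suppose that the chain can move from \<open>x\<close> into an open null set \<open>G\<close>. A bump function \<open>f\<close> supported
  in \<open>G\<close> has integral zero, and by invariance so has \<open>P f\<close>. As \<open>P f\<close> is continuous, nonnegative and
  positive at \<open>x\<close>, the set where it is positive is a null neighbourhood of \<open>x\<close>. Consequently the support
  of an invariant measure is absorbing.\<close>

lemma invariant_null_open_step:
  assumes \<nu>: "\<nu> \<in> invariant_measures p" and G: "open G" "emeasure \<nu> (G \<inter> simplex2) = 0"
    and x: "x \<in> simplex2" "i \<in> {0,1,2}" "0 < p i x" and t: "t \<in> {0..1}"
    and mG: "t *\<^sub>R x + (1 - t) *\<^sub>R vertex i \<in> G"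
  shows "\<exists>W. open W \<and> x \<in> W \<and> emeasure \<nu> (W \<inter> simplex2) = 0"
proof -
  interpret prob_space \<nu> using invariantD(1)[OF \<nu>] .
  let ?z = "t *\<^sub>R x + (1 - t) *\<^sub>R vertex i"
  obtain e where e: "e > 0" "ball ?z e \<subseteq> G" using G(1) mG open_contains_ball by blast
  define f where "f y = max 0 (e - dist ?z y)" for y
  have cf: "continuous_on A f" for A unfolding f_def by (intro continuous_intros)
  have f0: "f y = 0" if "y \<notin> G" for y
  proof -
    have "\<not> dist ?z y < e" using e(2) that by auto
    then show ?thesis by (simp add: f_def)
  qed
  have ae: "AE y in \<nu>. f y = 0"
  proof (rule AE_I[where N = "G \<inter> simplex2"])
    show "G \<inter> simplex2 \<in> sets \<nu>"
      unfolding invariantD(2)[OF \<nu>] by (rule open_simplex_sets[OF G(1)])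
    show "{y \<in> space \<nu>. f y \<noteq> 0} \<subseteq> G \<inter> simplex2" using f0 invariantD(3)[OF \<nu>] by blast
  qed (rule G(2))
  have "(LINT y|\<nu>. P f y) = (LINT y|\<nu>. f y)" using invariantD(4)[OF \<nu> cf, of 1] by simp
  also have "\<dots> = 0" using ae by (simp add: integral_eq_zero_AE)
  finally have I0: "(LINT y|\<nu>. P f y) = 0" .
  have Pc: "continuous_on simplex2 (P f)" by (rule P_cont[OF cf])
  have Pn: "0 \<le> P f y" if "y \<in> simplex2" for y
    using P_mono[OF absorbing_simplex2 continuous_on_const cf _ that, of 0] P_const[OF that, of 0]
    by (simp add: f_def)
  have Pint: "integrable \<nu> (P f)"
    by (rule bounded_measurable_integrable[OF invariantD(1,2)[OF \<nu>] cont_bounded_measurable[OF Pc]])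
  have aeP: "AE y in \<nu>. P f y = 0"
  proof -
    have "AE y in \<nu>. 0 \<le> P f y" using Pn invariantD(3)[OF \<nu>] by (intro AE_I2) simp
    from integral_nonneg_eq_0_iff_AE[OF Pint this] I0 show ?thesis by simp
  qed
  have Px: "P f x \<noteq> 0"
  proof
    assume "P f x = 0"
    then have "f ?z = 0"
      by (intro P_zero_segment[OF absorbing_simplex2 cf _ x(1) _ x(2,3)]) (use t in \<open>auto simp: f_def\<close>)
    then show False using e(1) by (simp add: f_def)
  qed
  have "openin (top_of_set simplex2) (simplex2 \<inter> P f -` (- {0}))"
    by (rule continuous_openin_preimage_gen[OF Pc], rule open_Compl, rule closed_singleton)
  then obtain W where W: "open W" "simplex2 \<inter> P f -` (- {0}) = simplex2 \<inter> W"
    unfolding openin_open by blast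
  have "emeasure \<nu> {y \<in> space \<nu>. \<not> P f y = 0} = 0"
    using aeP Pint by (subst (asm) AE_iff_measurable[OF _ refl]) auto
  also have "{y \<in> space \<nu>. \<not> P f y = 0} = W \<inter> simplex2" using W(2) invariantD(3)[OF \<nu>] by auto
  finally show ?thesis using W x(1) Px by blast
qed

lemma support_absorbing:
  assumes \<nu>: "\<nu> \<in> invariant_measures p" and ne: "measure_support \<nu> \<noteq> {}"
  shows "absorbing p (measure_support \<nu>)"
proof -
  have mem: "x \<in> measure_support \<nu> \<longleftrightarrow> x \<in> simplex2 \<and> \<not> (\<exists>W. open W \<and> x \<in> W \<and> emeasure \<nu> (W \<inter> simplex2) = 0)" for x
    unfolding measure_support_def invariantD(3)[OF \<nu>] by (auto simp: zero_less_iff_neq_zero)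
  show ?thesis
    unfolding absorbing_iff
  proof (intro conjI ballI impI ne)
    show sub: "measure_support \<nu> \<subseteq> simplex2" using mem by blast
    have "measure_support \<nu> = simplex2 - \<Union> {W. open W \<and> emeasure \<nu> (W \<inter> simplex2) = 0}"
      using mem by blast
    then show "compact (measure_support \<nu>)"
      using compact_simplex2 by (auto intro!: compact_diff open_Union)
    fix x i t assume x: "x \<in> measure_support \<nu>" and i: "i \<in> {0,1,2}" "0 < p i x" and t: "t \<in> {0..1::real}"
    have xs: "x \<in> simplex2" using x sub by blast
    show "t *\<^sub>R x + (1 - t) *\<^sub>R vertex i \<in> measure_support \<nu>"
    proof (rule ccontr)
      assume "\<not> ?thesis"
      moreover have "t *\<^sub>R x + (1 - t) *\<^sub>R vertex i \<in> simplex2" using t by (intro move_simplex2[OF xs]) auto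
      ultimately obtain W where W: "open W" "t *\<^sub>R x + (1 - t) *\<^sub>R vertex i \<in> W"
        "emeasure \<nu> (W \<inter> simplex2) = 0" using mem by blast
      show False using invariant_null_open_step[OF \<nu> W(1,3) xs i t W(2)] x mem by blast
    qed
  qed
qed

text \<open>The measure lives on \<open>K\<close>, because the integral of the distance from \<open>K\<close> is the limit value of a
  function vanishing on \<open>K\<close>. The support is nonempty by compactness, hence absorbing, and \<open>K\<close> is
  minimal.\<close>

lemma stat_support:
  assumes K: "K \<in> minimal_absorbing p"
  shows "measure_support (stat K) = K"
proof -
  note inv = stat_invariant[OF K]
  interpret prob_space "stat K" using stat(1)[OF K] .
  have sp: "space (stat K) = simplex2" using invariantD(3)[OF inv] .
  have mem: "x \<in> measure_support (stat K) \<longleftrightarrow> x \<in> simplex2 \<and> \<not> (\<exists>W. open W \<and> x \<in> W \<and> emeasure (stat K) (W \<inter> simplex2) = 0)" for x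
    unfolding measure_support_def sp by (auto simp: zero_less_iff_neq_zero)
  have sub: "measure_support (stat K) \<subseteq> K"
  proof (rule ccontr)
    assume "\<not> ?thesis"
    then obtain x where x: "x \<in> measure_support (stat K)" "x \<notin> K" by blast
    have hb: "HB 2 (2 * 1) (\<lambda>y. infdist y K)"
    proof (rule lipschitz_HB)
      fix x y :: point assume x: "x \<in> simplex2"
      obtain k where k: "k \<in> K" using minimal_absorbingD(4)[OF K] by auto
      have "infdist x K \<le> dist x k" by (rule infdist_le[OF k])
      also have "\<dots> \<le> 2" using dist_simplex2_le[OF x] k minimal_absorbingD(2)[OF K] by blast
      finally show "\<bar>infdist x K\<bar> \<le> 2" using infdist_nonneg[of x K] by simp
      show "\<bar>infdist x K - infdist y K\<bar> \<le> 1 * dist x y" using infdist_triangle_abs by simp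
    qed simp
    have "integral\<^sup>L (stat K) (\<lambda>y. infdist y K) = 0"
      using stat(3)[OF K hb] lim_val_const_on[OF K hb, of 0] by simp
    moreover have int: "integrable (stat K) (\<lambda>y. infdist y K)"
      by (rule bounded_measurable_integrable[OF stat(1,2)[OF K] cont_bounded_measurable[OF HB_cont[OF hb]]])
    ultimately have "AE y in stat K. infdist y K = 0"
      using integral_nonneg_eq_0_iff_AE[OF int] by (simp add: infdist_nonneg)
    then have "emeasure (stat K) {y \<in> space (stat K). \<not> infdist y K = 0} = 0"
      using int by (subst (asm) AE_iff_measurable[OF _ refl]) auto
    moreover have cl: "closed K" using minimal_absorbingD(3)[OF K] compact_imp_closed by blast
    then have "{y \<in> space (stat K). \<not> infdist y K = 0} = - K \<inter> simplex2"
      using in_closed_iff_infdist_zero[OF cl minimal_absorbingD(4)[OF K]] sp by auto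
    ultimately have "emeasure (stat K) (- K \<inter> simplex2) = 0" by simp
    moreover have "open (- K)" using cl by (rule open_Compl)
    ultimately show False using x mem by blast
  qed
  have "measure_support (stat K) \<noteq> {}"
  proof
    assume e: "measure_support (stat K) = {}"
    define \<W> where "\<W> = {W. open W \<and> emeasure (stat K) (W \<inter> simplex2) = 0}"
    have "simplex2 \<subseteq> \<Union>\<W>" using e mem unfolding \<W>_def by blast
    then obtain \<F> where F: "\<F> \<subseteq> \<W>" "finite \<F>" "simplex2 \<subseteq> \<Union>\<F>"
      using compactE[OF compact_simplex2, of \<W>] unfolding \<W>_def by blast
    have Fs: "W \<inter> simplex2 \<in> sets (stat K)" "emeasure (stat K) (W \<inter> simplex2) = 0" if "W \<in> \<F>" for W
      using F(1) that open_simplex_sets unfolding \<W>_def stat(2)[OF K] by blast+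
    have "emeasure (stat K) simplex2 \<le> emeasure (stat K) (\<Union>W\<in>\<F>. W \<inter> simplex2)"
    proof (rule emeasure_mono)
      show "simplex2 \<subseteq> (\<Union>W\<in>\<F>. W \<inter> simplex2)" using F(3) by blast
      show "(\<Union>W\<in>\<F>. W \<inter> simplex2) \<in> sets (stat K)" by (intro sets.finite_UN F(2) Fs(1))
    qed
    also have "\<dots> \<le> (\<Sum>W\<in>\<F>. emeasure (stat K) (W \<inter> simplex2))"
      using Fs(1) by (intro emeasure_subadditive_finite F(2)) blast
    also have "\<dots> = 0" using Fs(2) by (intro sum.neutral ballI)
    finally show False using emeasure_space_1 sp by simp
  qed
  then have "absorbing p (measure_support (stat K))" by (rule support_absorbing[OF inv])
  then show ?thesis using K sub unfolding minimal_absorbing_def by blast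
qed

section \<open>The geometric rate for complex functions\<close>

lemma trans_op_cong:
  assumes "\<And>y. y \<in> simplex2 \<Longrightarrow> f y = g y" and x: "x \<in> simplex2"
  shows "trans_op p f x = trans_op p g x"
proof -
  have "(LINT t:{0..1}|lborel. f (t *\<^sub>R x + (1 - t) *\<^sub>R vertex i))
      = (LINT t:{0..1}|lborel. g (t *\<^sub>R x + (1 - t) *\<^sub>R vertex i))" for i
    using assms(1) move_simplex2[OF x] by (intro set_lebesgue_integral_cong) auto
  then show ?thesis unfolding trans_op_def by simp
qed

lemma trans_op_complex:
  fixes \<phi> :: "point \<Rightarrow> complex"
  assumes c: "continuous_on simplex2 \<phi>" and x: "x \<in> simplex2"
  shows "trans_op p \<phi> x = Complex (P (\<lambda>y. Re (\<phi> y)) x) (P (\<lambda>y. Im (\<phi> y)) x)"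
proof -
  have "Re (LINT t:{0..1}|lborel. \<phi> (t *\<^sub>R x + (1 - t) *\<^sub>R vertex i))
      = (LINT t:{0..1}|lborel. Re (\<phi> (t *\<^sub>R x + (1 - t) *\<^sub>R vertex i)))"
    "Im (LINT t:{0..1}|lborel. \<phi> (t *\<^sub>R x + (1 - t) *\<^sub>R vertex i))
      = (LINT t:{0..1}|lborel. Im (\<phi> (t *\<^sub>R x + (1 - t) *\<^sub>R vertex i)))" for i
    using set_integrable_move[OF c x, of i]
    unfolding set_integrable_def set_lebesgue_integral_def
    by (simp_all flip: integral_Re integral_Im)
  then show ?thesis unfolding trans_op_def by (simp add: complex_eq_iff)
qed

lemma trans_op_complex_funpow:
  fixes \<phi> :: "point \<Rightarrow> complex"
  assumes c: "continuous_on simplex2 \<phi>" and x: "x \<in> simplex2"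
  shows "(trans_op p ^^ n) \<phi> x = Complex ((P ^^ n) (\<lambda>y. Re (\<phi> y)) x) ((P ^^ n) (\<lambda>y. Im (\<phi> y)) x)"
  using x
proof (induction n arbitrary: x)
  case (Suc n)
  have cri: "continuous_on simplex2 (\<lambda>y. Re (\<phi> y))" "continuous_on simplex2 (\<lambda>y. Im (\<phi> y))"
    by (intro continuous_intros c)+
  define \<psi> where "\<psi> y = Complex ((P ^^ n) (\<lambda>y. Re (\<phi> y)) y) ((P ^^ n) (\<lambda>y. Im (\<phi> y)) y)" for y
  have c\<psi>: "continuous_on simplex2 \<psi>"
    unfolding \<psi>_def using Pn_cont[OF cri(1)] Pn_cont[OF cri(2)]
    by (simp add: Complex_eq continuous_on_add continuous_on_mult_left)
  have "trans_op p ((trans_op p ^^ n) \<phi>) x = trans_op p \<psi> x"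
    by (rule trans_op_cong) (simp_all add: Suc \<psi>_def del: split_paired_All)
  also have "\<dots> = Complex (P (\<lambda>y. Re (\<psi> y)) x) (P (\<lambda>y. Im (\<psi> y)) x)"
    by (rule trans_op_complex[OF c\<psi> Suc.prems])
  finally show ?case by (simp add: \<psi>_def)
qed simp

text \<open>The sup norm \<open>A1\<close> and the Hoelder seminorm \<open>A2\<close>: they bound the real and the imaginary part, to
  which the real-valued theory applies.\<close>

lemma complex_holder_bound:
  assumes \<phi>: "\<phi> \<in> holder_space \<alpha>"
  obtains A1 A2 where "HB A1 A2 (\<lambda>x. Re (\<phi> x))" "HB A1 A2 (\<lambda>x. Im (\<phi> x))" "A1 + A2 = holder_norm \<alpha> \<phi>"
    "continuous_on simplex2 \<phi>"
proof -
  obtain C where C: "\<forall>x\<in>simplex2. \<forall>y\<in>simplex2. cmod (\<phi> x - \<phi> y) \<le> C * dist x y powr \<alpha>"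
    using \<phi> by (auto simp: holder_space_def)
  have c: "continuous_on simplex2 \<phi>"
    by (rule holder_continuous[OF alpha(1)]) (use C in \<open>auto simp: dist_norm\<close>)
  define A1 where "A1 = (SUP x\<in>simplex2. cmod (\<phi> x))"
  let ?S = "{(x, y). x \<in> simplex2 \<and> y \<in> simplex2 \<and> x \<noteq> y}"
  let ?q = "\<lambda>(x, y). cmod (\<phi> x - \<phi> y) / dist x y powr \<alpha>"
  define A2 where "A2 = (SUP z\<in>?S. ?q z)"
  have "bdd_above ((\<lambda>x. cmod (\<phi> x)) ` simplex2)"
    by (intro bounded_imp_bdd_above compact_imp_bounded compact_continuous_image compact_simplex2
        continuous_on_norm c)
  then have b1: "cmod (\<phi> x) \<le> A1" if "x \<in> simplex2" for x unfolding A1_def by (rule cSUP_upper[OF that])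
  have "bdd_above (?q ` ?S)"
  proof (rule bdd_aboveI2)
    fix z assume "z \<in> ?S"
    then obtain x y where z: "z = (x, y)" "x \<in> simplex2" "y \<in> simplex2" "x \<noteq> y" by auto
    then have "dist x y powr \<alpha> > 0" by simp
    moreover have "cmod (\<phi> x - \<phi> y) \<le> C * dist x y powr \<alpha>" using C z by blast
    ultimately show "?q z \<le> C" unfolding z(1) by (simp add: pos_divide_le_eq)
  qed
  then have q: "?q z \<le> A2" if "z \<in> ?S" for z unfolding A2_def by (rule cSUP_upper[OF that])
  have b2: "cmod (\<phi> x - \<phi> y) \<le> A2 * dist x y powr \<alpha>" if "x \<in> simplex2" "y \<in> simplex2" for x y
  proof (cases "x = y")
    case False
    then have "cmod (\<phi> x - \<phi> y) / dist x y powr \<alpha> \<le> A2" using q[of "(x, y)"] that by simp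
    moreover have "dist x y powr \<alpha> > 0" using False by simp
    ultimately show ?thesis by (simp add: pos_divide_le_eq)
  qed simp
  show thesis
  proof (rule that[OF _ _ _ c])
    show "HB A1 A2 (\<lambda>x. Re (\<phi> x))"
      unfolding holder_bd_def using b1 b2 abs_Re_le_cmod order_trans by (metis minus_complex.sel(1))
    show "HB A1 A2 (\<lambda>x. Im (\<phi> x))"
      unfolding holder_bd_def using b1 b2 abs_Im_le_cmod order_trans by (metis minus_complex.sel(2))
    show "A1 + A2 = holder_norm \<alpha> \<phi>" by (simp add: A1_def A2_def holder_norm_def)
  qed
qed

lemma stat_integral_complex:
  assumes K: "K \<in> minimal_absorbing p" and c: "continuous_on simplex2 \<phi>"
  shows "(LINT y|stat K. \<phi> y) = Complex (LINT y|stat K. Re (\<phi> y)) (LINT y|stat K. Im (\<phi> y))"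
proof -
  interpret prob_space "stat K" using stat(1)[OF K] .
  obtain B where "\<forall>x\<in>simplex2. norm (\<phi> x) \<le> B"
    using compact_imp_bounded[OF compact_continuous_image[OF c compact_simplex2]]
    by (auto simp: bounded_iff)
  then have "integrable (stat K) \<phi>"
    using cont_measurable_simplex2[OF c] stat(2)[OF K] simplex_measure_space[OF stat(2)[OF K]]
    by (intro integrable_const_bound[of _ B]) (auto cong: measurable_cong_sets)
  then show ?thesis by (simp add: complex_eq_iff)
qed

text \<open>The limit and its rate are known for the real and the imaginary part; the integrals are the values
  \<open>lim_val K\<close> of these parts.\<close>

theorem geometric_rate_stat:
  "geometric_rate \<alpha> p (\<lambda>\<phi> x. \<Sum>K\<in>minimal_absorbing p. complex_of_real (hit K x) * (LINT y|stat K. \<phi> y))"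
proof -
  obtain \<kappa> \<rho> where k: "\<kappa> > 0" "0 \<le> \<rho>" "\<rho> < 1"
    "\<forall>B C f n. HB B C f \<longrightarrow>
       (\<forall>x\<in>simplex2. \<bar>(P ^^ n) f x - orbit_lim f x\<bar> \<le> \<kappa> * \<rho> ^ n * (B + C))"
    by (rule orbit_lim_rate)
  show ?thesis
    unfolding geometric_rate_def
  proof (intro exI[of _ "2 * \<kappa>"] conjI bexI[of _ \<rho>] ballI allI)
    fix \<phi> x n assume \<phi>: "\<phi> \<in> holder_space \<alpha>" and x: "x \<in> simplex2"
    obtain A1 A2 where A: "HB A1 A2 (\<lambda>x. Re (\<phi> x))" "HB A1 A2 (\<lambda>x. Im (\<phi> x))"
      "A1 + A2 = holder_norm \<alpha> \<phi>" "continuous_on simplex2 \<phi>" using complex_holder_bound[OF \<phi>] .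
    let ?L = "\<Sum>K\<in>minimal_absorbing p. complex_of_real (hit K x) * (LINT y|stat K. \<phi> y)"
    have "Re ?L = (\<Sum>K\<in>minimal_absorbing p. lim_val K (\<lambda>x. Re (\<phi> x)) * hit K x)"
      unfolding Re_sum
      by (rule sum.cong) (simp_all add: stat_integral_complex[OF _ A(4)] stat(3)[OF _ A(1)])
    then have re: "Re ?L = orbit_lim (\<lambda>x. Re (\<phi> x)) x" using orbit_lim_eq[OF A(1) x] by simp
    have "Im ?L = (\<Sum>K\<in>minimal_absorbing p. lim_val K (\<lambda>x. Im (\<phi> x)) * hit K x)"
      unfolding Im_sum
      by (rule sum.cong) (simp_all add: stat_integral_complex[OF _ A(4)] stat(3)[OF _ A(2)])
    then have im: "Im ?L = orbit_lim (\<lambda>x. Im (\<phi> x)) x" using orbit_lim_eq[OF A(2) x] by simp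
    have "cmod ((trans_op p ^^ n) \<phi> x - ?L)
        \<le> \<bar>Re ((trans_op p ^^ n) \<phi> x - ?L)\<bar> + \<bar>Im ((trans_op p ^^ n) \<phi> x - ?L)\<bar>" by (rule cmod_le)
    also have "\<dots> = \<bar>(P ^^ n) (\<lambda>y. Re (\<phi> y)) x - orbit_lim (\<lambda>x. Re (\<phi> x)) x\<bar>
        + \<bar>(P ^^ n) (\<lambda>y. Im (\<phi> y)) x - orbit_lim (\<lambda>x. Im (\<phi> x)) x\<bar>"
      unfolding minus_complex.sel re im trans_op_complex_funpow[OF A(4) x] by simp
    also have "\<dots> \<le> \<kappa> * \<rho> ^ n * (A1 + A2) + \<kappa> * \<rho> ^ n * (A1 + A2)"
      using k(4) A(1,2) x by (intro add_mono) blast+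
    finally show "cmod ((trans_op p ^^ n) \<phi> x - ?L) \<le> 2 * \<kappa> * \<rho> ^ n * holder_norm \<alpha> \<phi>"
      unfolding A(3) by (simp add: mult_ac)
  qed (use k in auto)
qed

end

section \<open>The stationary density on an edge\<close>

lemma isCont_interior:
  fixes h :: "real \<Rightarrow> real"
  assumes "continuous_on {0..1} h" "0 < t" "t < 1"
  shows "isCont h t"
proof -
  have "continuous_on {0<..<1} h" using assms(1) by (rule continuous_on_subset) auto
  then show ?thesis using assms by (simp add: continuous_on_eq_continuous_at)
qed

lemma interval_deriv:
  fixes h :: "real \<Rightarrow> real"
  assumes h: "continuous_on {0<..<1} h" and s: "0 < s" "s < 1" and t: "0 < t" "t < 1"
  shows "((\<lambda>t. LBINT u=ereal s..ereal t. h u) has_real_derivative h t) (at t)"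
proof -
  define l where "l = min s t / 2"
  define r where "r = (1 + max s t) / 2"
  have lr: "0 < l" "l < s" "l < t" "s < r" "t < r" "r < 1"
    using s t by (auto simp: l_def r_def)
  have "continuous_on {l..r} h" using h by (rule continuous_on_subset) (use lr in auto)
  then have "((\<lambda>t. LBINT u=ereal s..ereal t. h u) has_vector_derivative h t) (at t within {l..r})"
    by (intro interval_integral_FTC2) (use lr in auto)
  moreover have "at t within {l..r} = at t" by (rule at_within_interior) (use lr in \<open>simp add: interior_atLeastAtMost_real\<close>)
  ultimately show ?thesis by (simp add: has_real_derivative_iff_has_vector_derivative)
qed

text \<open>On an edge the chain lives on \<open>[0, 1]\<close>: from \<open>t\<close> it moves to a uniform point of \<open>[t, 1]\<close> with
  probability \<open>a t\<close> and of \<open>[0, t]\<close> with probability \<open>b t\<close>. The density \<open>g\<close> solves a linear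
  differential equation, which says that \<open>t * g t\<close> has derivative \<open>g t * a t / (1 - t)\<close> and
  \<open>(1 - t) * g t\<close> has derivative \<open>- g t * b t / t\<close>. The conditions \<open>0 < a 0\<close> and \<open>0 < b 1\<close> say that the
  chain does not stick to the end points; they make \<open>g\<close> integrable.\<close>

locale edge_ode =
  fixes a b g :: "real \<Rightarrow> real"
  assumes cont: "continuous_on {0..1} a" "continuous_on {0..1} b"
    and nonneg: "\<And>t. 0 \<le> t \<Longrightarrow> t \<le> 1 \<Longrightarrow> 0 \<le> a t" "\<And>t. 0 \<le> t \<Longrightarrow> t \<le> 1 \<Longrightarrow> 0 \<le> b t"
    and sum_one: "\<And>t. 0 \<le> t \<Longrightarrow> t \<le> 1 \<Longrightarrow> a t + b t = 1"
    and ends: "0 < a 0" "0 < b 1"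
    and pos: "\<And>t. 0 < t \<Longrightarrow> t < 1 \<Longrightarrow> 0 < g t"
    and deriv: "\<And>t. 0 < t \<Longrightarrow> t < 1 \<Longrightarrow> (g has_real_derivative g t * (a t / (1 - t) - b t / t)) (at t)"
begin

lemma g_cont: "0 < t \<Longrightarrow> t < 1 \<Longrightarrow> isCont g t"
  using deriv DERIV_isCont by blast

text \<open>Near the left end \<open>a\<close> stays above some \<open>\<eta> > 0\<close>, so \<open>g t * t powr (1 - \<eta>)\<close> increases and hence
  stays bounded as \<open>t\<close> tends to 0. Thus \<open>t * g t\<close> tends to 0, and its derivative
  \<open>g t * a t / (1 - t)\<close>, which is at least \<open>\<eta> * g t\<close>, is integrable.\<close>

lemma left_end:
  shows "((\<lambda>t. t * g t) \<longlongrightarrow> 0) (at_right 0)"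
    and "\<exists>r. 0 < r \<and> r < 1 \<and> set_integrable lborel {0<..<r} g"
proof -
  define \<eta> where "\<eta> = a 0 / 2"
  have \<eta>: "0 < \<eta>" "\<eta> < 1" "\<eta> < a 0"
    using ends(1) sum_one[of 0] nonneg(2)[of 0] by (auto simp: \<eta>_def)
  have "\<exists>d>0. \<forall>t\<in>{0..1}. dist t 0 < d \<longrightarrow> dist (a t) (a 0) < a 0 - \<eta>"
    using cont(1) \<eta>(3) unfolding continuous_on_iff by (metis atLeastAtMost_iff diff_gt_0_iff_gt order_refl zero_le_one)
  then obtain d where d: "d > 0" "\<And>t. t \<in> {0..1} \<Longrightarrow> dist t 0 < d \<Longrightarrow> dist (a t) (a 0) < a 0 - \<eta>" by blast
  define r where "r = min (d / 2) (1 / 2)"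
  have r: "0 < r" "r < 1" "r < d" using d(1) by (auto simp: r_def)
  have a\<eta>: "\<eta> \<le> a t" if "0 \<le> t" "t \<le> r" for t
  proof -
    have "dist (a t) (a 0) < a 0 - \<eta>" using that r by (intro d(2)) auto
    then show ?thesis by (simp add: dist_real_def)
  qed
  define G where "G t = g t * t powr (1 - \<eta>)" for t
  have G: "G t \<le> G r" if t: "0 < t" "t \<le> r" for t
  proof (rule DERIV_nonneg_imp_nondecreasing[OF t(2)])
    fix x assume x: "t \<le> x" "x \<le> r"
    have x01: "0 < x" "x < 1" using x t r by auto
    let ?y = "g x * (a x / (1 - x) - b x / x) * x powr (1 - \<eta>) + g x * ((1 - \<eta>) * x powr (1 - \<eta> - 1))"
    have "DERIV G x :> ?y"
      unfolding G_def using DERIV_mult[OF deriv[OF x01] has_real_derivative_powr[OF x01(1), of "1 - \<eta>"]]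
      by (simp add: add.commute mult.commute)
    moreover have "0 \<le> ?y"
    proof -
      have pw: "x powr (1 - \<eta>) = x * x powr (1 - \<eta> - 1)"
        using x01 powr_add[of x 1 "1 - \<eta> - 1"] by simp
      have "?y = g x * x powr (1 - \<eta> - 1) * (x * a x / (1 - x) - b x + (1 - \<eta>))"
        unfolding pw using x01 by (simp add: field_simps)
      also have "- b x + (1 - \<eta>) = a x - \<eta>" using sum_one[of x] x01 by simp
      then have "x * a x / (1 - x) - b x + (1 - \<eta>) = x * a x / (1 - x) + (a x - \<eta>)" by linarith
      finally have "?y = g x * x powr (1 - \<eta> - 1) * (x * a x / (1 - x) + (a x - \<eta>))" .
      moreover have "0 \<le> x * a x / (1 - x) + (a x - \<eta>)"
        using a\<eta>[of x] x x01 nonneg(1)[of x] by (intro add_nonneg_nonneg divide_nonneg_nonneg mult_nonneg_nonneg) auto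
      ultimately show ?thesis using pos[OF x01] by (simp add: mult_nonneg_nonneg)
    qed
    ultimately show "\<exists>y. DERIV G x :> y \<and> 0 \<le> y" by blast
  qed
  have bound: "t * g t \<le> G r * t powr \<eta>" if t: "0 < t" "t \<le> r" for t
  proof -
    have "t * g t = G t * t powr \<eta>"
      using t powr_add[of t "1 - \<eta>" \<eta>] by (simp add: G_def mult_ac)
    also have "\<dots> \<le> G r * t powr \<eta>" by (intro mult_right_mono G t) simp
    finally show ?thesis .
  qed
  have ev: "\<forall>\<^sub>F t in at_right (0::real). 0 < t \<and> t < r"
    using r(1) by (auto simp: eventually_at_right_field)
  show lim: "((\<lambda>t. t * g t) \<longlongrightarrow> 0) (at_right 0)"
  proof (rule tendsto_sandwich[of "\<lambda>_. 0" _ _ "\<lambda>t. G r * t powr \<eta>"])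
    have "((\<lambda>t. G r * t powr \<eta>) \<longlongrightarrow> G r * 0 powr \<eta>) (at_right 0)"
      using \<eta> ev by (intro tendsto_intros tendsto_powr') (auto elim: eventually_mono)
    then show "((\<lambda>t. G r * t powr \<eta>) \<longlongrightarrow> 0) (at_right 0)" by simp
    show "\<forall>\<^sub>F t in at_right 0. t * g t \<le> G r * t powr \<eta>"
      using ev by eventually_elim (use bound in auto)
    show "\<forall>\<^sub>F t in at_right 0. 0 \<le> t * g t"
      using ev by eventually_elim (use pos r in \<open>auto simp: less_imp_le\<close>)
  qed simp
  have "set_integrable lborel (einterval (ereal 0) (ereal r)) (\<lambda>t. g t * (a t / (1 - t)))"
  proof (rule interval_integral_FTC_nonneg)
    fix x :: real assume "ereal 0 < ereal x" "ereal x < ereal r"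
    then have x: "0 < x" "x < 1" using r by auto
    have "DERIV (\<lambda>t. t * g t) x :> 1 * g x + g x * (a x / (1 - x) - b x / x) * x"
      by (rule DERIV_mult[OF DERIV_ident deriv[OF x]])
    also have "1 * g x + g x * (a x / (1 - x) - b x / x) * x = g x * (a x / (1 - x))"
    proof -
      define A where "A = a x / (1 - x)"
      have "1 - b x = A * (1 - x)" using sum_one[of x] x by (simp add: A_def)
      then have b: "b x = 1 - A * (1 - x)" by simp
      have "1 * g x + g x * (A - b x / x) * x = g x + g x * (A * x) - g x * (b x / x * x)"
        by (simp add: algebra_simps)
      also have "b x / x * x = 1 - A * (1 - x)" using x b by simp
      finally show ?thesis unfolding A_def[symmetric] by (simp add: right_diff_distrib mult.commute)
    qed
    finally show "DERIV (\<lambda>t. t * g t) x :> g x * (a x / (1 - x))" .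
    show "isCont (\<lambda>t. g t * (a t / (1 - t))) x"
      using x g_cont isCont_interior[OF cont(1)] by (intro continuous_intros) auto
  next
    show "AE x in lborel. ereal 0 < ereal x \<longrightarrow> ereal x < ereal r \<longrightarrow> 0 \<le> g x * (a x / (1 - x))"
      using pos nonneg r by (intro AE_I2) (auto intro!: mult_nonneg_nonneg less_imp_le[OF pos] divide_nonneg_nonneg)
    show "(((\<lambda>t. t * g t) \<circ> real_of_ereal) \<longlongrightarrow> 0) (at_right (ereal 0))"
      using lim by (simp add: ereal_tendsto_simps1)
    have "((\<lambda>t. t * g t) \<longlongrightarrow> r * g r) (at_left r)"
      using g_cont[OF r(1,2)] unfolding isCont_def
      by (intro tendsto_intros) (auto intro: tendsto_within_subset)
    then show "(((\<lambda>t. t * g t) \<circ> real_of_ereal) \<longlongrightarrow> r * g r) (at_left (ereal r))"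
      by (simp add: ereal_tendsto_simps1)
  qed (use r in auto)
  then have "set_integrable lborel {0<..<r} (\<lambda>t. (1 / \<eta>) * (g t * (a t / (1 - t))))"
    by (simp del: times_divide_eq_left times_divide_eq_right)
  then have "set_integrable lborel {0<..<r} g"
  proof (rule set_integrable_bound)
    have "continuous_on {0<..<r} g"
      using g_cont r by (intro continuous_at_imp_continuous_on) auto
    from set_measurable_continuous_on[OF _ this]
    show "set_borel_measurable lborel {0<..<r} g" by (simp add: set_borel_measurable_def)
    show "AE x in lborel. x \<in> {0<..<r} \<longrightarrow> norm (g x) \<le> norm ((1 / \<eta>) * (g x * (a x / (1 - x))))"
    proof (intro AE_I2 impI)
      fix x assume "x \<in> {0<..<r}"
      then have x: "0 < x" "x < r" "x < 1" using r by auto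
      have "a x \<le> a x / (1 - x)" using x nonneg(1)[of x] by (simp add: field_simps mult_left_le)
      then have "\<eta> \<le> a x / (1 - x)" using a\<eta>[of x] x by linarith
      then have "\<eta> * g x \<le> g x * (a x / (1 - x))"
        using pos[of x] x by (subst mult.commute) (intro mult_left_mono, auto)
      then have "(1 / \<eta>) * (\<eta> * g x) \<le> (1 / \<eta>) * (g x * (a x / (1 - x)))"
        using \<eta>(1) by (intro mult_left_mono) auto
      moreover have "(1 / \<eta>) * (\<eta> * g x) = g x" using \<eta>(1) by simp
      ultimately have "g x \<le> (1 / \<eta>) * (g x * (a x / (1 - x)))" by linarith
      then show "norm (g x) \<le> norm ((1 / \<eta>) * (g x * (a x / (1 - x))))"
        using pos[of x] x abs_ge_self[of "(1 / \<eta>) * (g x * (a x / (1 - x)))"]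
        unfolding real_norm_def by linarith
    qed
  qed
  then show "\<exists>r. 0 < r \<and> r < 1 \<and> set_integrable lborel {0<..<r} g" using r by blast
qed

text \<open>The substitution of \<open>1 - t\<close> for \<open>t\<close> exchanges the roles of the two end points, so results at the
  left end hold at the right one.\<close>

lemma reflected: "edge_ode (\<lambda>t. b (1 - t)) (\<lambda>t. a (1 - t)) (\<lambda>t. g (1 - t))"
proof
  show "continuous_on {0..1} (\<lambda>t. b (1 - t))" "continuous_on {0..1} (\<lambda>t. a (1 - t))"
    by (rule continuous_on_compose2[OF cont(2)], auto intro!: continuous_intros)
       (rule continuous_on_compose2[OF cont(1)], auto intro!: continuous_intros)
  fix t :: real assume t: "0 < t" "t < 1"
  have t': "0 < 1 - t" "1 - t < 1" using t by auto
  have "((\<lambda>t. g (1 - t)) has_real_derivative (g (1 - t) * (a (1 - t) / (1 - (1 - t)) - b (1 - t) / (1 - t))) * (- 1)) (at t)"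
    by (rule DERIV_chain2[where f = g and g = "\<lambda>t. 1 - t", OF deriv[OF t']])
       (auto intro!: derivative_eq_intros)
  then show "((\<lambda>t. g (1 - t)) has_real_derivative g (1 - t) * (b (1 - t) / (1 - t) - a (1 - t) / t)) (at t)"
    by (simp add: algebra_simps)
qed (use nonneg sum_one ends pos in \<open>auto simp: add.commute\<close>)

lemma right_end: "((\<lambda>t. (1 - t) * g t) \<longlongrightarrow> 0) (at_left 1)"
proof -
  interpret R: edge_ode "\<lambda>t. b (1 - t)" "\<lambda>t. a (1 - t)" "\<lambda>t. g (1 - t)" by (rule reflected)
  have "filterlim (\<lambda>t. 1 - t) (at_right (0::real)) (at_left 1)"
    unfolding filterlim_at
  proof
    show "\<forall>\<^sub>F t in at_left (1::real). 1 - t \<in> {0<..} \<and> 1 - t \<noteq> 0"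
      by (auto simp: eventually_at_filter)
    have "((\<lambda>t. 1 - t) \<longlongrightarrow> 1 - 1) (at_left (1::real))" by (intro tendsto_intros)
    then show "((\<lambda>t. 1 - t) \<longlongrightarrow> 0) (at_left (1::real))" by simp
  qed
  from filterlim_compose[OF R.left_end(1) this] show ?thesis by simp
qed

lemma g_integrable: "set_integrable lborel {0<..<1} g"
proof -
  interpret R: edge_ode "\<lambda>t. b (1 - t)" "\<lambda>t. a (1 - t)" "\<lambda>t. g (1 - t)" by (rule reflected)
  obtain r where r: "0 < r" "r < 1" "set_integrable lborel {0<..<r} g" using left_end(2) by blast
  obtain q where q: "0 < q" "q < 1" "set_integrable lborel {0<..<q} (\<lambda>t. g (1 - t))" using R.left_end(2) by blast
  have "integrable lborel (\<lambda>x. indicator {0<..<q} (1 + (- 1) * x) *\<^sub>R g (1 - (1 + (- 1) * x)))"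
    using lborel_integrable_real_affine[OF q(3)[unfolded set_integrable_def], of "- 1" 1] by simp
  also have "(\<lambda>x. indicator {0<..<q} (1 + (- 1) * x) *\<^sub>R g (1 - (1 + (- 1) * x)))
      = (\<lambda>x. indicator {1 - q<..<1} x *\<^sub>R g x)"
    by (auto simp: fun_eq_iff indicator_def)
  finally have right: "set_integrable lborel {1 - q<..<1} g" by (simp add: set_integrable_def)
  have mid: "set_integrable lborel {r / 2..1 - q / 2} g"
  proof (rule borel_integrable_atLeastAtMost')
    show "continuous_on {r / 2..1 - q / 2} g"
      using r q by (intro continuous_at_imp_continuous_on ballI g_cont) auto
  qed
  \<comment> \<open>near the ends the integrability is known, and in between \<open>g\<close> is continuous\<close>
  have "{0<..<1} = ({0<..<r} \<union> {r / 2..1 - q / 2}) \<union> {1 - q<..<1}" using r q by auto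
  then show ?thesis
    using set_integrable_Un[OF set_integrable_Un[OF r(3) mid] right] by simp
qed

text \<open>Stationarity: with \<open>F\<close> an antiderivative of \<open>f\<close>, the difference of the two integrands is the
  derivative of \<open>g t * (t * F 1 - F t)\<close>, which vanishes at both ends.\<close>

lemma stationary:
  assumes f: "continuous_on {0..1} f" and F0: "F 0 = 0"
    and F: "\<And>t. 0 \<le> t \<Longrightarrow> t \<le> 1 \<Longrightarrow> (F has_real_derivative f t) (at t within {0..1})"
  shows "(LINT t:{0<..<1}|lborel. g t * (a t / (1 - t) * (F 1 - F t) + b t / t * F t))
       = (LINT t:{0<..<1}|lborel. g t * f t)"
proof -
  define Q where "Q t = a t / (1 - t) * (F 1 - F t) + b t / t * F t" for t
  define H where "H t = g t * (t * F 1 - F t)" for t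
  obtain m where "\<forall>t\<in>{0..1}. \<bar>f t\<bar> \<le> m"
    using compact_imp_bounded[OF compact_continuous_image[OF f compact_Icc]]
    by (auto simp: bounded_iff)
  then have m: "\<bar>f t\<bar> \<le> m" if "t \<in> {0..1}" for t using that by blast
  have m0: "0 \<le> m" using m[of 0] by simp
  have lip: "\<bar>F t - F s\<bar> \<le> m * \<bar>t - s\<bar>" if "t \<in> {0..1}" "s \<in> {0..1}" for s t
    using field_differentiable_bound[of "{0..1}" F f m t s] F m that by auto
  have F1: "\<bar>F 1 - F t\<bar> \<le> m * (1 - t)" and F2: "\<bar>F t\<bar> \<le> m * t" if "t \<in> {0..1}" for t
    using lip[of 1 t] lip[of t 0] that F0 by auto
  have contF: "continuous_on {0..1} F"
    using F by (intro DERIV_continuous_on) auto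
  have contQ: "isCont Q t" if "0 < t" "t < 1" for t
    unfolding Q_def using that isCont_interior[OF contF] isCont_interior[OF cont(1)] isCont_interior[OF cont(2)]
    by (intro continuous_intros) auto
  have Fd: "(F has_real_derivative f t) (at t)" if t: "0 < t" "t < 1" for t
  proof -
    have "at t within {0..1} = at t" by (rule at_within_interior) (use t in \<open>simp add: interior_atLeastAtMost_real\<close>)
    then show ?thesis using F[of t] t by simp
  qed
  have Hd: "(H has_real_derivative g t * Q t - g t * f t) (at t)" if t: "0 < t" "t < 1" for t
  proof -
    have "(H has_real_derivative g t * (a t / (1 - t) - b t / t) * (t * F 1 - F t) + (1 * F 1 - f t) * g t) (at t)"
      unfolding H_def by (rule DERIV_mult[OF deriv[OF t] DERIV_diff[OF _ Fd[OF t]]])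
        (auto intro!: derivative_eq_intros)
    also have "g t * (a t / (1 - t) - b t / t) * (t * F 1 - F t) + (1 * F 1 - f t) * g t
        = g t * ((a t / (1 - t) - b t / t) * (t * F 1 - F t) + (a t + b t) * F 1) - g t * f t"
    proof -
      have "g0 * w * z + (1 * y - f0) * g0 = g0 * (w * z + 1 * y) - g0 * f0" for g0 w z y f0 :: real
        by (simp add: algebra_simps)
      moreover have "a t + b t = 1" using sum_one[of t] t by simp
      ultimately show ?thesis by metis
    qed
    also have "(a t / (1 - t) - b t / t) * (t * F 1 - F t) + (a t + b t) * F 1 = Q t"
    proof -
      have "(A - B) * (t * y - z) + (A * ((1 - t) * y) + B * (t * y)) = A * (y - z) + B * z" for A B y z :: real
        by (simp add: algebra_simps)
      moreover have "(a t + b t) * F 1 = a t / (1 - t) * ((1 - t) * F 1) + b t / t * (t * F 1)"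
        using t by (simp add: distrib_right)
      ultimately show ?thesis unfolding Q_def by (simp only:)
    qed
    finally show ?thesis .
  qed
  have Qb: "\<bar>Q t\<bar> \<le> m" if t: "0 < t" "t < 1" for t
  proof -
    have "\<bar>Q t\<bar> \<le> a t / (1 - t) * \<bar>F 1 - F t\<bar> + b t / t * \<bar>F t\<bar>"
      unfolding Q_def using nonneg[of t] t by (intro order_trans[OF abs_triangle_ineq]) (simp add: abs_mult)
    also have "\<dots> \<le> a t / (1 - t) * (m * (1 - t)) + b t / t * (m * t)"
      using nonneg[of t] t F1[of t] F2[of t] by (intro add_mono mult_left_mono) auto
    also have "\<dots> = (a t + b t) * m" using t by (simp add: distrib_right)
    finally show ?thesis using sum_one[of t] t by simp
  qed
  have int: "set_integrable lborel {0<..<1} (\<lambda>t. g t * h t)"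
    if c: "\<And>t. 0 < t \<Longrightarrow> t < 1 \<Longrightarrow> isCont h t" and h: "\<And>t. 0 < t \<Longrightarrow> t < 1 \<Longrightarrow> \<bar>h t\<bar> \<le> m" for h
  proof (rule set_integrable_bound[where f = "\<lambda>t. m * g t"])
    show "set_integrable lborel {0<..<1} (\<lambda>t. m * g t)" using g_integrable by simp
    have "continuous_on {0<..<1} (\<lambda>t. g t * h t)"
      using g_cont c by (intro continuous_at_imp_continuous_on ballI continuous_intros) auto
    from set_measurable_continuous_on[OF _ this]
    show "set_borel_measurable lborel {0<..<1} (\<lambda>t. g t * h t)" by (simp add: set_borel_measurable_def)
    show "AE x in lborel. x \<in> {0<..<1} \<longrightarrow> norm (g x * h x) \<le> norm (m * g x)"
    proof (intro AE_I2 impI)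
      fix x :: real assume "x \<in> {0<..<1}"
      then have "\<bar>h x\<bar> * \<bar>g x\<bar> \<le> m * \<bar>g x\<bar>" using h by (intro mult_right_mono) auto
      then show "norm (g x * h x) \<le> norm (m * g x)" using m0 by (simp add: abs_mult mult.commute)
    qed
  qed
  have iQ: "set_integrable lborel {0<..<1} (\<lambda>t. g t * Q t)" using int[OF contQ Qb] .
  have i_f: "set_integrable lborel {0<..<1} (\<lambda>t. g t * f t)"
    using int[OF isCont_interior[OF f]] m by auto
  have small: "\<bar>H t\<bar> \<le> (\<bar>F 1\<bar> + m) * (t * g t)" "\<bar>H t\<bar> \<le> (\<bar>F 1\<bar> + m) * ((1 - t) * g t)"
    if t: "0 < t" "t < 1" for t
  proof -
    have "\<bar>t * F 1 - F t\<bar> \<le> t * \<bar>F 1\<bar> + m * t"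
      using F2[of t] t by (intro order_trans[OF abs_triangle_ineq4]) (auto simp: abs_mult)
    then have "g t * \<bar>t * F 1 - F t\<bar> \<le> g t * (t * \<bar>F 1\<bar> + m * t)"
      using pos[OF t] by (intro mult_left_mono) auto
    then show "\<bar>H t\<bar> \<le> (\<bar>F 1\<bar> + m) * (t * g t)"
      unfolding H_def abs_mult using pos[OF t] by (simp add: algebra_simps)
    have "t * F 1 - F t = (F 1 - F t) - (1 - t) * F 1" by (simp add: algebra_simps)
    then have "\<bar>t * F 1 - F t\<bar> \<le> m * (1 - t) + (1 - t) * \<bar>F 1\<bar>"
      using F1[of t] t by (simp only:) (intro order_trans[OF abs_triangle_ineq4], auto simp: abs_mult)
    then have "g t * \<bar>t * F 1 - F t\<bar> \<le> g t * (m * (1 - t) + (1 - t) * \<bar>F 1\<bar>)"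
      using pos[OF t] by (intro mult_left_mono) auto
    then show "\<bar>H t\<bar> \<le> (\<bar>F 1\<bar> + m) * ((1 - t) * g t)"
      unfolding H_def abs_mult using pos[OF t] by (simp add: algebra_simps)
  qed
  have "(LBINT t=ereal 0..ereal 1. g t * Q t - g t * f t) = 0 - 0"
  proof (rule interval_integral_FTC_integrable)
    fix t :: real assume "ereal 0 < ereal t" "ereal t < ereal 1"
    then have t: "0 < t" "t < 1" by auto
    show "(H has_vector_derivative g t * Q t - g t * f t) (at t)"
      using Hd[OF t] by (simp add: has_real_derivative_iff_has_vector_derivative)
    show "isCont (\<lambda>t. g t * Q t - g t * f t) t"
      by (intro continuous_intros g_cont contQ isCont_interior[OF f] t)
  next
    show "set_integrable lborel (einterval (ereal 0) (ereal 1)) (\<lambda>t. g t * Q t - g t * f t)"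
      using set_integral_diff(1)[OF iQ i_f] by simp
    have "(H \<longlongrightarrow> 0) (at_right 0)"
    proof (rule Lim_null_comparison)
      show "\<forall>\<^sub>F t in at_right 0. norm (H t) \<le> (\<bar>F 1\<bar> + m) * (t * g t)"
        unfolding eventually_at_right_field using small(1) by (intro exI[of _ 1]) auto
      show "((\<lambda>t. (\<bar>F 1\<bar> + m) * (t * g t)) \<longlongrightarrow> 0) (at_right 0)"
        using tendsto_mult_left[OF left_end(1), of "\<bar>F 1\<bar> + m"] by simp
    qed
    then show "((H \<circ> real_of_ereal) \<longlongrightarrow> 0) (at_right (ereal 0))" by (simp add: ereal_tendsto_simps1)
    have "(H \<longlongrightarrow> 0) (at_left 1)"
    proof (rule Lim_null_comparison)
      show "\<forall>\<^sub>F t in at_left 1. norm (H t) \<le> (\<bar>F 1\<bar> + m) * ((1 - t) * g t)"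
        unfolding eventually_at_left_field using small(2) by (intro exI[of _ 0]) auto
      show "((\<lambda>t. (\<bar>F 1\<bar> + m) * ((1 - t) * g t)) \<longlongrightarrow> 0) (at_left 1)"
        using tendsto_mult_left[OF right_end, of "\<bar>F 1\<bar> + m"] by simp
    qed
    then show "((H \<circ> real_of_ereal) \<longlongrightarrow> 0) (at_left (ereal 1))" by (simp add: ereal_tendsto_simps1)
  qed simp
  then have "(LINT t:{0<..<1}|lborel. g t * Q t - g t * f t) = 0"
    by (simp add: interval_lebesgue_integral_le_eq)
  then show ?thesis using set_integral_diff(2)[OF iQ i_f] unfolding Q_def by simp
qed

end

section \<open>Barycentric coordinates and edges\<close>

text \<open>The barycentric coordinates of \<open>x\<close>: \<open>x\<close> is the combination of the vertices with these weights.
  They put the three vertices on an equal footing.\<close>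

definition bary :: "nat \<Rightarrow> point \<Rightarrow> real" where
  "bary l x = (if l = 0 then 1 - fst x - snd x else if l = 1 then fst x else snd x)"

lemma bary_affine: "bary l (t *\<^sub>R x + (1 - t) *\<^sub>R y) = t * bary l x + (1 - t) * bary l y"
  by (simp add: bary_def algebra_simps)

lemma bary_vertex: "l \<in> {0,1,2} \<Longrightarrow> m \<in> {0,1,2} \<Longrightarrow> bary l (vertex m) = (if l = m then 1 else 0)"
  by (auto simp: bary_def vertex_def)

lemma bary_nonneg: "x \<in> simplex2 \<Longrightarrow> 0 \<le> bary l x"
  by (auto simp: bary_def simplex2_def)

lemma bary_sum: "bary 0 x + bary 1 x + bary 2 x = 1"
  by (simp add: bary_def)

lemma bary_ext:
  assumes "\<And>l. l \<in> {0,1,2} \<Longrightarrow> bary l x = bary l y"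
  shows "x = y"
  using assms[of 1] assms[of 2] by (simp add: bary_def prod_eq_iff)

lemma bary_cont: "continuous_on A (bary l)"
  unfolding bary_def by (cases "l = 0"; cases "l = 1") (auto intro!: continuous_intros)

lemma edge_iff:
  assumes "i \<in> {0,1,2}" "j \<in> {0,1,2}" "k \<in> {0,1,2}" "i \<noteq> j" "k \<noteq> i" "k \<noteq> j"
  shows "x \<in> edge i j \<longleftrightarrow> x \<in> simplex2 \<and> bary k x = 0"
proof
  assume "x \<in> edge i j"
  then obtain u where u: "0 \<le> u" "u \<le> 1" "x = (1 - u) *\<^sub>R vertex i + u *\<^sub>R vertex j"
    by (auto simp: closed_segment_def)
  then have x: "x = u *\<^sub>R vertex j + (1 - u) *\<^sub>R vertex i" by (simp add: add.commute)
  show "x \<in> simplex2 \<and> bary k x = 0"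
    unfolding x bary_affine using u assms move_simplex2[OF vertex_simplex2, of u j i] by (simp add: bary_vertex)
next
  assume x: "x \<in> simplex2 \<and> bary k x = 0"
  let ?y = "(1 - bary j x) *\<^sub>R vertex i + bary j x *\<^sub>R vertex j"
  have sum: "bary i x + bary j x + bary k x = 1"
    using assms bary_sum[of x] by auto
  have y: "?y = bary j x *\<^sub>R vertex j + (1 - bary j x) *\<^sub>R vertex i" by (simp add: add.commute)
  have "x = ?y"
  proof (rule bary_ext)
    fix l :: nat assume l: "l \<in> {0,1,2}"
    then have "l = i \<or> l = j \<or> l = k" using assms by auto
    then show "bary l x = bary l ?y"
      unfolding y bary_affine using assms x sum by (auto simp: bary_vertex)
  qed
  moreover have "0 \<le> bary j x" "bary j x \<le> 1"
    using x sum bary_nonneg[of x] by (smt (verit))+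
  ultimately show "x \<in> edge i j" unfolding closed_segment_def by blast
qed

lemma third_vertex:
  assumes "i \<in> {0,1,2}" "j \<in> {0,1,2}" "i \<noteq> (j::nat)"
  obtains k where "k \<in> {0,1,2}" "k \<noteq> i" "k \<noteq> j" "{i,j,k} = {0,1,2}"
  using assms by (elim insertE emptyE) (auto intro: that[of 0] that[of 1] that[of 2])

lemma edge_point_in_edge: "0 \<le> t \<Longrightarrow> t \<le> 1 \<Longrightarrow> edge_point i j t \<in> edge i j"
  unfolding closed_segment_def by (auto intro!: exI[of _ "1 - t"])

lemma edge_point_cont: "continuous_on A (edge_point i j)"
  by (intro continuous_intros)

lemma edge_point_simplex2: "0 \<le> t \<Longrightarrow> t \<le> 1 \<Longrightarrow> edge_point i j t \<in> simplex2"
  by (rule move_simplex2) auto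

lemma edge_subset: "edge i j \<subseteq> simplex2"
  by (rule closed_segment_subset) (auto simp: convex_simplex2)

context df_weights
begin

lemma weights_sum3:
  assumes "{i,j,k} = {0,1,2::nat}" "x \<in> simplex2"
  shows "p i x + p j x + p k x = 1"
proof -
  have "card {i,j,k} = 3" using assms(1) by simp
  then have "i \<noteq> j" "i \<noteq> k" "j \<noteq> k" by (auto simp: card_insert_if split: if_splits)
  then have "(\<Sum>l\<in>{i,j,k}. p l x) = p i x + p j x + p k x" by simp
  moreover have "(\<Sum>l\<in>{0,1,2}. p l x) = 1" using sum_one[OF assms(2)] by simp
  ultimately show ?thesis using assms(1) by simp
qed

lemma vertex_absorbing:
  assumes i: "i \<in> {0,1,2}"
  shows "absorbing p {vertex i} \<longleftrightarrow> p i (vertex i) = 1"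
proof -
  obtain j k where jk: "j \<in> {0,1,2}" "k \<in> {0,1,2}" "j \<noteq> i" "k \<noteq> i" "{i,j,k} = {0,1,2}"
    using i by (elim insertE emptyE) (auto intro: that[of 1 2] that[of 0 2] that[of 0 1])
  have sum: "p i (vertex i) + p j (vertex i) + p k (vertex i) = 1"
    using weights_sum3[OF jk(5) vertex_simplex2] .
  have nn: "0 \<le> p l (vertex i)" if "l \<in> {0,1,2}" for l using nonneg[OF that vertex_simplex2] .
  show ?thesis
  proof
    assume A: "absorbing p {vertex i}"
    have "p l (vertex i) = 0" if l: "l \<in> {0,1,2}" "l \<noteq> i" for l
    proof (rule ccontr)
      assume "p l (vertex i) \<noteq> 0"
      then have "0 < p l (vertex i)" using nn[OF l(1)] by simp
      from absorbing_move[OF A _ l(1) this, of 0] have "vertex l = vertex i" by simp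
      then show False using bary_vertex[OF i l(1)] bary_vertex[OF i i] l(2) by auto
    qed
    then show "p i (vertex i) = 1" using sum jk by simp
  next
    assume p1: "p i (vertex i) = 1"
    have only: "l = i" if l: "l \<in> {0,1,2}" "0 < p l (vertex i)" for l
    proof -
      have "p j (vertex i) = 0" "p k (vertex i) = 0" using p1 sum nn[OF jk(1)] nn[OF jk(2)] by linarith+
      moreover have "l \<in> {i,j,k}" using l(1) jk(5) by simp
      ultimately show ?thesis using l(2) by auto
    qed
    show "absorbing p {vertex i}"
      unfolding absorbing_iff
    proof (intro conjI ballI impI)
      fix x l t assume "x \<in> {vertex i}" "l \<in> {0,1,2}" "0 < p l x" "t \<in> {0..1::real}"
      then have "x = vertex i" "l = i" using only by auto
      then show "t *\<^sub>R x + (1 - t) *\<^sub>R vertex l \<in> {vertex i}" by (simp flip: scaleR_add_left)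
    qed auto
  qed
qed

section \<open>The edge law\<close>

text \<open>A positive weight of the third vertex would lead off the edge.\<close>

lemma minimal_edge_weights:
  assumes K: "edge i j \<in> minimal_absorbing p" and ij: "i \<in> {0,1,2}" "j \<in> {0,1,2}" "i \<noteq> j"
    and x: "x \<in> edge i j"
  shows "p i x + p j x = 1" and "\<And>k. k \<in> {0,1,2} \<Longrightarrow> k \<noteq> i \<Longrightarrow> k \<noteq> j \<Longrightarrow> p k x = 0"
proof -
  have xs: "x \<in> simplex2" using x edge_subset by blast
  show k0: "p k x = 0" if k: "k \<in> {0,1,2}" "k \<noteq> i" "k \<noteq> j" for k
  proof (rule ccontr)
    assume "p k x \<noteq> 0"
    then have "0 < p k x" using nonneg[OF k(1) xs] by simp
    from absorbing_move[OF minimal_absorbingD(1)[OF K] x k(1) this, of 0]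
    have "vertex k \<in> edge i j" by simp
    then show False using edge_iff[OF ij(1,2) k(1) ij(3) k(2,3)] bary_vertex[OF k(1) k(1)] by simp
  qed
  obtain k where k: "k \<in> {0,1,2}" "k \<noteq> i" "k \<noteq> j" "{i,j,k} = {0,1,2}" by (rule third_vertex[OF ij])
  show "p i x + p j x = 1" using weights_sum3[OF k(4) xs] k0[OF k(1-3)] by simp
qed

text \<open>Otherwise the vertex alone would be absorbing, and the edge not minimal.\<close>

lemma minimal_edge_vertex:
  assumes K: "edge i j \<in> minimal_absorbing p" and ij: "i \<in> {0,1,2}" "j \<in> {0,1,2}" "i \<noteq> j"
  shows "p i (vertex i) < 1" "p j (vertex j) < 1"
proof -
  have *: "p l (vertex l) < 1" if l: "l \<in> {i, j}" for l
  proof (rule ccontr)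
    have l3: "l \<in> {0,1,2}" using l ij by auto
    have lK: "vertex l \<in> edge i j" using l by auto
    assume "\<not> ?thesis"
    moreover have "p l (vertex l) \<le> 1"
      using minimal_edge_weights(1)[OF K ij lK] nonneg[OF ij(1) vertex_simplex2, of l]
        nonneg[OF ij(2) vertex_simplex2, of l] l by auto
    ultimately have "absorbing p {vertex l}" using vertex_absorbing[OF l3] by simp
    moreover have "{vertex l} \<subseteq> edge i j" using lK by simp
    ultimately have "{vertex l} = edge i j" using K unfolding minimal_absorbing_def by blast
    then have "vertex i = vertex j" by (metis ends_in_segment singletonD)
    then show False using bary_vertex[OF ij(1,1)] bary_vertex[OF ij(1,2)] ij(3) by simp
  qed
  show "p i (vertex i) < 1" "p j (vertex j) < 1" using * by auto
qed

lemma weight_edge_cont: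
  assumes "l \<in> {0,1,2}" shows "continuous_on {0..1} (\<lambda>u. p l (edge_point i j u))"
  by (rule continuous_on_compose2[OF weight_cont[OF assms] edge_point_cont])
     (auto intro: edge_point_simplex2 simp del: scaleR_Pair)

text \<open>The logarithm of the density is an oriented integral with the variable end point \<open>t\<close>, so its
  derivative is the difference of the two integrands.\<close>

lemma edge_density_ode:
  assumes K: "edge i j \<in> minimal_absorbing p" and ij: "i \<in> {0,1,2}" "j \<in> {0,1,2}" "i \<noteq> j"
    and s: "0 < s" "s < 1"
  shows "edge_ode (\<lambda>t. p i (edge_point i j t)) (\<lambda>t. p j (edge_point i j t)) (edge_density p i j s)"
proof
  show "continuous_on {0..1} (\<lambda>t. p i (edge_point i j t))" "continuous_on {0..1} (\<lambda>t. p j (edge_point i j t))"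
    using weight_edge_cont ij by blast+
  show "0 \<le> p i (edge_point i j t)" "0 \<le> p j (edge_point i j t)" if "0 \<le> t" "t \<le> 1" for t
    using nonneg[OF ij(1) edge_point_simplex2[OF that]] nonneg[OF ij(2) edge_point_simplex2[OF that]] by blast+
  show "p i (edge_point i j t) + p j (edge_point i j t) = 1" if "0 \<le> t" "t \<le> 1" for t
    by (rule minimal_edge_weights(1)[OF K ij edge_point_in_edge[OF that]])
  show "0 < p i (edge_point i j 0)"
    using minimal_edge_weights(1)[OF K ij, of "vertex j"] minimal_edge_vertex(2)[OF K ij] by simp
  show "0 < p j (edge_point i j 1)"
    using minimal_edge_weights(1)[OF K ij, of "vertex i"] minimal_edge_vertex(1)[OF K ij] by simp
  show "0 < edge_density p i j s t" for t by (simp add: edge_density_def)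
  fix t :: real assume t: "0 < t" "t < 1"
  let ?a = "\<lambda>u. p i (edge_point i j u) / (1 - u)" and ?b = "\<lambda>u. p j (edge_point i j u) / u"
  have "continuous_on {0<..<1} ?a" "continuous_on {0<..<1} ?b"
    using continuous_on_subset[OF weight_edge_cont[OF ij(1), of i j], of "{0<..<1}"]
      continuous_on_subset[OF weight_edge_cont[OF ij(2), of i j], of "{0<..<1}"]
    by (intro continuous_on_divide continuous_intros; force)+
  from interval_deriv[OF this(1) s t] interval_deriv[OF this(2) s t]
  have "((\<lambda>t. (LBINT u=ereal s..ereal t. ?a u) - (LBINT u=ereal s..ereal t. ?b u)) has_real_derivative ?a t - ?b t) (at t)"
    by (rule DERIV_diff)
  from DERIV_fun_exp[OF this]
  show "(edge_density p i j s has_real_derivative edge_density p i j s t * (?a t - ?b t)) (at t)"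
    unfolding edge_density_def[abs_def] interval_integral_endpoints_reverse[of "ereal _" "ereal s"] by simp
qed

text \<open>Averaging towards an end point of the edge is a difference quotient of an antiderivative \<open>F\<close>; in
  this form the averages enter \<open>edge_ode.stationary\<close>.\<close>

lemma seg_avg_edge:
  assumes f: "continuous_on simplex2 f"
    and F: "\<And>t. 0 \<le> t \<Longrightarrow> t \<le> 1 \<Longrightarrow> (F has_real_derivative f (edge_point i j t)) (at t within {0..1})"
    and t: "0 < t" "t < 1"
  shows "seg_avg f (vertex i) (edge_point i j t) = (F 1 - F t) / (1 - t)"
    and "seg_avg f (vertex j) (edge_point i j t) = (F t - F 0) / t"
proof -
  have p1: "u *\<^sub>R edge_point i j t + (1 - u) *\<^sub>R vertex i = edge_point i j (1 - u * (1 - t))" for u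
    by (simp add: algebra_simps)
  have p2: "u *\<^sub>R edge_point i j t + (1 - u) *\<^sub>R vertex j = edge_point i j (u * t)" for u
    by (simp add: algebra_simps)
  have ut: "0 \<le> u * t \<and> u * t \<le> 1 \<and> 0 \<le> 1 - u * (1 - t) \<and> 1 - u * (1 - t) \<le> 1" if "u \<in> {0..1}" for u
    using that t mult_le_one[of u t] mult_le_one[of u "1 - t"] by auto
  have in01: "1 - u * (1 - t) \<in> {0..1}" "u * t \<in> {0..1}" if "u \<in> {0..1}" for u
    using ut[OF that] unfolding atLeastAtMost_iff by blast+
  have "((\<lambda>u. f (edge_point i j (1 - u * (1 - t)))) has_integral
      (- F (1 - 1 * (1 - t)) / (1 - t)) - (- F (1 - 0 * (1 - t)) / (1 - t))) {0..1}"
  proof (rule fundamental_theorem_of_calculus)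
    fix u :: real assume u: "u \<in> {0..1}"
    have D: "((\<lambda>u. F (1 - u * (1 - t))) has_real_derivative f (edge_point i j (1 - u * (1 - t))) * (- (1 - t))) (at u within {0..1})"
    proof -
      have "((\<lambda>u. 1 - u * (1 - t)) has_real_derivative - (1 - t)) (at u within {0..1})"
        by (auto intro!: derivative_eq_intros)
      moreover have "(F has_real_derivative f (edge_point i j (1 - u * (1 - t))))
          (at (1 - u * (1 - t)) within (\<lambda>u. 1 - u * (1 - t)) ` {0..1})"
        using ut[OF u] by (intro DERIV_subset[OF F] image_subsetI in01(1)) blast+
      ultimately show ?thesis
        using DERIV_image_chain[of F _ "\<lambda>u. 1 - u * (1 - t)" u "{0..1}" "- (1 - t)"] by (simp only: o_def)
    qed
    have e: "- (v * - (1 - t)) / (1 - t) = v" for v :: real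
      unfolding mult_minus_right minus_minus using t by simp
    from DERIV_cdivide[OF DERIV_minus[OF D], of "1 - t"]
    show "((\<lambda>u. - F (1 - u * (1 - t)) / (1 - t)) has_vector_derivative f (edge_point i j (1 - u * (1 - t)))) (at u within {0..1})"
      unfolding e has_real_derivative_iff_has_vector_derivative .
  qed simp
  then show "seg_avg f (vertex i) (edge_point i j t) = (F 1 - F t) / (1 - t)"
    unfolding seg_avg_def p1 by (simp add: integral_unique diff_divide_distrib)
  have "((\<lambda>u. f (edge_point i j (u * t))) has_integral F (1 * t) / t - F (0 * t) / t) {0..1}"
  proof (rule fundamental_theorem_of_calculus)
    fix u :: real assume u: "u \<in> {0..1}"
    have "((\<lambda>u. F (u * t)) has_real_derivative f (edge_point i j (u * t)) * t) (at u within {0..1})"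
    proof -
      have "((\<lambda>u. u * t) has_real_derivative t) (at u within {0..1})"
        by (auto intro!: derivative_eq_intros)
      moreover have "(F has_real_derivative f (edge_point i j (u * t))) (at (u * t) within (\<lambda>u. u * t) ` {0..1})"
        using ut[OF u] by (intro DERIV_subset[OF F] image_subsetI in01(2)) blast+
      ultimately show ?thesis
        using DERIV_image_chain[of F _ "\<lambda>u. u * t" u "{0..1}" t] by (simp only: o_def)
    qed
    from DERIV_cdivide[OF this, of t]
    show "((\<lambda>u. F (u * t) / t) has_vector_derivative f (edge_point i j (u * t))) (at u within {0..1})"
      using t by (simp add: has_real_derivative_iff_has_vector_derivative)
  qed simp
  then show "seg_avg f (vertex j) (edge_point i j t) = (F t - F 0) / t"
    unfolding seg_avg_def p2 by (simp add: integral_unique diff_divide_distrib)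
qed

text \<open>The normalized density defines an invariant measure, by \<open>edge_ode.stationary\<close>. As it is carried
  by the edge, where the iterates of \<open>f\<close> converge to \<open>lim_val (edge i j) f\<close>, its integral of \<open>f\<close> is this
  number, and \<open>stat_unique\<close> applies.\<close>

lemma stat_edge:
  assumes K: "edge i j \<in> minimal_absorbing p" and ij: "i \<in> {0,1,2}" "j \<in> {0,1,2}" "i \<noteq> j"
  shows "is_edge_law p i j (stat (edge i j))"
  unfolding is_edge_law_def
proof (intro conjI ballI stat(1)[OF K])
  fix s :: real assume "s \<in> {0<..<1}"
  then have s: "0 < s" "s < 1" by auto
  define g where "g = edge_density p i j s"
  interpret O: edge_ode "\<lambda>t. p i (edge_point i j t)" "\<lambda>t. p j (edge_point i j t)" g
    unfolding g_def by (rule edge_density_ode[OF K ij s])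
  define Z where "Z = (LINT t:{0<..<1}|lborel. g t)"
  have gc: "continuous_on {0<..<1} g" using O.g_cont by (intro continuous_at_imp_continuous_on) auto
  let ?R = "restrict_space lborel {0<..<1::real}"
  have gm: "g \<in> borel_measurable ?R"
    using borel_measurable_continuous_on_restrict[OF gc]
    by (simp add: borel_measurable_restrict_space_iff)
  have gint: "integrable ?R g"
    using O.g_integrable by (simp add: set_integrable_eq)
  have RI: "integral\<^sup>L ?R h = (LINT t:{0<..<1}|lborel. h t)" for h :: "real \<Rightarrow> real"
    by (simp add: integral_restrict_space set_lebesgue_integral_def)
  have Z: "0 < Z"
  proof -
    have "0 \<le> Z" unfolding Z_def RI[symmetric]
      by (intro Bochner_Integration.integral_nonneg) (auto simp: space_restrict_space less_imp_le O.pos)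
    moreover have "Z \<noteq> 0"
    proof
      assume "Z = 0"
      moreover have "AE t in ?R. 0 \<le> g t"
        by (intro AE_I2) (auto simp: space_restrict_space less_imp_le O.pos)
      ultimately have "AE t in ?R. g t = 0"
        unfolding Z_def RI[symmetric] using integral_nonneg_eq_0_iff_AE[OF gint] by simp
      then have "AE t in ?R. False"
        by (rule AE_mp) (use O.pos in \<open>force intro!: AE_I2 simp: space_restrict_space\<close>)
      then have "emeasure ?R (space ?R) = 0" by (subst (asm) AE_iff_measurable[OF sets.top]) auto
      then show False by (simp add: space_restrict_space emeasure_restrict_space)
    qed
    ultimately show ?thesis by simp
  qed
  define C where "C = 1 / Z"
  have C: "0 < C" "C * Z = 1" using Z by (auto simp: C_def)
  define D where "D = density ?R (\<lambda>t. ennreal (C * g t))"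
  have qm: "edge_point i j \<in> measurable D borel_simplex"
  proof (rule measurable_restrict_space2)
    have "edge_point i j \<in> borel_measurable borel"
      by (rule borel_measurable_continuous_onI[OF edge_point_cont])
    then have "edge_point i j \<in> borel_measurable ?R"
      by (intro measurable_restrict_space1) simp
    then show "edge_point i j \<in> borel_measurable D" by (simp add: D_def)
    show "edge_point i j \<in> space D \<rightarrow> simplex2"
      using edge_point_simplex2 by (auto simp: D_def space_restrict_space simp del: scaleR_Pair)
  qed
  define \<mu> where "\<mu> = distr D borel_simplex (edge_point i j)"
  have int: "integral\<^sup>L \<mu> f = C * (LINT t:{0<..<1}|lborel. g t * f (edge_point i j t))"
    if f: "continuous_on simplex2 f" for f
  proof -
    have fm: "(\<lambda>t. f (edge_point i j t)) \<in> borel_measurable ?R"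
      using measurable_compose[OF qm cont_measurable_simplex2[OF f]] by (simp add: D_def)
    have "integral\<^sup>L \<mu> f = (\<integral>t. f (edge_point i j t) \<partial>D)"
      unfolding \<mu>_def by (rule integral_distr[OF qm cont_measurable_simplex2[OF f]])
    also have "\<dots> = (\<integral>t. (C * g t) *\<^sub>R f (edge_point i j t) \<partial>?R)"
      unfolding D_def using C O.pos gm fm
      by (intro integral_density) (auto intro!: AE_I2 simp: space_restrict_space less_imp_le)
    also have "\<dots> = C * (\<integral>t. g t * f (edge_point i j t) \<partial>?R)" by (simp add: mult.assoc)
    finally show ?thesis unfolding RI .
  qed
  have pD: "prob_space D"
  proof (rule prob_spaceI)
    have "emeasure D (space D) = (\<integral>\<^sup>+t. ennreal (C * g t) * indicator (space ?R) t \<partial>?R)"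
      unfolding D_def space_density using gm by (intro emeasure_density sets.top) simp
    also have "\<dots> = (\<integral>\<^sup>+t. ennreal (C * g t) \<partial>?R)"
      by (rule nn_integral_cong) simp
    also have "\<dots> = ennreal (\<integral>t. C * g t \<partial>?R)"
      using C O.pos gint by (intro nn_integral_eq_integral) (auto intro!: AE_I2 simp: space_restrict_space less_imp_le)
    also have "(\<integral>t. C * g t \<partial>?R) = 1" using C(2) by (simp add: RI Z_def[symmetric])
    finally show "emeasure D (space D) = 1" by simp
  qed
  have p\<mu>: "prob_space \<mu>" unfolding \<mu>_def by (rule prob_space.prob_space_distr[OF pD qm])
  have st: "sets \<mu> = sets borel_simplex" by (simp add: \<mu>_def)
  have inv: "\<mu> \<in> invariant_measures p"
  proof (rule invariant_of_holder[OF p\<mu> st])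
    fix B C' f assume f: "HB B C' f"
    have cf: "continuous_on simplex2 f" using HB_cont[OF f] .
    have cfe: "continuous_on {0..1} (\<lambda>t. f (edge_point i j t))"
      by (rule continuous_on_compose2[OF cf edge_point_cont])
         (auto intro: edge_point_simplex2 simp del: scaleR_Pair)
    define F where "F t = integral {0..t} (\<lambda>t. f (edge_point i j t))" for t
    have F: "(F has_real_derivative f (edge_point i j t)) (at t within {0..1})" if "0 \<le> t" "t \<le> 1" for t
      unfolding F_def by (rule integral_has_real_derivative[OF cfe]) (use that in auto)
    have F0: "F 0 = 0" by (simp add: F_def)
    have Pf: "P f (edge_point i j t) = p i (edge_point i j t) / (1 - t) * (F 1 - F t) + p j (edge_point i j t) / t * F t"
      if t: "0 < t" "t < 1" for t
    proof -
      have xe: "edge_point i j t \<in> edge i j" using t by (intro edge_point_in_edge) auto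
      obtain k where k: "k \<in> {0,1,2}" "k \<noteq> i" "k \<noteq> j" "{i,j,k} = {0,1,2}" by (rule third_vertex[OF ij])
      have "P f (edge_point i j t) = (\<Sum>l\<in>{i,j,k}. p l (edge_point i j t) * seg_avg f (vertex l) (edge_point i j t))"
        unfolding k(4) using xe edge_subset by (intro trans_op_eq[OF cf]) auto
      also have "\<dots> = p i (edge_point i j t) * seg_avg f (vertex i) (edge_point i j t)
          + p j (edge_point i j t) * seg_avg f (vertex j) (edge_point i j t)"
        using k(2,3) ij(3) minimal_edge_weights(2)[OF K ij xe k(1-3)] by simp
      also have "\<dots> = p i (edge_point i j t) * ((F 1 - F t) / (1 - t)) + p j (edge_point i j t) * ((F t - F 0) / t)"
        by (simp only: seg_avg_edge[where F = F and f = f and i = i and j = j, OF cf F t])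
      finally show ?thesis unfolding F0 by simp
    qed
    have "(LINT t:{0<..<1}|lborel. g t * P f (edge_point i j t))
        = (LINT t:{0<..<1}|lborel. g t * (p i (edge_point i j t) / (1 - t) * (F 1 - F t) + p j (edge_point i j t) / t * F t))"
      by (rule set_lebesgue_integral_cong) (auto simp: Pf)
    also have "\<dots> = (LINT t:{0<..<1}|lborel. g t * f (edge_point i j t))"
      by (rule O.stationary[OF cfe F0 F])
    finally show "(LINT x|\<mu>. P f x) = (LINT x|\<mu>. f x)"
      unfolding int[OF cf] int[OF P_cont[OF cf]] by simp
  qed
  interpret \<mu>: prob_space \<mu> by (rule p\<mu>)
  have conc: "AE x in \<mu>. x \<in> edge i j"
  proof -
    have me: "{x \<in> space borel_simplex. x \<in> edge i j} \<in> sets borel_simplex"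
    proof -
      have "edge i j \<in> sets borel_simplex"
        unfolding sets_borel_simplex_closed using edge_subset by (intro sigma_sets.Basic) simp
      moreover have "{x \<in> space borel_simplex. x \<in> edge i j} = edge i j" using edge_subset by auto
      ultimately show ?thesis by simp
    qed
    show ?thesis
      unfolding \<mu>_def AE_distr_iff[OF qm me]
      by (rule AE_I2) (auto simp: D_def space_restrict_space intro!: edge_point_in_edge simp del: scaleR_Pair)
  qed
  have eq: "\<mu> = stat (edge i j)"
  proof (rule stat_unique[OF K p\<mu> st])
    fix B C' f assume f: "HB B C' f"
    obtain C'' where C'': "HB B C'' (orbit_lim f)" using orbit_lim_HB[OF f] .
    have "integral\<^sup>L \<mu> f = (LINT x|\<mu>. orbit_lim f x)" by (rule invariant_integral_orbit_lim[OF inv f])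
    also have "\<dots> = (LINT x|\<mu>. lim_val (edge i j) f)"
    proof (rule integral_cong_AE)
      show "orbit_lim f \<in> borel_measurable \<mu>"
        using bounded_measurable_integrable[OF p\<mu> st cont_bounded_measurable[OF HB_cont[OF C'']]] by simp
      show "AE x in \<mu>. orbit_lim f x = lim_val (edge i j) f"
        using conc by eventually_elim (rule orbit_lim_on_minimal[OF K f])
    qed simp
    finally show "integral\<^sup>L \<mu> f = lim_val (edge i j) f" by (simp add: \<mu>.prob_space)
  qed
  show "\<exists>C>0. stat (edge i j) = distr (density ?R (\<lambda>t. ennreal (C * edge_density p i j s t)))
      borel_simplex (edge_point i j)"
    using eq[symmetric] unfolding \<mu>_def D_def g_def by (intro exI[of _ C] conjI C(1))
qed

lemma stat_vertex:
  assumes K: "{vertex i} \<in> minimal_absorbing p"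
  shows "stat {vertex i} = dirac i"
proof (rule stat_unique[OF K, symmetric])
  have sp: "vertex i \<in> space borel_simplex" by simp
  show "prob_space (dirac i)" by (rule prob_space_return[OF sp])
  show "sets (dirac i) = sets borel_simplex" by simp
  fix B C f assume f: "HB B C f"
  have "integral\<^sup>L (dirac i) f = f (vertex i)"
    by (rule integral_return[OF sp cont_measurable_simplex2[OF HB_cont[OF f]]])
  also have "\<dots> = lim_val {vertex i} f"
    by (rule lim_val_const_on[OF K f, symmetric]) simp
  finally show "integral\<^sup>L (dirac i) f = lim_val {vertex i} f" .
qed

end

section \<open>Almost sure behaviour of the chain\<close>

lemma geometric_summable: "0 \<le> \<rho> \<Longrightarrow> \<rho> < 1 \<Longrightarrow> summable (\<lambda>n. c * \<rho> ^ n :: real)"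
  by (intro summable_mult summable_geometric) simp

lemma tendsto_iff_infdist_singleton: "(\<lambda>n. infdist (z n) {a}) \<longlonglongrightarrow> 0 \<longleftrightarrow> z \<longlonglongrightarrow> a"
  using tendsto_dist_iff[of z a sequentially] by simp

text \<open>By monotone convergence the sum has a finite expectation, hence is almost surely finite.\<close>

lemma AE_summable_of_summable_integrals:
  fixes X :: "nat \<Rightarrow> 'w \<Rightarrow> real"
  assumes X: "\<And>n. integrable M (X n)" "\<And>n \<omega>. \<omega> \<in> space M \<Longrightarrow> 0 \<le> X n \<omega>"
    and s: "summable (\<lambda>n. integral\<^sup>L M (X n))"
  shows "AE \<omega> in M. summable (\<lambda>n. X n \<omega>)"
proof -
  have I0: "0 \<le> integral\<^sup>L M (X n)" for n
    by (rule Bochner_Integration.integral_nonneg) (rule X(2))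
  have "(\<integral>\<^sup>+\<omega>. (\<Sum>n. ennreal (X n \<omega>)) \<partial>M) = (\<Sum>n. \<integral>\<^sup>+\<omega>. ennreal (X n \<omega>) \<partial>M)"
    using X(1) by (intro nn_integral_suminf) auto
  also have "\<dots> = (\<Sum>n. ennreal (integral\<^sup>L M (X n)))"
    using X by (intro suminf_cong nn_integral_eq_integral AE_I2) auto
  also have "\<dots> = ennreal (\<Sum>n. integral\<^sup>L M (X n))"
    by (rule suminf_ennreal2[OF I0 s])
  finally have "(\<integral>\<^sup>+\<omega>. (\<Sum>n. ennreal (X n \<omega>)) \<partial>M) \<noteq> \<infinity>" by simp
  then have "AE \<omega> in M. (\<Sum>n. ennreal (X n \<omega>)) \<noteq> \<infinity>"
    using X(1) by (intro nn_integral_PInf_AE) auto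
  then show ?thesis
    using AE_space by eventually_elim (use X(2) in \<open>auto intro: summable_suminf_not_top\<close>)
qed

context df_weights
begin

context
  fixes M :: "'w measure" and Z :: "nat \<Rightarrow> 'w \<Rightarrow> point" and x :: point
  assumes chain: "df_chain p x M Z" and x: "x \<in> simplex2"
begin

lemma chain_prob: "prob_space M"
  using chain by (simp add: df_chain_def)

lemma chain_measurable: "Z n \<in> measurable M borel_simplex"
  using chain by (simp add: df_chain_def)

lemma chain_in: "\<omega> \<in> space M \<Longrightarrow> Z n \<omega> \<in> simplex2"
  using measurable_space[OF chain_measurable] by fastforce

lemma chain_measurable_borel: "Z n \<in> borel_measurable M"
  using chain_measurable[of n] by (simp add: measurable_restrict_space2_iff)

lemma chain_cont_measurable:
  "continuous_on simplex2 f \<Longrightarrow> (\<lambda>\<omega>. f (Z n \<omega>)) \<in> borel_measurable M"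
  using measurable_compose[OF chain_measurable cont_measurable_simplex2] .

lemma chain_integrable2:
  fixes f g :: "point \<Rightarrow> real"
  assumes "continuous_on simplex2 f" "continuous_on simplex2 g"
  shows "integrable M (\<lambda>\<omega>. f (Z m \<omega>) * g (Z n \<omega>))"
proof -
  interpret prob_space M by (rule chain_prob)
  obtain B C where B: "\<forall>y\<in>simplex2. \<bar>f y\<bar> \<le> B" and C: "\<forall>y\<in>simplex2. \<bar>g y\<bar> \<le> C"
    using continuous_simplex2_bounded assms by metis
  have "\<bar>f (Z m \<omega>) * g (Z n \<omega>)\<bar> \<le> B * C" if "\<omega> \<in> space M" for \<omega>
    unfolding abs_mult using B C chain_in[OF that] abs_ge_zero order_trans by (intro mult_mono) blast+
  then show ?thesis
    using chain_cont_measurable assms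
    by (intro integrable_const_bound[of _ "B * C"] borel_measurable_times) (auto intro!: AE_I2)
qed

lemma chain_integrable:
  fixes f :: "point \<Rightarrow> real"
  assumes "continuous_on simplex2 f" shows "integrable M (\<lambda>\<omega>. f (Z n \<omega>))"
  using chain_integrable2[OF assms continuous_on_const[of _ 1]] by simp

lemma filtration_subalgebra: "subalgebra M (natural_filtration M Z n)"
proof -
  have sub: "{Z k -` A \<inter> space M | k A. k \<le> n \<and> A \<in> sets borel} \<subseteq> sets M"
    using measurable_sets[OF chain_measurable_borel] by blast
  then have "{Z k -` A \<inter> space M | k A. k \<le> n \<and> A \<in> sets borel} \<subseteq> Pow (space M)"
    using sets.space_closed by blast
  then show ?thesis
    unfolding subalgebra_def natural_filtration_def
    using sub by (simp add: space_measure_of sets_measure_of sets.sigma_sets_subset)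
qed

lemma filtration_measurable:
  assumes f: "continuous_on simplex2 f"
  shows "(\<lambda>\<omega>. f (Z n \<omega>)) \<in> borel_measurable (natural_filtration M Z n)"
proof -
  let ?F = "natural_filtration M Z n"
  have spF: "space ?F = space M" using filtration_subalgebra by (simp add: subalgebra_def)
  have "Z n \<in> borel_measurable ?F"
  proof (rule measurableI)
    fix A :: "point set" assume A: "A \<in> sets borel"
    let ?G = "{Z k -` A \<inter> space M | k A. k \<le> n \<and> A \<in> sets borel}"
    have "?G \<subseteq> Pow (space M)" by auto
    then have "sets ?F = sigma_sets (space M) ?G" by (simp add: natural_filtration_def sets_measure_of)
    moreover have "Z n -` A \<inter> space M \<in> ?G" using A by auto
    ultimately show "Z n -` A \<inter> space ?F \<in> sets ?F" unfolding spF by (auto intro: sigma_sets.Basic)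
  qed simp
  then have "Z n \<in> measurable ?F borel_simplex"
    by (rule measurable_restrict_space2[rotated]) (use chain_in spF in auto)
  then show ?thesis using measurable_compose cont_measurable_simplex2[OF f] by blast
qed

text \<open>The Markov property, tested against functions of the present position only; this is all that the
  second moments below require.\<close>

lemma chain_step:
  assumes f: "continuous_on simplex2 f" and g: "continuous_on simplex2 g"
  shows "(\<integral>\<omega>. g (Z n \<omega>) * f (Z (Suc n) \<omega>) \<partial>M) = (\<integral>\<omega>. g (Z n \<omega>) * P f (Z n \<omega>) \<partial>M)"
proof -
  interpret prob_space M by (rule chain_prob)
  interpret S: finite_measure_subalgebra M "natural_filtration M Z n"
    by unfold_locales (rule filtration_subalgebra)
  have "(\<integral>\<omega>. g (Z n \<omega>) * f (Z (Suc n) \<omega>) \<partial>M)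
      = (\<integral>\<omega>. g (Z n \<omega>) * real_cond_exp M (natural_filtration M Z n) (\<lambda>\<omega>. f (Z (Suc n) \<omega>)) \<omega> \<partial>M)"
    using S.real_cond_exp_intg(2)[OF chain_integrable2[OF g f] filtration_measurable[OF g] chain_cont_measurable[OF f]]
    by simp
  also have "\<dots> = (\<integral>\<omega>. g (Z n \<omega>) * P f (Z n \<omega>) \<partial>M)"
  proof (rule integral_cong_AE)
    have "AE \<omega> in M. real_cond_exp M (natural_filtration M Z n) (\<lambda>\<omega>. f (Z (Suc n) \<omega>)) \<omega> = P f (Z n \<omega>)"
      using chain cont_bounded_measurable[OF f] unfolding df_chain_def by blast
    then show "AE \<omega> in M. g (Z n \<omega>) * real_cond_exp M (natural_filtration M Z n) (\<lambda>\<omega>. f (Z (Suc n) \<omega>)) \<omega>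
        = g (Z n \<omega>) * P f (Z n \<omega>)" by eventually_elim simp
  qed (use chain_cont_measurable[OF g] chain_cont_measurable[OF P_cont[OF f]] in auto)
  finally show ?thesis .
qed

lemma chain_expectation:
  assumes f: "continuous_on simplex2 f"
  shows "(\<integral>\<omega>. f (Z n \<omega>) \<partial>M) = (P ^^ n) f x"
  using f
proof (induction n arbitrary: f)
  case 0
  interpret prob_space M by (rule chain_prob)
  have "(\<integral>\<omega>. f (Z 0 \<omega>) \<partial>M) = (\<integral>\<omega>. f x \<partial>M)"
  proof (rule integral_cong_AE)
    have "AE \<omega> in M. Z 0 \<omega> = x" using chain by (simp add: df_chain_def)
    then show "AE \<omega> in M. f (Z 0 \<omega>) = f x" by eventually_elim simp
  qed (use chain_cont_measurable[OF 0] in auto)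
  then show ?case by (simp add: prob_space)
next
  case (Suc n)
  have "(\<integral>\<omega>. f (Z (Suc n) \<omega>) \<partial>M) = (\<integral>\<omega>. P f (Z n \<omega>) \<partial>M)"
    using chain_step[OF Suc.prems continuous_on_const[of _ 1]] by simp
  also have "\<dots> = (P ^^ n) (P f) x" by (rule Suc.IH[OF P_cont[OF Suc.prems]])
  finally show ?case by (simp add: funpow_swap1)
qed

text \<open>The distance from the union of the minimal absorbing sets vanishes on all of them, so it is a null
  function and its expectation along the chain decays geometrically. The sum of these distances is
  therefore almost surely finite.\<close>

lemma chain_dist_tendsto:
  "AE \<omega> in M. (\<lambda>n. infdist (Z n \<omega>) (\<Union> (minimal_absorbing p))) \<longlonglongrightarrow> 0"
proof -
  interpret prob_space M by (rule chain_prob)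
  let ?U = "\<Union> (minimal_absorbing p)"
  let ?d = "\<lambda>y. infdist y ?U"
  obtain K0 where K0: "K0 \<in> minimal_absorbing p" using absorbing_contains_minimal[OF absorbing_simplex2] .
  then obtain u where uK: "u \<in> K0" using minimal_absorbingD(4) by blast
  then have u: "u \<in> ?U" "u \<in> simplex2" using K0 minimal_absorbingD(2)[OF K0] by blast+
  have hb: "HB 2 (2 * 1) ?d"
  proof (rule lipschitz_HB)
    fix y y' :: point assume y: "y \<in> simplex2"
    have "?d y \<le> dist y u" by (rule infdist_le[OF u(1)])
    then show "\<bar>?d y\<bar> \<le> 2" using dist_simplex2_le[OF y u(2)] infdist_nonneg[of y ?U] by simp
    show "\<bar>?d y - ?d y'\<bar> \<le> 1 * dist y y'" using infdist_triangle_abs by simp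
  qed simp
  have cd: "continuous_on simplex2 ?d" by (rule HB_cont[OF hb])
  have "lim_val K ?d = 0" if K: "K \<in> minimal_absorbing p" for K
    by (rule lim_val_const_on[OF K hb]) (use K in \<open>auto intro!: infdist_zero\<close>)
  then have nf: "null_fun ?d" by (simp add: null_fun_def)
  obtain \<kappa> \<rho> where k: "\<kappa> > 0" "0 \<le> \<rho>" "\<rho> < 1"
    "\<forall>B C f n. HB B C f \<and> null_fun f \<longrightarrow> (\<forall>x\<in>simplex2. \<bar>(P ^^ n) f x\<bar> \<le> \<kappa> * \<rho> ^ n * (B + C))"
    by (rule null_fun_rate)
  have "summable (\<lambda>n. \<integral>\<omega>. ?d (Z n \<omega>) \<partial>M)"
  proof (rule summable_comparison_test')
    show "summable (\<lambda>n. (\<kappa> * (2 + 2 * 1)) * \<rho> ^ n)" using k by (intro geometric_summable) auto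
    show "norm (\<integral>\<omega>. ?d (Z n \<omega>) \<partial>M) \<le> (\<kappa> * (2 + 2 * 1)) * \<rho> ^ n" for n
      unfolding chain_expectation[OF cd]
      using k(4)[rule_format, OF conjI[OF hb nf] x, of n] by (simp add: mult_ac)
  qed
  then have "AE \<omega> in M. summable (\<lambda>n. ?d (Z n \<omega>))"
    by (intro AE_summable_of_summable_integrals chain_integrable cd infdist_nonneg)
  then show ?thesis by eventually_elim (rule summable_LIMSEQ_zero)
qed

text \<open>Along a harmonic Hoelder function \<open>h\<close> the increments are orthogonal to the past, so their second
  moments are the increments of the expectation of \<open>h\<^sup>2\<close>, which decay geometrically. Weighting with
  \<open>q ^ n\<close> turns this into almost sure absolute summability of the increments.\<close>

lemma chain_harmonic_converges:
  assumes h: "HB B C h" and harm: "\<And>y. y \<in> simplex2 \<Longrightarrow> P h y = h y"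
  shows "AE \<omega> in M. convergent (\<lambda>n. h (Z n \<omega>))"
proof -
  interpret prob_space M by (rule chain_prob)
  have ch: "continuous_on simplex2 h" by (rule HB_cont[OF h])
  define w where "w y = h y * h y" for y
  have w: "HB (B * B) (B * C + C * B) w" unfolding w_def by (rule HB_mult[OF h h])
  have cw: "continuous_on simplex2 w" by (rule HB_cont[OF w])
  define b where "b = B * B + (B * C + C * B)"
  have b0: "0 \<le> b" unfolding b_def using holder_bd_nonneg[OF w] holder_bd_const_nonneg[OF w] by (rule add_nonneg_nonneg)
  obtain \<kappa> \<rho>0 where k: "\<kappa> > 0" "0 \<le> \<rho>0" "\<rho>0 < 1"
    "\<forall>B C f n. HB B C f \<longrightarrow>
       (\<forall>x\<in>simplex2. \<bar>(P ^^ n) f x - orbit_lim f x\<bar> \<le> \<kappa> * \<rho>0 ^ n * (B + C))"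
    by (rule orbit_lim_rate)
  \<comment> \<open>kept away from 0, since the powers of \<open>q\<close> occur in denominators\<close>
  define \<rho> where "\<rho> = max \<rho>0 (1 / 2)"
  have \<rho>: "0 < \<rho>" "\<rho> < 1" "\<rho>0 \<le> \<rho>" using k by (auto simp: \<rho>_def)
  define q where "q = sqrt \<rho>"
  have q: "0 < q" "q < 1" "q * q = \<rho>" using \<rho> by (auto simp: q_def)
  define \<Delta> where "\<Delta> n \<omega> = h (Z (Suc n) \<omega>) - h (Z n \<omega>)" for n \<omega>
  have sq: "(\<Delta> n \<omega>)\<^sup>2 = w (Z (Suc n) \<omega>) - 2 * (h (Z n \<omega>) * h (Z (Suc n) \<omega>)) + w (Z n \<omega>)" for n \<omega>
    by (simp add: \<Delta>_def w_def power2_eq_square algebra_simps)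
  have int\<Delta>: "integrable M (\<lambda>\<omega>. (\<Delta> n \<omega>)\<^sup>2)" for n
    unfolding sq by (intro Bochner_Integration.integrable_add Bochner_Integration.integrable_diff
        integrable_mult_right chain_integrable chain_integrable2 cw ch)
  \<comment> \<open>the mixed term is evaluated with the Markov property and \<open>P h = h\<close>\<close>
  have E: "(\<integral>\<omega>. (\<Delta> n \<omega>)\<^sup>2 \<partial>M) = (P ^^ Suc n) w x - (P ^^ n) w x" for n
  proof -
    have "(\<integral>\<omega>. h (Z n \<omega>) * h (Z (Suc n) \<omega>) \<partial>M) = (\<integral>\<omega>. h (Z n \<omega>) * P h (Z n \<omega>) \<partial>M)"
      by (rule chain_step[OF ch ch])
    also have "\<dots> = (\<integral>\<omega>. w (Z n \<omega>) \<partial>M)"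
      by (rule Bochner_Integration.integral_cong[OF refl]) (simp add: harm chain_in w_def)
    finally have cross: "(\<integral>\<omega>. h (Z n \<omega>) * h (Z (Suc n) \<omega>) \<partial>M) = (\<integral>\<omega>. w (Z n \<omega>) \<partial>M)" .
    have "(\<integral>\<omega>. (\<Delta> n \<omega>)\<^sup>2 \<partial>M) = (\<integral>\<omega>. w (Z (Suc n) \<omega>) \<partial>M)
        - 2 * (\<integral>\<omega>. h (Z n \<omega>) * h (Z (Suc n) \<omega>) \<partial>M) + (\<integral>\<omega>. w (Z n \<omega>) \<partial>M)"
      unfolding sq using chain_integrable[OF cw] chain_integrable2[OF ch ch] by simp
    then show ?thesis unfolding cross chain_expectation[OF cw] by simp
  qed
  have bound: "(\<integral>\<omega>. (\<Delta> n \<omega>)\<^sup>2 \<partial>M) \<le> 2 * \<kappa> * b * \<rho> ^ n" for n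
  proof -
    have 1: "\<bar>(P ^^ n) w x - orbit_lim w x\<bar> \<le> \<kappa> * \<rho> ^ n * b" for n
    proof -
      have "\<bar>(P ^^ n) w x - orbit_lim w x\<bar> \<le> \<kappa> * \<rho>0 ^ n * b"
        using k(4)[rule_format, OF w x, of n] by (simp add: b_def)
      also have "\<dots> \<le> \<kappa> * \<rho> ^ n * b"
        using k(1,2) \<rho>(3) b0 by (intro mult_right_mono mult_left_mono power_mono) auto
      finally show ?thesis .
    qed
    have "\<kappa> * \<rho> ^ Suc n * b \<le> \<kappa> * \<rho> ^ n * b"
      using k(1) \<rho> b0 by (intro mult_right_mono mult_left_mono power_decreasing) auto
    then have "(P ^^ Suc n) w x - (P ^^ n) w x \<le> 2 * (\<kappa> * \<rho> ^ n * b)"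
      using 1[of n] 1[of "Suc n"] unfolding abs_le_iff by linarith
    then show ?thesis unfolding E by (simp add: mult_ac)
  qed
  have "AE \<omega> in M. summable (\<lambda>n. (\<Delta> n \<omega>)\<^sup>2 / q ^ n)"
  proof (rule AE_summable_of_summable_integrals)
    show "integrable M (\<lambda>\<omega>. (\<Delta> n \<omega>)\<^sup>2 / q ^ n)" for n by (rule integrable_divide_zero) (rule int\<Delta>)
    show "0 \<le> (\<Delta> n \<omega>)\<^sup>2 / q ^ n" for n \<omega> using q by simp
    show "summable (\<lambda>n. \<integral>\<omega>. (\<Delta> n \<omega>)\<^sup>2 / q ^ n \<partial>M)"
    proof (rule summable_comparison_test')
      show "summable (\<lambda>n. (2 * \<kappa> * b) * q ^ n)" using q by (intro geometric_summable) auto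
      fix n
      have "(\<integral>\<omega>. (\<Delta> n \<omega>)\<^sup>2 / q ^ n \<partial>M) = (\<integral>\<omega>. (\<Delta> n \<omega>)\<^sup>2 \<partial>M) / q ^ n" by simp
      also have "\<dots> \<le> (2 * \<kappa> * b * \<rho> ^ n) / q ^ n" using bound q by (intro divide_right_mono) auto
      also have "\<dots> = (2 * \<kappa> * b) * q ^ n" using q by (simp add: power_mult_distrib flip: q(3))
      finally have "(\<integral>\<omega>. (\<Delta> n \<omega>)\<^sup>2 / q ^ n \<partial>M) \<le> (2 * \<kappa> * b) * q ^ n" .
      moreover have "0 \<le> (\<integral>\<omega>. (\<Delta> n \<omega>)\<^sup>2 / q ^ n \<partial>M)"
        using q by (intro Bochner_Integration.integral_nonneg) simp
      ultimately show "norm (\<integral>\<omega>. (\<Delta> n \<omega>)\<^sup>2 / q ^ n \<partial>M) \<le> (2 * \<kappa> * b) * q ^ n" by simp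
    qed
  qed
  then show ?thesis
  proof eventually_elim
    case (elim \<omega>)
    have "summable (\<lambda>n. \<Delta> n \<omega>)"
    proof (rule summable_comparison_test')
      show "summable (\<lambda>n. (\<Delta> n \<omega>)\<^sup>2 / q ^ n + 1 * q ^ n)"
        using q by (intro summable_add elim geometric_summable) auto
      fix n
      let ?d = "\<bar>\<Delta> n \<omega>\<bar>"
      have qn: "q ^ n > 0" using q by simp
      \<comment> \<open>an increment is bounded by its weighted square, summable by \<open>elim\<close>, plus a geometric term\<close>
      have "?d * q ^ n \<le> ?d\<^sup>2 + (q ^ n)\<^sup>2"
        using sum_squares_bound[of ?d "q ^ n"] qn mult_nonneg_nonneg[of ?d "q ^ n"] by linarith
      then have "?d \<le> (?d\<^sup>2 + (q ^ n)\<^sup>2) / q ^ n" using qn by (simp add: pos_le_divide_eq)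
      also have "\<dots> = (\<Delta> n \<omega>)\<^sup>2 / q ^ n + 1 * q ^ n"
        using qn by (simp add: add_divide_distrib power2_eq_square)
      finally show "norm (\<Delta> n \<omega>) \<le> (\<Delta> n \<omega>)\<^sup>2 / q ^ n + 1 * q ^ n" by simp
    qed
    then have "(\<lambda>n. \<Sum>k<n. \<Delta> k \<omega>) \<longlonglongrightarrow> (\<Sum>k. \<Delta> k \<omega>)" by (rule summable_LIMSEQ)
    then have "(\<lambda>n. h (Z n \<omega>) - h (Z 0 \<omega>)) \<longlonglongrightarrow> (\<Sum>k. \<Delta> k \<omega>)"
      unfolding \<Delta>_def sum_lessThan_telescope[of "\<lambda>n. h (Z n \<omega>)"] .
    from tendsto_add[OF this tendsto_const[of "h (Z 0 \<omega>)"]]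
    show ?case by (auto simp: convergent_def)
  qed
qed

end

text \<open>If a sequence approaches the union of the minimal absorbing sets while all functions \<open>hit K\<close>
  converge along it, it approaches a single one of them. Every cluster point lies in some \<open>K\<close>, and this \<open>K\<close> can be
  recognized from the limits, because \<open>hit K\<close> is 1 on \<open>K\<close> and 0 on the others.\<close>

lemma approach_single:
  assumes z: "\<And>n. z n \<in> simplex2"
    and U: "(\<lambda>n. infdist (z n) (\<Union> (minimal_absorbing p))) \<longlonglongrightarrow> 0"
    and h: "\<And>K. K \<in> minimal_absorbing p \<Longrightarrow> (\<lambda>n. hit K (z n)) \<longlonglongrightarrow> l K"
  obtains K where "K \<in> minimal_absorbing p" "(\<lambda>n. infdist (z n) K) \<longlonglongrightarrow> 0"
    "\<forall>L\<in>minimal_absorbing p. (l L = (if L = K then 1 else 0)) \<and> (L \<noteq> K \<longrightarrow> \<not> (\<lambda>n. infdist (z n) L) \<longlonglongrightarrow> 0)"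
proof -
  let ?U = "\<Union> (minimal_absorbing p)"
  have clU: "closed ?U"
    using finite_minimal_absorbing minimal_absorbingD(3) compact_imp_closed by (intro closed_Union) auto
  have neU: "?U \<noteq> {}"
  proof -
    obtain K0 where K0: "K0 \<in> minimal_absorbing p" using absorbing_contains_minimal[OF absorbing_simplex2] .
    then show ?thesis using minimal_absorbingD(4)[OF K0] by blast
  qed
  have inK: "y \<in> K" if "closed K" "K \<noteq> {}" "(\<lambda>n. infdist (z n) K) \<longlonglongrightarrow> 0" "strict_mono r" "(z \<circ> r) \<longlonglongrightarrow> y"
    for y K r
  proof -
    have "(\<lambda>n. infdist ((z \<circ> r) n) K) \<longlonglongrightarrow> infdist y K" by (rule tendsto_infdist[OF that(5)])
    moreover have "(\<lambda>n. infdist ((z \<circ> r) n) K) \<longlonglongrightarrow> 0"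
      using LIMSEQ_subseq_LIMSEQ[OF that(3,4)] by (simp add: comp_def)
    ultimately have "infdist y K = 0" by (rule LIMSEQ_unique)
    then show ?thesis using in_closed_iff_infdist_zero[OF that(1,2)] by blast
  qed
  have cluster: "\<exists>K y r'. K \<in> minimal_absorbing p \<and> y \<in> K \<and> strict_mono r' \<and> (z \<circ> (r \<circ> r')) \<longlonglongrightarrow> y \<and>
      (\<forall>L\<in>minimal_absorbing p. l L = (if L = K then 1 else 0))" if r: "strict_mono r" for r :: "nat \<Rightarrow> nat"
  proof -
    have zr: "\<forall>n. (z \<circ> r) n \<in> simplex2" using z by simp
    obtain y r' where y: "y \<in> simplex2" "strict_mono (r' :: nat \<Rightarrow> nat)" "(z \<circ> r \<circ> r') \<longlonglongrightarrow> y"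
      using compact_imp_seq_compact[OF compact_simplex2] zr unfolding seq_compact_def by meson
    have rr: "strict_mono (r \<circ> r')" using r y(2) by (rule strict_mono_o)
    have y3: "(z \<circ> (r \<circ> r')) \<longlonglongrightarrow> y" using y(3) by (simp add: comp_assoc)
    have "y \<in> ?U" by (rule inK[OF clU neU U rr y3])
    then obtain K where K: "K \<in> minimal_absorbing p" "y \<in> K" by blast
    have "l L = (if L = K then 1 else 0)" if L: "L \<in> minimal_absorbing p" for L
    proof -
      obtain C where "HB 1 C (hit L)" using hit_HB[OF L] .
      then have "continuous_on simplex2 (hit L)" by (rule HB_cont)
      then have "(\<lambda>n. hit L ((z \<circ> (r \<circ> r')) n)) \<longlonglongrightarrow> hit L y"
        by (rule continuous_on_tendsto_compose[OF _ y3 y(1)]) (simp add: z)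
      moreover have "(\<lambda>n. hit L ((z \<circ> (r \<circ> r')) n)) \<longlonglongrightarrow> l L"
        using LIMSEQ_subseq_LIMSEQ[OF h[OF L] rr] by (simp add: comp_def)
      ultimately have "l L = hit L y" using LIMSEQ_unique by blast
      then show ?thesis using hit_on_minimal[OF L K] by auto
    qed
    then show ?thesis using K y(2) y3 by blast
  qed
  obtain K y r' where K: "K \<in> minimal_absorbing p" "y \<in> K" "strict_mono (r' :: nat \<Rightarrow> nat)" "(z \<circ> (id \<circ> r')) \<longlonglongrightarrow> y"
    "\<forall>L\<in>minimal_absorbing p. l L = (if L = K then 1 else 0)"
    using cluster[OF strict_mono_id] by blast
  have conv: "(\<lambda>n. infdist (z n) K) \<longlonglongrightarrow> 0"
  proof (rule ccontr)
    assume "\<not> ?thesis"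
    then obtain e where e: "e > 0" "\<forall>N. \<exists>n\<ge>N. \<not> infdist (z n) K < e"
      unfolding LIMSEQ_iff by (auto simp: infdist_nonneg)
    then have "infinite {n. \<not> infdist (z n) K < e}"
      unfolding infinite_nat_iff_unbounded_le by auto
    from infinite_enumerate[OF this] obtain r where r: "strict_mono (r :: nat \<Rightarrow> nat)"
      "\<forall>n. \<not> infdist (z (r n)) K < e" by auto
    obtain K' y' r'' where K': "K' \<in> minimal_absorbing p" "y' \<in> K'" "strict_mono (r'' :: nat \<Rightarrow> nat)"
      "(z \<circ> (r \<circ> r'')) \<longlonglongrightarrow> y'" "\<forall>L\<in>minimal_absorbing p. l L = (if L = K' then 1 else 0)"
      using cluster[OF r(1)] by blast
    have "K' = K" using K(5) K'(5) K(1) K'(1) by (metis zero_neq_one)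
    then have "infdist y' K = 0" using K'(2) by simp
    moreover have "(\<lambda>n. infdist ((z \<circ> (r \<circ> r'')) n) K) \<longlonglongrightarrow> infdist y' K" by (rule tendsto_infdist[OF K'(4)])
    ultimately have "\<forall>\<^sub>F n in sequentially. infdist ((z \<circ> (r \<circ> r'')) n) K < e"
      using e(1) by (intro order_tendstoD(2)) auto
    then show False using r(2) by (auto simp: eventually_sequentially)
  qed
  have other: "\<not> (\<lambda>n. infdist (z n) L) \<longlonglongrightarrow> 0" if L: "L \<in> minimal_absorbing p" "L \<noteq> K" for L
  proof
    assume "(\<lambda>n. infdist (z n) L) \<longlonglongrightarrow> 0"
    then have "y \<in> L"
      using K(3,4) minimal_absorbingD(3,4)[OF L(1)] compact_imp_closed
      by (intro inK[of L r']) auto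
    then show False using minimal_absorbing_disjoint[OF L(1) K(1) L(2)] K(2) by blast
  qed
  show thesis using that[OF K(1) conv] K(5) other by blast
qed

text \<open>As \<open>hit K\<close> is harmonic, the expectation of \<open>hit K (Z n)\<close> is \<open>hit K x\<close> for all \<open>n\<close>; its limit is the
  probability of approaching \<open>K\<close>, since \<open>hit K (Z n)\<close> converges to the indicator of this event.\<close>

lemma chain_absorption:
  assumes chain: "df_chain p x M Z" and x: "x \<in> simplex2"
  shows "AE \<omega> in M. \<exists>K\<in>minimal_absorbing p. (\<lambda>n. infdist (Z n \<omega>) K) \<longlonglongrightarrow> 0 \<and>
      (\<forall>L\<in>minimal_absorbing p. L \<noteq> K \<longrightarrow> \<not> (\<lambda>n. infdist (Z n \<omega>) L) \<longlonglongrightarrow> 0)"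
    and "K \<in> minimal_absorbing p \<Longrightarrow>
      measure M {\<omega>\<in>space M. (\<lambda>n. infdist (Z n \<omega>) K) \<longlonglongrightarrow> 0} = hit K x"
proof -
  interpret prob_space M by (rule chain_prob[OF chain x])
  have conv: "AE \<omega> in M. \<forall>K\<in>minimal_absorbing p. convergent (\<lambda>n. hit K (Z n \<omega>))"
  proof (rule AE_finite_allI[OF finite_minimal_absorbing])
    fix K assume K: "K \<in> minimal_absorbing p"
    obtain C where C: "HB 1 C (hit K)" using hit_HB[OF K] .
    show "AE \<omega> in M. convergent (\<lambda>n. hit K (Z n \<omega>))"
      by (rule chain_harmonic_converges[OF chain x C hit_harmonic[OF K]])
  qed
  have main: "AE \<omega> in M. \<exists>K\<in>minimal_absorbing p. (\<lambda>n. infdist (Z n \<omega>) K) \<longlonglongrightarrow> 0 \<and>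
      (\<forall>L\<in>minimal_absorbing p. (lim (\<lambda>n. hit L (Z n \<omega>)) = (if L = K then 1 else 0)) \<and>
         (\<lambda>n. hit L (Z n \<omega>)) \<longlonglongrightarrow> lim (\<lambda>n. hit L (Z n \<omega>)) \<and>
         (L \<noteq> K \<longrightarrow> \<not> (\<lambda>n. infdist (Z n \<omega>) L) \<longlonglongrightarrow> 0))"
    using conv chain_dist_tendsto[OF chain x] AE_space
  proof eventually_elim
    case (elim \<omega>)
    have lims: "(\<lambda>n. hit L (Z n \<omega>)) \<longlonglongrightarrow> lim (\<lambda>n. hit L (Z n \<omega>))" if "L \<in> minimal_absorbing p" for L
      using elim(1) that by (simp add: convergent_LIMSEQ_iff)
    obtain K where "K \<in> minimal_absorbing p" "(\<lambda>n. infdist (Z n \<omega>) K) \<longlonglongrightarrow> 0"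
      "\<forall>L\<in>minimal_absorbing p. (lim (\<lambda>n. hit L (Z n \<omega>)) = (if L = K then 1 else 0)) \<and>
         (L \<noteq> K \<longrightarrow> \<not> (\<lambda>n. infdist (Z n \<omega>) L) \<longlonglongrightarrow> 0)"
      using approach_single[OF chain_in[OF chain x elim(3)] elim(2) lims] .
    then show ?case using lims by blast
  qed
  show "AE \<omega> in M. \<exists>K\<in>minimal_absorbing p. (\<lambda>n. infdist (Z n \<omega>) K) \<longlonglongrightarrow> 0 \<and>
      (\<forall>L\<in>minimal_absorbing p. L \<noteq> K \<longrightarrow> \<not> (\<lambda>n. infdist (Z n \<omega>) L) \<longlonglongrightarrow> 0)"
    using main by eventually_elim blast
  assume K: "K \<in> minimal_absorbing p"
  obtain C where C: "HB 1 C (hit K)" using hit_HB[OF K] .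
  have ch: "continuous_on simplex2 (hit K)" by (rule HB_cont[OF C])
  let ?E = "{\<omega>\<in>space M. (\<lambda>n. infdist (Z n \<omega>) K) \<longlonglongrightarrow> 0}"
  have mi: "(\<lambda>\<omega>. infdist (Z n \<omega>) K) \<in> borel_measurable M" for n
    by (rule chain_cont_measurable[OF chain x]) (intro continuous_on_infdist continuous_on_id)
  have E: "?E \<in> sets M"
    using mi by measurable
  have "(\<lambda>n. \<integral>\<omega>. hit K (Z n \<omega>) \<partial>M) \<longlonglongrightarrow> (\<integral>\<omega>. indicator ?E \<omega> \<partial>M)"
  proof (rule integral_dominated_convergence[where w = "\<lambda>_. 1"])
    show "AE \<omega> in M. (\<lambda>n. hit K (Z n \<omega>)) \<longlonglongrightarrow> indicator ?E \<omega>"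
      using main AE_space
    proof eventually_elim
      case (elim \<omega>)
      then obtain L where L: "L \<in> minimal_absorbing p" "(\<lambda>n. infdist (Z n \<omega>) L) \<longlonglongrightarrow> 0"
        "\<forall>L'\<in>minimal_absorbing p. (lim (\<lambda>n. hit L' (Z n \<omega>)) = (if L' = L then 1 else 0)) \<and>
         (\<lambda>n. hit L' (Z n \<omega>)) \<longlonglongrightarrow> lim (\<lambda>n. hit L' (Z n \<omega>)) \<and>
         (L' \<noteq> L \<longrightarrow> \<not> (\<lambda>n. infdist (Z n \<omega>) L') \<longlonglongrightarrow> 0)" by blast
      have LK: "lim (\<lambda>n. hit K (Z n \<omega>)) = (if K = L then 1 else 0)"
        "(\<lambda>n. hit K (Z n \<omega>)) \<longlonglongrightarrow> lim (\<lambda>n. hit K (Z n \<omega>))"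
        "K \<noteq> L \<longrightarrow> \<not> (\<lambda>n. infdist (Z n \<omega>) K) \<longlonglongrightarrow> 0"
        using bspec[OF L(3) K] by blast+
      have ind: "indicator ?E \<omega> = (if K = L then 1 else 0 :: real)"
        using L(2) LK(3) elim(2) by (cases "K = L") (simp_all add: indicator_def)
      show ?case using LK(2) unfolding LK(1) ind .
    qed
    show "AE \<omega> in M. norm (hit K (Z n \<omega>)) \<le> 1" for n
      using hit_nonneg[OF K chain_in[OF chain x]] hit_le_1[OF K chain_in[OF chain x]] by (intro AE_I2) auto
  qed (use chain_cont_measurable[OF chain x ch] E in auto)
  moreover have "(\<integral>\<omega>. hit K (Z n \<omega>) \<partial>M) = hit K x" for n
  proof -
    have "(P ^^ n) (hit K) y = hit K y" if "y \<in> simplex2" for y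
      using that
    proof (induction n arbitrary: y)
      case (Suc n)
      have "P ((P ^^ n) (hit K)) y = P (hit K) y"
        by (rule P_cong[OF absorbing_simplex2 Pn_cont[OF ch] ch Suc.IH Suc.prems])
      then show ?case using hit_harmonic[OF K Suc.prems] by simp
    qed simp
    then show ?thesis using chain_expectation[OF chain x ch] x by simp
  qed
  ultimately have "hit K x = (\<integral>\<omega>. indicator ?E \<omega> \<partial>M)" by (simp add: LIMSEQ_const_iff)
  then show "measure M ?E = hit K x" using E by simp
qed

text \<open>If all minimal absorbing sets are vertices, approaching one of them is convergence. On the null
  set without convergence the limit variable takes some vertex \<open>v0\<close> as value, in order to be vertex-valued
  everywhere.\<close>

lemma chain_vertex_limit:
  assumes chain: "df_chain p x M Z" and x: "x \<in> simplex2"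
    and V: "minimal_absorbing p = (\<lambda>i. {vertex i}) ` I"
  shows "\<exists>Zinf\<in>borel_measurable M. (\<forall>\<omega>\<in>space M. Zinf \<omega> \<in> vertex ` I) \<and>
    (AE \<omega> in M. (\<lambda>n. Z n \<omega>) \<longlonglongrightarrow> Zinf \<omega>) \<and>
    (\<forall>i\<in>I. measure M {\<omega>\<in>space M. Zinf \<omega> = vertex i} = hit {vertex i} x)"
proof -
  interpret prob_space M by (rule chain_prob[OF chain x])
  have finI: "finite (vertex ` I)"
  proof -
    have "(\<lambda>v. {v}) ` vertex ` I = minimal_absorbing p" unfolding V by auto
    then show ?thesis using finite_minimal_absorbing finite_imageD[of "\<lambda>v. {v}" "vertex ` I"] by (auto simp: inj_on_def)
  qed
  obtain v0 where v0: "v0 \<in> vertex ` I"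
  proof -
    obtain K0 where K0: "K0 \<in> minimal_absorbing p" using absorbing_contains_minimal[OF absorbing_simplex2] .
    then show thesis using that unfolding V by blast
  qed
  note mZ = chain_measurable_borel[OF chain x]
  have mi: "(\<lambda>\<omega>. infdist (Z n \<omega>) K) \<in> borel_measurable M" for n K
    by (rule chain_cont_measurable[OF chain x]) (intro continuous_on_infdist continuous_on_id)
  have E: "{\<omega>\<in>space M. (\<lambda>n. infdist (Z n \<omega>) {v}) \<longlonglongrightarrow> 0} \<in> sets M" for v
    using mi by measurable
  have cE: "{\<omega>\<in>space M. \<exists>v\<in>vertex ` I. (\<lambda>n. Z n \<omega>) \<longlonglongrightarrow> v} \<in> sets M"
  proof -
    have "{\<omega>\<in>space M. \<exists>v\<in>vertex ` I. (\<lambda>n. Z n \<omega>) \<longlonglongrightarrow> v}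
        = (\<Union>v\<in>vertex ` I. {\<omega>\<in>space M. (\<lambda>n. infdist (Z n \<omega>) {v}) \<longlonglongrightarrow> 0})"
      unfolding tendsto_iff_infdist_singleton by auto
    then show ?thesis using E finI by auto
  qed
  define Zinf where "Zinf \<omega> = (if \<exists>v\<in>vertex ` I. (\<lambda>n. Z n \<omega>) \<longlonglongrightarrow> v then lim (\<lambda>n. Z n \<omega>) else v0)" for \<omega>
  have m: "Zinf \<in> borel_measurable M"
    unfolding Zinf_def[abs_def]
    by (rule measurable_If[OF borel_measurable_lim_metric[OF mZ] _ cE]) simp
  have ae: "AE \<omega> in M. \<exists>v\<in>vertex ` I. (\<lambda>n. Z n \<omega>) \<longlonglongrightarrow> v"
    using chain_absorption(1)[OF chain x]
    by eventually_elim (auto simp: V tendsto_iff_infdist_singleton simp del: infdist_singleton)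
  have Zl: "Zinf \<omega> = v" if "v \<in> vertex ` I" "(\<lambda>n. Z n \<omega>) \<longlonglongrightarrow> v" for v \<omega>
    using that limI[OF that(2)] unfolding Zinf_def by auto
  have in_I: "Zinf \<omega> \<in> vertex ` I" for \<omega>
  proof (cases "\<exists>v\<in>vertex ` I. (\<lambda>n. Z n \<omega>) \<longlonglongrightarrow> v")
    case True
    then obtain v where v: "v \<in> vertex ` I" "(\<lambda>n. Z n \<omega>) \<longlonglongrightarrow> v" by blast
    then show ?thesis unfolding Zl[OF v] by blast
  qed (use v0 in \<open>simp add: Zinf_def\<close>)
  have "AE \<omega> in M. (\<lambda>n. Z n \<omega>) \<longlonglongrightarrow> Zinf \<omega>"
    using ae
  proof eventually_elim
    case (elim \<omega>)
    then obtain v where v: "v \<in> vertex ` I" "(\<lambda>n. Z n \<omega>) \<longlonglongrightarrow> v" by blast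
    show ?case unfolding Zl[OF v] by (rule v(2))
  qed
  moreover have "measure M {\<omega>\<in>space M. Zinf \<omega> = vertex i} = hit {vertex i} x" if i: "i \<in> I" for i
  proof -
    have K: "{vertex i} \<in> minimal_absorbing p" unfolding V using i by blast
    have "measure M {\<omega>\<in>space M. Zinf \<omega> = vertex i}
        = measure M {\<omega>\<in>space M. (\<lambda>n. infdist (Z n \<omega>) {vertex i}) \<longlonglongrightarrow> 0}"
    proof (rule finite_measure_eq_AE)
      show "AE \<omega> in M. \<omega> \<in> {\<omega>\<in>space M. Zinf \<omega> = vertex i}
          \<longleftrightarrow> \<omega> \<in> {\<omega>\<in>space M. (\<lambda>n. infdist (Z n \<omega>) {vertex i}) \<longlonglongrightarrow> 0}"
        unfolding tendsto_iff_infdist_singleton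
        using ae
      proof eventually_elim
        case (elim \<omega>)
        then obtain v where v: "v \<in> vertex ` I" "(\<lambda>n. Z n \<omega>) \<longlonglongrightarrow> v" by blast
        have "vertex i = v \<longleftrightarrow> (\<lambda>n. Z n \<omega>) \<longlonglongrightarrow> vertex i" using v(2) LIMSEQ_unique by blast
        then show ?case using Zl[OF v] by auto
      qed
      show "{\<omega>\<in>space M. Zinf \<omega> = vertex i} \<in> sets M"
        using measurable_sets[OF m, of "{vertex i}"] by (simp add: vimage_def Int_def conj_commute)
    qed (rule E)
    also have "\<dots> = hit {vertex i} x" by (rule chain_absorption(2)[OF chain x K])
    finally show ?thesis .
  qed
  ultimately show ?thesis using m in_I by blast
qed

end

section \<open>Classification of the minimal absorbing sets\<close>

lemma vertex_inj: "i \<in> {0,1,2} \<Longrightarrow> j \<in> {0,1,2} \<Longrightarrow> vertex i = vertex j \<longleftrightarrow> i = j"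
  by (metis bary_vertex zero_neq_one)

lemma interior_simplex2_iff:
  "z \<in> interior simplex2 \<longleftrightarrow> z \<in> simplex2 \<and> (\<forall>k\<in>{0,1,2}. 0 < bary k z)"
proof
  assume z: "z \<in> interior simplex2"
  have "0 < bary k z" if k: "k \<in> {0,1,2}" for k
  proof (rule ccontr)
    assume "\<not> ?thesis"
    moreover have "0 \<le> bary k z" using z interior_subset bary_nonneg by blast
    ultimately have b0: "bary k z = 0" by simp
    obtain e where e: "e > 0" "ball z e \<subseteq> simplex2" using z mem_interior by blast
    \<comment> \<open>a step away from the vertex \<open>k\<close> that is short enough to stay in the ball but would make the
      coordinate \<open>k\<close> negative\<close>
    define d where "d = e / (2 * (1 + dist z (vertex k)))"
    have d: "d > 0" using e(1) by (simp add: d_def add_pos_nonneg)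
    let ?y = "(1 + d) *\<^sub>R z + (1 - (1 + d)) *\<^sub>R vertex k"
    have "?y - z = d *\<^sub>R (z - vertex k)" by (simp add: algebra_simps)
    then have "norm (?y - z) = d * norm (z - vertex k)" using d by (simp only: norm_scaleR abs_of_pos)
    then have "dist z ?y = d * dist z (vertex k)" by (simp only: dist_norm norm_minus_commute)
    also have "\<dots> < d * (2 * (1 + dist z (vertex k)))" 
      by (rule mult_strict_left_mono[OF _ d]) (use zero_le_dist[of z "vertex k"] in argo)
    also have "\<dots> = e" by (simp add: d_def add_nonneg_eq_0_iff)
    finally have "?y \<in> simplex2" using e(2) by auto
    then have "0 \<le> bary k ?y" by (rule bary_nonneg)
    also have "bary k ?y = - d" unfolding bary_affine using b0 bary_vertex[OF k k] by simp
    finally show False using d by simp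
  qed
  then show "z \<in> simplex2 \<and> (\<forall>k\<in>{0,1,2}. 0 < bary k z)" using z interior_subset by blast
next
  assume z: "z \<in> simplex2 \<and> (\<forall>k\<in>{0,1,2}. 0 < bary k z)"
  show "z \<in> interior simplex2"
  proof (rule interiorI)
    show "open {z. 0 < bary 0 z \<and> 0 < bary 1 z \<and> 0 < bary 2 z}"
      by (intro open_Collect_conj open_Collect_less continuous_intros bary_cont)
    show "{z. 0 < bary 0 z \<and> 0 < bary 1 z \<and> 0 < bary 2 z} \<subseteq> simplex2"
      by (auto simp: bary_def simplex2_def)
  qed (use z in auto)
qed

lemma edge_not_interior:
  assumes "i \<in> {0,1,2}" "j \<in> {0,1,2}" "x \<in> edge i j"
  shows "x \<notin> interior simplex2"
proof (cases "i = j")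
  case True
  then have x: "x = vertex i" using assms(3) by simp
  obtain k where k: "k \<in> {0,1,2}" "k \<noteq> i" using assms(1) by (metis insertCI zero_neq_one)
  show ?thesis unfolding interior_simplex2_iff x using bary_vertex[OF k(1) assms(1)] k by force
next
  case False
  obtain k where k: "k \<in> {0,1,2}" "k \<noteq> i" "k \<noteq> j" "{i,j,k} = {0,1,2}" by (rule third_vertex[OF assms(1,2) False])
  show ?thesis
    unfolding interior_simplex2_iff
    using iffD1[OF edge_iff[OF assms(1,2) k(1) False k(2,3)] assms(3)] k(1) by (metis less_irrefl)
qed

context df_weights
begin

text \<open>From a vertex \<open>i\<close> the chain either never moves or can move along a whole edge.\<close>

lemma minimal_vertex_or_edge:
  assumes K: "K \<in> minimal_absorbing p" and i: "i \<in> {0,1,2}" "vertex i \<in> K"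
  shows "K = {vertex i} \<or> (\<exists>j\<in>{0,1,2}. j \<noteq> i \<and> edge i j \<subseteq> K)"
proof (cases "p i (vertex i) = 1")
  case True
  then have "absorbing p {vertex i}" using vertex_absorbing[OF i(1)] by simp
  then show ?thesis using K i(2) unfolding minimal_absorbing_def by blast
next
  case False
  have "\<exists>j\<in>{0,1,2}. j \<noteq> i \<and> 0 < p j (vertex i)"
  proof (rule ccontr)
    assume no: "\<not> ?thesis"
    have "p j (vertex i) = 0" if "j \<in> {0,1,2}" "j \<noteq> i" for j
      using no nonneg[OF that(1) vertex_simplex2, of i] that by force
    then show False using sum_one[OF vertex_simplex2, of i] i(1) False by auto
  qed
  then obtain j where j: "j \<in> {0,1,2}" "j \<noteq> i" "0 < p j (vertex i)" by blast
  have "edge i j \<subseteq> K"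
  proof
    fix y assume "y \<in> edge i j"
    then obtain u where u: "0 \<le> u" "u \<le> 1" "y = (1 - u) *\<^sub>R vertex i + u *\<^sub>R vertex j"
      by (auto simp: closed_segment_def)
    then show "y \<in> K"
      using absorbing_move[OF minimal_absorbingD(1)[OF K] i(2) j(1,3), of "1 - u"] by simp
  qed
  then show ?thesis using j by blast
qed

lemma edge_absorbing:
  assumes ijk: "i \<in> {0,1,2}" "j \<in> {0,1,2}" "k \<in> {0,1,2}" "i \<noteq> j" "{i,j,k} = {0,1,2}"
    and z: "\<And>x. x \<in> edge i j \<Longrightarrow> p k x = 0"
  shows "absorbing p (edge i j)"
  unfolding absorbing_iff
proof (intro conjI ballI impI)
  fix x l t assume x: "x \<in> edge i j" and l: "l \<in> {0,1,2}" "0 < p l x" and t: "t \<in> {0..1::real}"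
  have "l \<noteq> k" using z[OF x] l(2) by auto
  moreover have "l \<in> {i,j,k}" using l(1) unfolding ijk(5) .
  ultimately have "l = i \<or> l = j" by blast
  then have "vertex l \<in> edge i j" by auto
  then have "(1 - (1 - t)) *\<^sub>R x + (1 - t) *\<^sub>R vertex l \<in> edge i j"
    using t by (intro convexD_alt convex_closed_segment x) auto
  then show "t *\<^sub>R x + (1 - t) *\<^sub>R vertex l \<in> edge i j" by simp
qed (use edge_subset in auto)

text \<open>An absorbing set containing an edge but no interior point of the triangle cannot leave the edge
  towards the opposite vertex, so the edge itself is absorbing. From an inner point of the edge a
  positive weight of the opposite vertex would lead into the interior; the end points follow by
  continuity of the weight.\<close>

lemma minimal_edge:
  assumes K: "K \<in> minimal_absorbing p" and ij: "i \<in> {0,1,2}" "j \<in> {0,1,2}" "i \<noteq> j"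
    and sub: "edge i j \<subseteq> K" and int: "K \<inter> interior simplex2 = {}"
  shows "K = edge i j"
proof -
  obtain k where k: "k \<in> {0,1,2}" "k \<noteq> i" "k \<noteq> j" "{i,j,k} = {0,1,2}" by (rule third_vertex[OF ij])
  have open0: "p k (edge_point i j u) = 0" if u: "u \<in> {0<..<1}" for u
  proof (rule ccontr)
    have xe: "edge_point i j u \<in> edge i j" using u by (intro edge_point_in_edge) auto
    then have xs: "edge_point i j u \<in> simplex2" using edge_subset by blast
    assume "p k (edge_point i j u) \<noteq> 0"
    then have "0 < p k (edge_point i j u)" using nonneg[OF k(1) xs] by simp
    then have y: "(1/2) *\<^sub>R edge_point i j u + (1 - 1/2) *\<^sub>R vertex k \<in> K" (is "?y \<in> K")
      by (rule absorbing_move[OF minimal_absorbingD(1)[OF K] subsetD[OF sub xe] k(1)]) simp_all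
    have "0 < bary l ?y" if l: "l \<in> {0,1,2}" for l
    proof -
      have "l \<in> {i,j,k}" using l unfolding k(4) .
      then have "l = i \<or> l = j \<or> l = k" by blast
      then show ?thesis
        unfolding bary_affine bary_vertex[OF l ij(1)] bary_vertex[OF l ij(2)] bary_vertex[OF l k(1)]
        using ij(3) k(2,3) u by (elim disjE) simp_all
    qed
    then have "?y \<in> interior simplex2"
      unfolding interior_simplex2_iff using y minimal_absorbingD(2)[OF K] by blast
    then show False using y int by blast
  qed
  have "p k (edge_point i j u) = 0" if "u \<in> {0..1}" for u
  proof (rule continuous_constant_on_closure[where S = "{0<..<1::real}" and f = "\<lambda>u. p k (edge_point i j u)"])
    show "continuous_on (closure {0<..<1}) (\<lambda>u. p k (edge_point i j u))"
      using weight_edge_cont[OF k(1)] by (simp add: closure_greaterThanLessThan)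
  qed (use open0 that in \<open>auto simp: closure_greaterThanLessThan\<close>)
  moreover have "\<exists>u\<in>{0..1}. x = edge_point i j u" if "x \<in> edge i j" for x
  proof -
    obtain u where "0 \<le> u" "u \<le> 1" "x = (1 - u) *\<^sub>R vertex i + u *\<^sub>R vertex j"
      using \<open>x \<in> edge i j\<close> by (auto simp: closed_segment_def)
    then show ?thesis by (intro bexI[of _ "1 - u"]) auto
  qed
  ultimately have "absorbing p (edge i j)"
    by (intro edge_absorbing[OF ij(1,2) k(1) ij(3) k(4)]) blast
  then show ?thesis using K sub unfolding minimal_absorbing_def by blast
qed

text \<open>Such a set \<open>K\<close> contains an edge and is different from it. By minimality the edge is not absorbing,
  so the opposite vertex has positive weight somewhere on it and lies in \<open>K\<close>. Thus \<open>K\<close> contains all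
  vertices and meets every absorbing set, while different minimal ones are disjoint.\<close>

lemma minimal_interior_unique:
  assumes K: "K \<in> minimal_absorbing p" and int: "K \<inter> interior simplex2 \<noteq> {}"
  shows "minimal_absorbing p = {K}"
proof -
  obtain i where i: "i \<in> {0,1,2}" "vertex i \<in> K" by (rule absorbing_has_vertex[OF minimal_absorbingD(1)[OF K]])
  have "K \<noteq> {vertex i}" using int edge_not_interior[OF i(1) i(1), of "vertex i"] by auto
  then obtain j where j: "j \<in> {0,1,2}" "j \<noteq> i" "edge i j \<subseteq> K" using minimal_vertex_or_edge[OF K i] by blast
  obtain k where k: "k \<in> {0,1,2}" "k \<noteq> i" "k \<noteq> j" "{i,j,k} = {0,1,2}"
    by (rule third_vertex[OF i(1) j(1) j(2)[symmetric]])
  have kK: "vertex k \<in> K"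
  proof (rule ccontr)
    assume no: "vertex k \<notin> K"
    have "p k x = 0" if x: "x \<in> edge i j" for x
    proof (rule ccontr)
      assume "p k x \<noteq> 0"
      moreover have "x \<in> simplex2" using x edge_subset by blast
      ultimately have pos: "0 < p k x" using nonneg[OF k(1), of x] by simp
      show False
        using absorbing_move[OF minimal_absorbingD(1)[OF K] subsetD[OF j(3) x] k(1) pos, of 0] no by simp
    qed
    then have "absorbing p (edge i j)" by (rule edge_absorbing[OF i(1) j(1) k(1) j(2)[symmetric] k(4)])
    then have "edge i j = K" using K j(3) unfolding minimal_absorbing_def by blast
    then show False using int edge_not_interior[OF i(1) j(1)] by blast
  qed
  have jK: "vertex j \<in> K" using j(3) by auto
  have all: "vertex l \<in> K" if l: "l \<in> {0,1,2}" for l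
  proof -
    have "l \<in> {i,j,k}" using l unfolding k(4) .
    then show ?thesis using i(2) jK kK by blast
  qed
  have "L = K" if L: "L \<in> minimal_absorbing p" for L
  proof -
    obtain l where "l \<in> {0,1,2}" "vertex l \<in> L" by (rule absorbing_has_vertex[OF minimal_absorbingD(1)[OF L]])
    then show ?thesis using all minimal_absorbing_disjoint[OF L K] by blast
  qed
  then show ?thesis using K by blast
qed

text \<open>If no minimal absorbing set meets the interior, they are all vertices or edges; as they are
  disjoint, an edge leaves room only for the opposite vertex.\<close>

lemma minimal_absorbing_classification:
  "(minimal_absorbing p = {{vertex 0}, {vertex 1}, {vertex 2}} \<or>
      (\<exists>i\<in>{0, 1, 2}. \<exists>j\<in>{0, 1, 2}. i \<noteq> j \<and> minimal_absorbing p = {{vertex i}, {vertex j}}) \<or>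
      (\<exists>i\<in>{0, 1, 2}. minimal_absorbing p = {{vertex i}}) \<or>
      (\<exists>i\<in>{0, 1, 2}. \<exists>j\<in>{0, 1, 2}. i \<noteq> j \<and> minimal_absorbing p = {edge i j}) \<or>
      (\<exists>i j k. {i, j, k} = {0, 1, 2} \<and> minimal_absorbing p = {{vertex k}, edge i j}) \<or>
      (\<exists>K. K \<inter> interior simplex2 \<noteq> {} \<and> minimal_absorbing p = {K}))"
  (is "?A \<or> ?B \<or> ?C \<or> ?D \<or> ?E \<or> ?F")
proof (cases "\<exists>K\<in>minimal_absorbing p. K \<inter> interior simplex2 \<noteq> {}")
  case True
  then have ?F using minimal_interior_unique by blast
  then show ?thesis by blast
next
  case False
  have shape: "K = {vertex i} \<or> (\<exists>j\<in>{0,1,2}. j \<noteq> i \<and> K = edge i j)"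
    if K: "K \<in> minimal_absorbing p" and i: "i \<in> {0,1,2}" "vertex i \<in> K" for K i
    using minimal_vertex_or_edge[OF K i]
  proof
    assume "\<exists>j\<in>{0,1,2}. j \<noteq> i \<and> edge i j \<subseteq> K"
    then obtain j where j: "j \<in> {0,1,2}" "j \<noteq> i" "edge i j \<subseteq> K" by blast
    have "K \<inter> interior simplex2 = {}" using False K by blast
    from minimal_edge[OF K i(1) j(1) j(2)[symmetric] j(3) this] show ?thesis using j(1,2) by blast
  qed blast
  show ?thesis
  proof (cases "\<exists>i\<in>{0,1,2}. \<exists>j\<in>{0,1,2}. i \<noteq> j \<and> edge i j \<in> minimal_absorbing p")
    case True
    then obtain i j where ij: "i \<in> {0,1,2}" "j \<in> {0,1,2}" "i \<noteq> j" "edge i j \<in> minimal_absorbing p" by blast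
    obtain k where k: "k \<in> {0,1,2}" "k \<noteq> i" "k \<noteq> j" "{i,j,k} = {0,1,2}" by (rule third_vertex[OF ij(1-3)])
    have other: "L = {vertex k}" if L: "L \<in> minimal_absorbing p" "L \<noteq> edge i j" for L
    proof -
      have dis: "L \<inter> edge i j = {}" using minimal_absorbing_disjoint[OF L(1) ij(4) L(2)] .
      obtain l where l: "l \<in> {0,1,2}" "vertex l \<in> L" by (rule absorbing_has_vertex[OF minimal_absorbingD(1)[OF L(1)]])
      have only: "m = k" if m: "m \<in> {0,1,2}" "vertex m \<in> L" for m
      proof -
        have "m \<noteq> i" "m \<noteq> j" using dis m(2) by auto
        moreover have "m \<in> {i,j,k}" using m(1) unfolding k(4) .
        ultimately show ?thesis by blast
      qed
      have lk: "l = k" by (rule only[OF l])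
      show ?thesis using shape[OF L(1) l]
      proof
        assume "\<exists>m\<in>{0,1,2}. m \<noteq> l \<and> L = edge l m"
        then obtain m where m: "m \<in> {0,1,2}" "m \<noteq> l" "L = edge l m" by blast
        then have "vertex m \<in> L" by simp
        from only[OF m(1) this] show ?thesis using m(2) lk by simp
      qed (use lk in blast)
    qed
    show ?thesis
    proof (cases "{vertex k} \<in> minimal_absorbing p")
      case True
      then have "minimal_absorbing p = {{vertex k}, edge i j}" using other ij(4) by blast
      then have ?E using k(4) by (intro exI[of _ i] exI[of _ j] exI[of _ k] conjI)
      then show ?thesis by blast
    next
      case False
      then have "minimal_absorbing p = {edge i j}" using other ij(4) by blast
      then have ?D using ij(1-3) by (intro bexI[of _ i] bexI[of _ j] conjI)
      then show ?thesis by blast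
    qed
  next
    case noedge: False
    define I where "I = {i\<in>{0,1,2}. {vertex i} \<in> minimal_absorbing p}"
    have M: "minimal_absorbing p = (\<lambda>i. {vertex i}) ` I"
    proof
      show "minimal_absorbing p \<subseteq> (\<lambda>i. {vertex i}) ` I"
      proof
        fix K assume K: "K \<in> minimal_absorbing p"
        obtain i where i: "i \<in> {0,1,2}" "vertex i \<in> K" by (rule absorbing_has_vertex[OF minimal_absorbingD(1)[OF K]])
        have "K = {vertex i}"
          using shape[OF K i]
        proof
          assume "\<exists>j\<in>{0,1,2}. j \<noteq> i \<and> K = edge i j"
          then obtain j where "j \<in> {0,1,2}" "i \<noteq> j" "K = edge i j" by metis
          then show ?thesis using noedge i(1) K by blast
        qed
        then show "K \<in> (\<lambda>i. {vertex i}) ` I" using K i(1) unfolding I_def by blast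
      qed
    qed (auto simp: I_def)
    obtain K0 where K0: "K0 \<in> minimal_absorbing p" using absorbing_contains_minimal[OF absorbing_simplex2] .
    have "I \<noteq> {}" using K0 M by auto
    moreover have "I \<subseteq> {0,1,2}" by (auto simp: I_def)
    ultimately have "I \<in> Pow {0,1,2} - {{}}" by blast
    then have shapes: "I = {0,1,2} \<or> I = {0,1} \<or> I = {0,2} \<or> I = {1,2} \<or> I = {0} \<or> I = {1} \<or> I = {2}"
      unfolding Pow_insert Pow_empty by auto
    have A: "?A" if "I = {0,1,2}" using M unfolding that by simp
    have B: "?B" if "I = {a,b}" "a \<in> {0,1,2}" "b \<in> {0,1,2}" "a \<noteq> b" for a b
      using M that(2-4) unfolding that(1) by (intro bexI[of _ a] bexI[of _ b]) simp_all
    have C: "?C" if "I = {a}" "a \<in> {0,1,2}" for a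
      using M that(2) unfolding that(1) by (intro bexI[of _ a]) simp_all
    have "?A \<or> ?B \<or> ?C"
      using shapes
    proof (elim disjE)
      assume "I = {0,1}"
      then have ?B by (rule B) simp_all
      then show ?thesis by (rule disjI2[OF disjI1])
    next
      assume "I = {0,2}"
      then have ?B by (rule B) simp_all
      then show ?thesis by (rule disjI2[OF disjI1])
    next
      assume "I = {1,2}"
      then have ?B by (rule B) simp_all
      then show ?thesis by (rule disjI2[OF disjI1])
    next
      assume "I = {0}"
      then have ?C by (rule C) simp_all
      then show ?thesis by (rule disjI2[OF disjI2])
    next
      assume "I = {1}"
      then have ?C by (rule C) simp_all
      then show ?thesis by (rule disjI2[OF disjI2])
    next
      assume "I = {2}"
      then have ?C by (rule C) simp_all
      then show ?thesis by (rule disjI2[OF disjI2])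
    next
      assume "I = {0,1,2}"
      then have ?A by (rule A)
      then show ?thesis by (rule disjI1)
    qed
    then show ?thesis by (elim disjE) (intro disjI1 disjI2, assumption)+
  qed
qed

section \<open>Harmonic functions and convergence in law\<close>

lemma holder_spaceI:
  assumes "HB B C f"
  shows "(\<lambda>x. complex_of_real (f x)) \<in> holder_space \<alpha>"
  using assms unfolding holder_space_def holder_bd_def by (auto simp flip: of_real_diff)

lemma trans_op_of_real:
  assumes f: "continuous_on simplex2 f" and x: "x \<in> simplex2"
  shows "trans_op p (\<lambda>x. complex_of_real (f x)) x = complex_of_real (P f x)"
  using trans_op_complex[OF _ x, of "\<lambda>x. complex_of_real (f x)"] f P_const[OF x, of 0]
  by (simp add: continuous_on_of_real complex_eq_iff)

lemma hit_complex:
  assumes K: "K \<in> minimal_absorbing p"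
  shows "(\<lambda>x. complex_of_real (hit K x)) \<in> holder_space \<alpha>"
    and "x \<in> simplex2 \<Longrightarrow> trans_op p (\<lambda>x. complex_of_real (hit K x)) x = complex_of_real (hit K x)"
proof -
  obtain C where C: "HB 1 C (hit K)" using hit_HB[OF K] .
  show "(\<lambda>x. complex_of_real (hit K x)) \<in> holder_space \<alpha>" by (rule holder_spaceI[OF C])
  show "x \<in> simplex2 \<Longrightarrow> trans_op p (\<lambda>x. complex_of_real (hit K x)) x = complex_of_real (hit K x)"
    using trans_op_of_real[OF HB_cont[OF C]] hit_harmonic[OF K] by simp
qed

text \<open>The functional is needed only on Hoelder functions, which are continuous, so that integrals
  with respect to Dirac measures can be evaluated.\<close>

lemma geometric_rate_cong:
  assumes "geometric_rate \<alpha> p L"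
    and "\<And>\<phi> x. \<phi> \<in> holder_space \<alpha> \<Longrightarrow> continuous_on simplex2 \<phi> \<Longrightarrow> x \<in> simplex2 \<Longrightarrow> L \<phi> x = L' \<phi> x"
  shows "geometric_rate \<alpha> p L'"
proof -
  have c: "continuous_on simplex2 \<phi>" if "\<phi> \<in> holder_space \<alpha>" for \<phi>
    using complex_holder_bound[OF that] by blast
  obtain \<kappa> \<rho> where k: "\<kappa> > 0" "\<rho> \<in> {0..<1}" "\<forall>\<phi>\<in>holder_space \<alpha>. \<forall>x\<in>simplex2. \<forall>n.
      cmod ((trans_op p ^^ n) \<phi> x - L \<phi> x) \<le> \<kappa> * \<rho> ^ n * holder_norm \<alpha> \<phi>"
    using assms(1) unfolding geometric_rate_def by blast
  have "cmod ((trans_op p ^^ n) \<phi> x - L' \<phi> x) \<le> \<kappa> * \<rho> ^ n * holder_norm \<alpha> \<phi>"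
    if "\<phi> \<in> holder_space \<alpha>" "x \<in> simplex2" for \<phi> x n
    using k(3)[rule_format, OF that, of n] unfolding assms(2)[OF that(1) c[OF that(1)] that(2)] .
  then show ?thesis unfolding geometric_rate_def using k(1,2) by blast
qed

lemma harmonic_pair_hit:
  assumes ij: "i \<in> {0,1,2}" "j \<in> {0,1,2}" "i \<noteq> j" and M: "minimal_absorbing p = {{vertex i}, {vertex j}}"
  shows "harmonic_pair \<alpha> p i j (\<lambda>k x. complex_of_real (hit {vertex k} x))"
proof -
  have K: "{vertex k} \<in> minimal_absorbing p" if "k \<in> {i,j}" for k using that M by auto
  have ne: "vertex i \<noteq> vertex j" using vertex_inj[OF ij(1,2)] ij(3) by simp
  have s: "complex_of_real (hit {vertex i} x) + complex_of_real (hit {vertex j} x) = 1" if x: "x \<in> simplex2" for x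
    using hit_sum[OF x] ne unfolding M by (simp flip: of_real_add)
  have v: "hit {vertex k} (vertex l) = (if k = l then 1 else 0)" if "k \<in> {i,j}" "l \<in> {i,j}" for k l
    using hit_on_minimal[OF K[OF that(1)] K[OF that(2)], of "vertex l"] ne that by auto
  show ?thesis
    unfolding harmonic_pair_def using hit_complex[OF K] s v by auto
qed

text \<open>A harmonic function equals all its iterates, hence their limit, which depends only on its values
  at the two vertices.\<close>

lemma harmonic_pair_unique:
  assumes rate: "geometric_rate \<alpha> p (\<lambda>\<phi> x. h i x * \<phi> (vertex i) + h j x * \<phi> (vertex j))"
    and g: "harmonic_pair \<alpha> p i j g" and ij: "i \<noteq> j" and x: "x \<in> simplex2"
  shows "g i x = h i x \<and> g j x = h j x"
proof -
  obtain \<kappa> \<rho> where k: "\<kappa> > 0" "\<rho> \<in> {0..<1}" "\<forall>\<phi>\<in>holder_space \<alpha>. \<forall>x\<in>simplex2. \<forall>n.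
      cmod ((trans_op p ^^ n) \<phi> x - (h i x * \<phi> (vertex i) + h j x * \<phi> (vertex j))) \<le> \<kappa> * \<rho> ^ n * holder_norm \<alpha> \<phi>"
    using rate unfolding geometric_rate_def by blast
  have "g m x = h i x * g m (vertex i) + h j x * g m (vertex j)" if m: "m \<in> {i,j}" for m
  proof -
    have gm: "g m \<in> holder_space \<alpha>" "\<And>y. y \<in> simplex2 \<Longrightarrow> trans_op p (g m) y = g m y"
      using g m unfolding harmonic_pair_def by blast+
    have fixed: "(trans_op p ^^ n) (g m) y = g m y" if "y \<in> simplex2" for n y
      using that
    proof (induction n arbitrary: y)
      case (Suc n)
      then show ?case using trans_op_cong[of "(trans_op p ^^ n) (g m)" "g m" y] gm(2) by simp
    qed simp
    let ?l = "h i x * g m (vertex i) + h j x * g m (vertex j)"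
    have "cmod (g m x - ?l) \<le> \<kappa> * \<rho> ^ n * holder_norm \<alpha> (g m)" for n
      using k(3)[rule_format, OF gm(1) x, of n] unfolding fixed[OF x] .
    moreover have "(\<lambda>n. \<kappa> * \<rho> ^ n * holder_norm \<alpha> (g m)) \<longlonglongrightarrow> \<kappa> * 0 * holder_norm \<alpha> (g m)"
      using k(2) by (intro tendsto_intros LIMSEQ_power_zero) auto
    ultimately have "cmod (g m x - ?l) \<le> \<kappa> * 0 * holder_norm \<alpha> (g m)"
      by (intro LIMSEQ_le_const) auto
    then show ?thesis by simp
  qed
  then show ?thesis using g ij unfolding harmonic_pair_def by auto
qed

text \<open>By the Stone--Weierstrass theorem Hoelder functions are uniformly dense among the continuous
  ones.\<close>

lemma holder_dense:
  assumes f: "continuous_on simplex2 f" and e: "e > 0"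
  obtains g B C where "HB B C g" "\<forall>x\<in>simplex2. \<bar>f x - g x\<bar> < (e::real)"
proof -
  interpret R: function_ring_on "{g. \<exists>B C. HB B C g}" simplex2
  proof
    fix x y :: point assume xy: "x \<in> simplex2" "y \<in> simplex2" "x \<noteq> y"
    have "HB 2 (2 * 1) (\<lambda>z. dist x z)"
    proof (rule lipschitz_HB)
      fix z z' :: point assume z: "z \<in> simplex2"
      show "\<bar>dist x z\<bar> \<le> 2" using dist_simplex2_le[OF xy(1) z] by simp
      show "\<bar>dist x z - dist x z'\<bar> \<le> 1 * dist z z'"
        using dist_triangle[of x z z'] dist_triangle[of x z' z] by (simp add: dist_commute abs_le_iff)
    qed simp
    moreover have "dist x x \<noteq> dist x y" using xy(3) by simp
    ultimately show "\<exists>f\<in>{g. \<exists>B C. HB B C g}. f x \<noteq> f y" by blast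
  next
    fix f g :: "point \<Rightarrow> real" assume "f \<in> {g. \<exists>B C. HB B C g}" "g \<in> {g. \<exists>B C. HB B C g}"
    then obtain B C B' C' where fg: "HB B C f" "HB B' C' g" by blast
    show "(\<lambda>x. f x + g x) \<in> {g. \<exists>B C. HB B C g}" using HB_lin[OF fg, of 1 1] by auto
    show "(\<lambda>x. f x * g x) \<in> {g. \<exists>B C. HB B C g}" using HB_mult[OF fg] by blast
  next
    show "(\<lambda>_. c) \<in> {g. \<exists>B C. HB B C g}" for c using HB_const by blast
  qed (use compact_simplex2 HB_cont in auto)
  obtain g where "g \<in> {g. \<exists>B C. HB B C g}" "\<forall>x\<in>simplex2. \<bar>f x - g x\<bar> < e"
    using R.Stone_Weierstrass_basic[OF f e] by blast
  then show thesis using that by blast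
qed

text \<open>For Hoelder functions this is the convergence of the iterates, with \<open>hit K = 1\<close>; continuous
  functions are approximated uniformly.\<close>

lemma chain_converges_in_law:
  assumes chain: "df_chain p x M Z" and x: "x \<in> simplex2" and K: "minimal_absorbing p = {K}"
  shows "converges_in_law M Z (stat K)"
  unfolding converges_in_law_def
proof (intro allI impI)
  fix f :: "point \<Rightarrow> real" assume f: "continuous_on simplex2 f"
  have KM: "K \<in> minimal_absorbing p" using K by simp
  interpret S: prob_space "stat K" by (rule stat(1)[OF KM])
  have spS: "space (stat K) = simplex2" by (rule simplex_measure_space[OF stat(2)[OF KM]])
  have int: "integrable (stat K) u" if "continuous_on simplex2 u" for u :: "point \<Rightarrow> real"
    by (rule bounded_measurable_integrable[OF stat(1,2)[OF KM] cont_bounded_measurable[OF that]])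
  show "(\<lambda>n. LINT \<omega>|M. f (Z n \<omega>)) \<longlonglongrightarrow> integral\<^sup>L (stat K) f"
    unfolding chain_expectation[OF chain x f] LIMSEQ_iff
  proof (intro allI impI)
    fix e :: real assume e: "e > 0"
    obtain g B C where g: "HB B C g" "\<forall>x\<in>simplex2. \<bar>f x - g x\<bar> < e / 3"
      using holder_dense[OF f, of "e / 3"] e by (metis zero_less_divide_iff zero_less_numeral)
    have cg: "continuous_on simplex2 g" by (rule HB_cont[OF g(1)])
    have lim: "orbit_lim g x = integral\<^sup>L (stat K) g"
      using orbit_lim_eq[OF g(1) x] hit_sum[OF x] stat(3)[OF KM g(1)] unfolding K by simp
    obtain N where N: "\<forall>n\<ge>N. \<bar>(P ^^ n) g x - orbit_lim g x\<bar> < e / 3"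
      using orbit_lim_uniform[OF g(1), of "e / 3"] e x by auto
    have d1: "\<bar>(P ^^ n) f x - (P ^^ n) g x\<bar> \<le> e / 3" for n
      unfolding Pn_diff[OF f cg x, symmetric]
      by (rule Pn_bound[OF absorbing_simplex2 _ _ x]) (use g(2) in \<open>auto intro!: continuous_intros f cg less_imp_le\<close>)
    have d2: "\<bar>integral\<^sup>L (stat K) f - integral\<^sup>L (stat K) g\<bar> \<le> e / 3"
    proof -
      have "\<bar>integral\<^sup>L (stat K) f - integral\<^sup>L (stat K) g\<bar> = norm (LINT y|stat K. f y - g y)"
        using int[OF f] int[OF cg] by simp
      also have "\<dots> \<le> (LINT y|stat K. norm (f y - g y))" by (rule integral_norm_bound)
      also have "\<dots> \<le> (LINT y|stat K. e / 3)"
        using g(2) int[OF f] int[OF cg] spS by (intro integral_mono) (auto intro: less_imp_le)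
      finally show ?thesis by (simp add: S.prob_space)
    qed
    show "\<exists>N. \<forall>n\<ge>N. norm ((P ^^ n) f x - integral\<^sup>L (stat K) f) < e"
    proof (intro exI allI impI)
      fix n assume "n \<ge> N"
      then have "\<bar>(P ^^ n) g x - integral\<^sup>L (stat K) g\<bar> < e / 3" using N lim by simp
      then show "norm ((P ^^ n) f x - integral\<^sup>L (stat K) f) < e"
        using d1[of n] d2 unfolding real_norm_def by linarith
    qed
  qed
qed

end

section \<open>The six types of limit behaviour\<close>

theorem theorem19:
  fixes \<alpha> :: real and p :: "nat \<Rightarrow> point \<Rightarrow> real"
  assumes alpha: "0 < \<alpha>" "\<alpha> \<le> 1"
    and holder: "\<And>i. i \<in> {0, 1, 2} \<Longrightarrow> (\<lambda>x. complex_of_real (p i x)) \<in> holder_space \<alpha>"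
    and nonneg: "\<And>i x. i \<in> {0, 1, 2} \<Longrightarrow> x \<in> simplex2 \<Longrightarrow> 0 \<le> p i x"
    and sum_one: "\<And>x. x \<in> simplex2 \<Longrightarrow> p 0 x + p 1 x + p 2 x = 1"
  shows
    \<comment> \<open>the six options are exhaustive\<close>
    "(minimal_absorbing p = {{vertex 0}, {vertex 1}, {vertex 2}} \<or>
      (\<exists>i\<in>{0, 1, 2}. \<exists>j\<in>{0, 1, 2}. i \<noteq> j \<and> minimal_absorbing p = {{vertex i}, {vertex j}}) \<or>
      (\<exists>i\<in>{0, 1, 2}. minimal_absorbing p = {{vertex i}}) \<or>
      (\<exists>i\<in>{0, 1, 2}. \<exists>j\<in>{0, 1, 2}. i \<noteq> j \<and> minimal_absorbing p = {edge i j}) \<or>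
      (\<exists>i j k. {i, j, k} = {0, 1, 2} \<and> minimal_absorbing p = {{vertex k}, edge i j}) \<or>
      (\<exists>K. K \<inter> interior simplex2 \<noteq> {} \<and> minimal_absorbing p = {K}))
    \<comment> \<open>option 1\<close>
    \<and> (minimal_absorbing p = {{vertex 0}, {vertex 1}, {vertex 2}} \<longrightarrow>
        invariant_measures p = measure_hull {dirac 0, dirac 1, dirac 2} \<and>
        (\<exists>h :: nat \<Rightarrow> point \<Rightarrow> complex.
          (\<forall>i\<in>{0, 1, 2}. h i \<in> holder_space \<alpha> \<and>
             (\<forall>x\<in>simplex2. h i x \<in> \<real>\<^sub>\<ge>\<^sub>0 \<and> trans_op p (h i) x = h i x)) \<and>
          (\<forall>x\<in>simplex2. h 0 x + h 1 x + h 2 x = 1) \<and>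
          (\<forall>i\<in>{0, 1, 2}. \<forall>j\<in>{0, 1, 2}. i \<noteq> j \<longrightarrow> h i (vertex j) = 0) \<and>
          (\<forall>x\<in>simplex2. \<forall>(M :: 'w measure) Z. df_chain p x M Z \<longrightarrow>
             (\<exists>Zinf\<in>borel_measurable M.
                (\<forall>\<omega>\<in>space M. Zinf \<omega> \<in> {vertex 0, vertex 1, vertex 2}) \<and>
                (AE \<omega> in M. (\<lambda>n. Z n \<omega>) \<longlonglongrightarrow> Zinf \<omega>) \<and>
                (\<forall>i\<in>{0, 1, 2}.
                   complex_of_real (measure M {\<omega>\<in>space M. Zinf \<omega> = vertex i}) = h i x))) \<and>
          geometric_rate \<alpha> p
            (\<lambda>\<phi> x. h 0 x * \<phi> (vertex 0) + h 1 x * \<phi> (vertex 1) + h 2 x * \<phi> (vertex 2))))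
    \<comment> \<open>option 2\<close>
    \<and> (\<forall>i\<in>{0, 1, 2}. \<forall>j\<in>{0, 1, 2}. i \<noteq> j \<and> minimal_absorbing p = {{vertex i}, {vertex j}} \<longrightarrow>
        invariant_measures p = measure_hull {dirac i, dirac j} \<and>
        (\<exists>h. harmonic_pair \<alpha> p i j h \<and>
          (\<forall>g. harmonic_pair \<alpha> p i j g \<longrightarrow> (\<forall>x\<in>simplex2. g i x = h i x \<and> g j x = h j x)) \<and>
          (\<forall>x\<in>simplex2. \<forall>(M :: 'w measure) Z. df_chain p x M Z \<longrightarrow>
             (\<exists>Zinf\<in>borel_measurable M.
                (\<forall>\<omega>\<in>space M. Zinf \<omega> \<in> {vertex i, vertex j}) \<and>
                (AE \<omega> in M. (\<lambda>n. Z n \<omega>) \<longlonglongrightarrow> Zinf \<omega>) \<and>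
                (\<forall>k\<in>{i, j}.
                   complex_of_real (measure M {\<omega>\<in>space M. Zinf \<omega> = vertex k}) = h k x))) \<and>
          geometric_rate \<alpha> p (\<lambda>\<phi> x. h i x * \<phi> (vertex i) + h j x * \<phi> (vertex j))))
    \<comment> \<open>option 3\<close>
    \<and> (\<forall>i\<in>{0, 1, 2}. minimal_absorbing p = {{vertex i}} \<longrightarrow>
        invariant_measures p = {dirac i} \<and>
        (\<forall>x\<in>simplex2. \<forall>(M :: 'w measure) Z. df_chain p x M Z \<longrightarrow>
           (AE \<omega> in M. (\<lambda>n. Z n \<omega>) \<longlonglongrightarrow> vertex i)) \<and>
        geometric_rate \<alpha> p (\<lambda>\<phi> x. \<phi> (vertex i)))
    \<comment> \<open>option 4\<close>
    \<and> (\<forall>i\<in>{0, 1, 2}. \<forall>j\<in>{0, 1, 2}. i \<noteq> j \<and> minimal_absorbing p = {edge i j} \<longrightarrow>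
        (\<exists>\<mu>. is_edge_law p i j \<mu> \<and> invariant_measures p = {\<mu>} \<and>
          (\<forall>x\<in>simplex2. \<forall>(M :: 'w measure) Z. df_chain p x M Z \<longrightarrow>
             (AE \<omega> in M. (\<lambda>n. infdist (Z n \<omega>) (edge i j)) \<longlonglongrightarrow> 0) \<and>
             converges_in_law M Z \<mu>) \<and>
          geometric_rate \<alpha> p (\<lambda>\<phi> x. LINT y|\<mu>. \<phi> y)))
    \<comment> \<open>option 5\<close>
    \<and> (\<forall>i j k. {i, j, k} = {0, 1, 2} \<and> minimal_absorbing p = {{vertex k}, edge i j} \<longrightarrow>
        (\<exists>\<mu>. is_edge_law p i j \<mu> \<and> invariant_measures p = measure_hull {dirac k, \<mu>} \<and>
          (\<exists>hk hij :: point \<Rightarrow> real.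
            (\<forall>x\<in>simplex2. \<forall>(M :: 'w measure) Z. df_chain p x M Z \<longrightarrow>
               measure M {\<omega>\<in>space M. (\<lambda>n. Z n \<omega>) \<longlonglongrightarrow> vertex k} = hk x \<and>
               measure M {\<omega>\<in>space M. (\<lambda>n. infdist (Z n \<omega>) (edge i j)) \<longlonglongrightarrow> 0} = hij x) \<and>
            geometric_rate \<alpha> p
              (\<lambda>\<phi> x. complex_of_real (hk x) * \<phi> (vertex k)
                     + complex_of_real (hij x) * (LINT y|\<mu>. \<phi> y)))))
    \<comment> \<open>option 6\<close>
    \<and> (\<forall>K. K \<inter> interior simplex2 \<noteq> {} \<and> minimal_absorbing p = {K} \<longrightarrow>
        (\<exists>\<mu>. invariant_measures p = {\<mu>} \<and> measure_support \<mu> = K))"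
proof -
  interpret df_weights \<alpha> p by unfold_locales (use alpha holder nonneg sum_one in auto)
  have ne: "vertex a \<noteq> vertex b" if "a \<in> {0,1,2}" "b \<in> {0,1,2}" "a \<noteq> b" for a b
    using vertex_inj[OF that(1,2)] that(3) by simp
  let ?h = "\<lambda>k x. complex_of_real (hit {vertex k} x)"
  show ?thesis
  proof (rule conjI[OF minimal_absorbing_classification conjI[OF _ conjI[OF _ conjI[OF _ conjI[OF _ conjI]]]]],
      goal_cases)
    case 1
    show ?case
    proof (rule impI, goal_cases)
      case 1
      note M = this
      have K: "{vertex i} \<in> minimal_absorbing p" if "i \<in> {0,1,2}" for i using that M by auto
      have d: "vertex 0 \<noteq> vertex 1" "vertex 0 \<noteq> vertex 2" "vertex 1 \<noteq> vertex 2" using ne by auto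
      have st: "stat {vertex i} = dirac i" if "i \<in> {0,1,2}" for i by (rule stat_vertex[OF K[OF that]])
      have sum3: "(\<Sum>K\<in>minimal_absorbing p. F K) = F {vertex 0} + F {vertex 1} + F {vertex 2}"
        for F :: "point set \<Rightarrow> complex" unfolding M using d by (simp add: add.assoc)
      have inv: "invariant_measures p = measure_hull {dirac 0, dirac 1, dirac 2}"
        unfolding invariant_measures_eq M by (simp add: st)
      have hol: "\<forall>i\<in>{0, 1, 2}. ?h i \<in> holder_space \<alpha> \<and>
          (\<forall>x\<in>simplex2. ?h i x \<in> \<real>\<^sub>\<ge>\<^sub>0 \<and> trans_op p (?h i) x = ?h i x)"
        by (intro ballI conjI hit_complex[OF K] iffD2[OF nonneg_Reals_of_real_iff] hit_nonneg[OF K])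
      have one: "\<forall>x\<in>simplex2. ?h 0 x + ?h 1 x + ?h 2 x = 1"
      proof
        fix x assume x: "x \<in> simplex2"
        have "?h 0 x + ?h 1 x + ?h 2 x = complex_of_real (\<Sum>K\<in>minimal_absorbing p. hit K x)"
          unfolding of_real_sum sum3 ..
        then show "?h 0 x + ?h 1 x + ?h 2 x = 1" using hit_sum[OF x] by simp
      qed
      have zero: "\<forall>i\<in>{0, 1, 2}. \<forall>j\<in>{0, 1, 2}. i \<noteq> j \<longrightarrow> ?h i (vertex j) = 0"
      proof (intro ballI impI)
        fix i j :: nat assume ij: "i \<in> {0,1,2}" "j \<in> {0,1,2}" "i \<noteq> j"
        then show "?h i (vertex j) = 0"
          using hit_on_minimal[OF K[OF ij(1)] K[OF ij(2)], of "vertex j"] ne by fastforce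
      qed
      have V: "minimal_absorbing p = (\<lambda>i. {vertex i}) ` {0,1,2}" unfolding M by simp
      have rate: "geometric_rate \<alpha> p
          (\<lambda>\<phi> x. ?h 0 x * \<phi> (vertex 0) + ?h 1 x * \<phi> (vertex 1) + ?h 2 x * \<phi> (vertex 2))"
        by (rule geometric_rate_cong[OF geometric_rate_stat]) (simp add: sum3 st dirac_integral)
      show ?case
        by (intro conjI exI[of _ ?h]; (rule inv hol one zero rate)?)
           (intro ballI allI impI,
            use chain_vertex_limit[OF _ _ V] in \<open>simp only: image_insert image_empty of_real_eq_iff\<close>)
    qed
  next
    case 2
    show ?case
    proof (intro ballI impI, goal_cases)
      case (1 i j)
      then have ij: "i \<in> {0,1,2}" "j \<in> {0,1,2}" "i \<noteq> j"
        and M: "minimal_absorbing p = {{vertex i}, {vertex j}}" by blast+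
      have st: "stat {vertex k} = dirac k" if "k \<in> {i,j}" for k
        by (rule stat_vertex) (use that M in auto)
      have d: "vertex i \<noteq> vertex j" using ne[OF ij] .
      have inv: "invariant_measures p = measure_hull {dirac i, dirac j}"
        unfolding invariant_measures_eq M by (simp add: st)
      have rate: "geometric_rate \<alpha> p (\<lambda>\<phi> x. ?h i x * \<phi> (vertex i) + ?h j x * \<phi> (vertex j))"
        by (rule geometric_rate_cong[OF geometric_rate_stat]) (simp add: M d st dirac_integral)
      have uniq: "\<forall>g. harmonic_pair \<alpha> p i j g \<longrightarrow> (\<forall>x\<in>simplex2. g i x = ?h i x \<and> g j x = ?h j x)"
        by (intro allI impI ballI harmonic_pair_unique[where h = ?h, OF rate _ ij(3)])
      have V: "minimal_absorbing p = (\<lambda>i. {vertex i}) ` {i,j}" unfolding M by simp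
      show ?case
        by (intro conjI exI[of _ ?h]; (rule inv harmonic_pair_hit[OF ij M] uniq rate)?)
           (intro ballI allI impI,
            use chain_vertex_limit[OF _ _ V] in \<open>simp only: image_insert image_empty of_real_eq_iff\<close>)
    qed
  next
    case 3
    show ?case
    proof (intro ballI impI, goal_cases)
      case (1 i)
      then have M: "minimal_absorbing p = {{vertex i}}" by blast
      have K: "{vertex i} \<in> minimal_absorbing p" using M by simp
      note st = stat_vertex[OF K]
      have inv: "invariant_measures p = {dirac i}"
        using measure_hull_singleton[OF stat(1)[OF K]] unfolding invariant_measures_eq M by (simp add: st)
      have h1: "hit {vertex i} x = 1" if "x \<in> simplex2" for x using hit_sum[OF that] unfolding M by simp
      have rate: "geometric_rate \<alpha> p (\<lambda>\<phi> x. \<phi> (vertex i))"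
        by (rule geometric_rate_cong[OF geometric_rate_stat]) (simp add: M h1 st dirac_integral)
      have conv: "AE \<omega> in N. (\<lambda>n. Z n \<omega>) \<longlonglongrightarrow> vertex i"
        if "x \<in> simplex2" "df_chain p x N Z" for x and N :: "'w measure" and Z
        using chain_absorption(1)[OF that(2,1)] unfolding M
        by eventually_elim (simp add: tendsto_iff_infdist_singleton del: infdist_singleton)
      show ?case by (intro conjI ballI allI impI; (rule inv rate | rule conv, assumption+))
    qed
  next
    case 4
    show ?case
    proof (intro ballI impI, goal_cases)
      case (1 i j)
      then have ij: "i \<in> {0,1,2}" "j \<in> {0,1,2}" "i \<noteq> j"
        and M: "minimal_absorbing p = {edge i j}" by blast+
      have K: "edge i j \<in> minimal_absorbing p" using M by simp
      have inv: "invariant_measures p = {stat (edge i j)}"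
        using measure_hull_singleton[OF stat(1)[OF K]] unfolding invariant_measures_eq M by simp
      have h1: "hit (edge i j) x = 1" if "x \<in> simplex2" for x using hit_sum[OF that] unfolding M by simp
      have rate: "geometric_rate \<alpha> p (\<lambda>\<phi> x. LINT y|stat (edge i j). \<phi> y)"
        by (rule geometric_rate_cong[OF geometric_rate_stat]) (simp add: M h1)
      have conv: "AE \<omega> in N. (\<lambda>n. infdist (Z n \<omega>) (edge i j)) \<longlonglongrightarrow> 0"
        if "x \<in> simplex2" "df_chain p x N Z" for x and N :: "'w measure" and Z
        using chain_absorption(1)[OF that(2,1)] unfolding M by eventually_elim simp
      show ?case
        by (intro exI[of _ "stat (edge i j)"] conjI ballI allI impI;
            (rule inv rate stat_edge[OF K ij] | rule conv, assumption+ | rule chain_converges_in_law[OF _ _ M], assumption+))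
    qed
  next
    case 5
    show ?case
    proof (intro allI impI, goal_cases)
      case (1 i j k)
      then have ijk: "{i, j, k} = {0, 1, 2}" and M: "minimal_absorbing p = {{vertex k}, edge i j}" by simp_all
      have "card {i,j,k} = 3" using ijk by simp
      then have nij: "i \<noteq> j" by (auto simp: card_insert_if split: if_splits)
      have ij: "i \<in> {0,1,2}" "j \<in> {0,1,2}" using ijk by blast+
      have K1: "{vertex k} \<in> minimal_absorbing p" and K2: "edge i j \<in> minimal_absorbing p" using M by auto
      have d: "{vertex k} \<noteq> edge i j"
        using ne[OF ij nij] by (metis ends_in_segment singletonD)
      have inv: "invariant_measures p = measure_hull {dirac k, stat (edge i j)}"
        unfolding invariant_measures_eq M by (simp add: stat_vertex[OF K1])
      have rate: "geometric_rate \<alpha> p (\<lambda>\<phi> x. complex_of_real (hit {vertex k} x) * \<phi> (vertex k)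
                     + complex_of_real (hit (edge i j) x) * (LINT y|stat (edge i j). \<phi> y))"
        by (rule geometric_rate_cong[OF geometric_rate_stat])
           (simp add: M d stat_vertex[OF K1] dirac_integral)
      have conv: "measure N {\<omega>\<in>space N. (\<lambda>n. Z n \<omega>) \<longlonglongrightarrow> vertex k} = hit {vertex k} x"
        "measure N {\<omega>\<in>space N. (\<lambda>n. infdist (Z n \<omega>) (edge i j)) \<longlonglongrightarrow> 0} = hit (edge i j) x"
        if "x \<in> simplex2" "df_chain p x N Z" for x and N :: "'w measure" and Z
        using chain_absorption(2)[OF that(2,1) K1] chain_absorption(2)[OF that(2,1) K2]
        unfolding tendsto_iff_infdist_singleton .
      show ?case
        by (rule exI[of _ "stat (edge i j)"], intro conjI, rule stat_edge[OF K2 ij nij], rule inv,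
            intro exI[of _ "hit {vertex k}"] exI[of _ "hit (edge i j)"] conjI ballI allI impI;
            (rule rate | rule conv, assumption+))
    qed
  next
    case 6
    show ?case
    proof (intro allI impI, goal_cases)
      case (1 K)
      then have M: "minimal_absorbing p = {K}" by blast
      have K: "K \<in> minimal_absorbing p" using M by simp
      have "invariant_measures p = {stat K}"
        using measure_hull_singleton[OF stat(1)[OF K]] unfolding invariant_measures_eq M by simp
      then show ?case using stat_support[OF K] by (intro exI[of _ "stat K"] conjI)
    qed
  qed
qed

end
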